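(* There exists a universal constant $C\ge1$ with the following property. Let $\mathbb X=L^p[0,1]$, $1<p<\infty$, with its usual norm, let $\tau\in(0,1]$, and let $\mathcal D=\Psi$ be a normalized basis of $L^p[0,1]$ which is greedy with respect to the Thresholding Greedy Algorithm. Let $$\alpha(p)=1\ \text{ if }1<p\le2,\qquad \alpha(p)=2/p'\ \text{ if }2<p<\infty.$$ Then there is $c=c(p,\tau,\Psi)>0$ such that the Weak Chebyshev Greedy Algorithm with weakness parameter $\tau$ satisfies $$\big\|f-\mathscr G_{\lfloor cN^{\alpha(p)}\rfloor}(f)\big\|_p\le C\,\sigma_N(f)\qquad\text{for all }N\ge1,\ f\in L^p[0,1].$$
   Context: Here $p'=p/(p-1)$. Scalars are $\mathbb R$ or $\mathbb C$. Thresholding Greedy Algorithm (TGA): if $\Psi=\{\psi_k\}_{k\ge1}$ is a normalized (Schauder) basis and $f=\sum_kc_k\psi_k$, then $G_N(f,\Psi)=\sum_{j=1}^Nc_{k_j}\psi_{k_j}$ where $|c_{k_1}|\ge|c_{k_2}|\ge\cdots$. The basis $\Psi$ is greedy with respect to the TGA if there is a constant $C_\Psi$ with $\|f-G_N(f,\Psi)\|\le C_\Psi\,\sigma_N(f)$ for all $f$ and all $N\ge1$ (equivalently, $\Psi$ is unconditional and democratic). $\Sigma_N$ is the set of linear combinations of at most $N$ elements of $\mathcal D$, and $\sigma_N(f)=\inf_{a\in\Sigma_N}\|f-a\|$. For $f\neq0$, $F_f\in\mathbb X^*$ is the norming functional: $\|F_f\|_{\mathbb X^*}=1$, $F_f(f)=\|f\|$.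 Square brackets denote linear span. Weak Chebyshev Greedy Algorithm (WCGA) with parameter $\tau\in(0,1]$: given $f\neq0$ put $f_0=f$. At step $n+1$ choose any $\varphi_{i_{n+1}}\in\mathcal D$ with $|F_{f_n}(\varphi_{i_{n+1}})|\ge\tau\sup_{\varphi\in\mathcal D}|F_{f_n}(\varphi)|$; let $\mathscr G_{n+1}(f)$ be any element of $[\varphi_{i_1},\dots,\varphi_{i_{n+1}}]$ with $\|f-\mathscr G_{n+1}(f)\|=\mathrm{dist}(f,[\varphi_{i_1},\dots,\varphi_{i_{n+1}}])$; put $f_{n+1}=f-\mathscr G_{n+1}(f)$. Iterate indefinitely, or until the remainder is $0$ (in which case the later remainders are also taken to be $0$). Also $\mathscr G_0(f)=0$. A bound for $\|f-\mathscr G_n(f)\|$ is understood to hold for every admissible run of the algorithm. *)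

theory Defs
  imports "HOL-Analysis.Analysis" "HOL-Library.Function_Algebras"
begin

text \<open>
  Elements of \<open>L\<^sup>p[0,1]\<close> are represented by measurable functions, not by their classes modulo
  almost everywhere equality. Two representatives of the same class are at \<open>Lnorm\<close>-distance 0,
  so an equation \<open>f = 0\<close> in \<open>L\<^sup>p\<close> reads \<open>Lnorm p f = 0\<close>. Values outside \<open>[0,1]\<close> play no role.
  The scalar field \<open>'k\<close> is instantiated by \<open>real\<close> and by \<open>complex\<close>.
\<close>

definition Lp :: "real \<Rightarrow> (real \<Rightarrow> 'k::real_normed_field) set" where
  "Lp p = {f \<in> borel_measurable (lebesgue_on {0..1}).
             integrable (lebesgue_on {0..1}) (\<lambda>x. norm (f x) powr p)}"

definition Lnorm :: "real \<Rightarrow> (real \<Rightarrow> 'k::real_normed_field) \<Rightarrow> real" where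
  "Lnorm p f = (integral\<^sup>L (lebesgue_on {0..1}) (\<lambda>x. norm (f x) powr p)) powr (1 / p)"

definition fscale :: "'k::real_normed_field \<Rightarrow> (real \<Rightarrow> 'k) \<Rightarrow> (real \<Rightarrow> 'k)" (infixr \<open>*\<^sub>F\<close> 75) where
  "a *\<^sub>F f = (\<lambda>x. a * f x)"

global_interpretation fscale: vector_space "fscale :: 'k::real_normed_field \<Rightarrow> _"
  by unfold_locales (auto simp: fscale_def fun_eq_iff algebra_simps)

text \<open>
  Functionals are constrained on \<open>Lp p\<close> only. Boundedness makes them well defined modulo
  almost everywhere equality.
\<close>

definition Lp_dual :: "real \<Rightarrow> ((real \<Rightarrow> 'k::real_normed_field) \<Rightarrow> 'k) set" where
  "Lp_dual p = {F.
     (\<forall>f\<in>Lp p. \<forall>g\<in>Lp p. F (f + g) = F f + F g) \<and>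
     (\<forall>a. \<forall>f\<in>Lp p. F (a *\<^sub>F f) = a * F f) \<and>
     (\<exists>K. \<forall>f\<in>Lp p. norm (F f) \<le> K * Lnorm p f)}"

definition dual_norm :: "real \<Rightarrow> ((real \<Rightarrow> 'k::real_normed_field) \<Rightarrow> 'k) \<Rightarrow> real" where
  "dual_norm p F = (SUP f\<in>{f \<in> Lp p. Lnorm p f \<le> 1}. norm (F f))"

definition norming_functional ::
    "real \<Rightarrow> (real \<Rightarrow> 'k::real_normed_field) \<Rightarrow> ((real \<Rightarrow> 'k) \<Rightarrow> 'k) \<Rightarrow> bool" where
  "norming_functional p f F \<longleftrightarrow>
     F \<in> Lp_dual p \<and> dual_norm p F = 1 \<and> F f = of_real (Lnorm p f)"

definition Sigma_N :: "(real \<Rightarrow> 'k::real_normed_field) set \<Rightarrow> nat \<Rightarrow> (real \<Rightarrow> 'k) set" where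
  "Sigma_N D N = {(\<Sum>g\<in>A. a g *\<^sub>F g) | A a. A \<subseteq> D \<and> finite A \<and> card A \<le> N}"

definition Lp_dist :: "real \<Rightarrow> (real \<Rightarrow> 'k::real_normed_field) \<Rightarrow> (real \<Rightarrow> 'k) set \<Rightarrow> real" where
  "Lp_dist p f S = (INF g\<in>S. Lnorm p (f - g))"

definition sigma_N ::
    "real \<Rightarrow> (real \<Rightarrow> 'k::real_normed_field) set \<Rightarrow> nat \<Rightarrow> (real \<Rightarrow> 'k) \<Rightarrow> real" where
  "sigma_N p D N f = Lp_dist p f (Sigma_N D N)"

definition expansion ::
    "real \<Rightarrow> (nat \<Rightarrow> real \<Rightarrow> 'k::real_normed_field) \<Rightarrow> (real \<Rightarrow> 'k) \<Rightarrow> (nat \<Rightarrow> 'k) \<Rightarrow> bool" where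
  "expansion p \<Psi> f c \<longleftrightarrow> (\<lambda>n. Lnorm p (f - (\<Sum>k<n. c k *\<^sub>F \<Psi> k))) \<longlonglongrightarrow> 0"

definition schauder_basis :: "real \<Rightarrow> (nat \<Rightarrow> real \<Rightarrow> 'k::real_normed_field) \<Rightarrow> bool" where
  "schauder_basis p \<Psi> \<longleftrightarrow> (\<forall>k. \<Psi> k \<in> Lp p) \<and> (\<forall>f\<in>Lp p. \<exists>!c. expansion p \<Psi> f c)"

definition normalized :: "real \<Rightarrow> (nat \<Rightarrow> real \<Rightarrow> 'k::real_normed_field) \<Rightarrow> bool" where
  "normalized p \<Psi> \<longleftrightarrow> (\<forall>k. Lnorm p (\<Psi> k) = 1)"

text \<open>
  An ordering need not list every index: if infinitely many coefficients are nonzero, a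
  nonincreasing enumeration of them never reaches the zero ones.
\<close>

definition decreasing_ordering :: "(nat \<Rightarrow> 'k::real_normed_field) \<Rightarrow> (nat \<Rightarrow> nat) \<Rightarrow> bool" where
  "decreasing_ordering c \<rho> \<longleftrightarrow>
     inj \<rho> \<and> {k. c k \<noteq> 0} \<subseteq> range \<rho> \<and> antimono (\<lambda>j. norm (c (\<rho> j)))"

definition TGA ::
    "(nat \<Rightarrow> real \<Rightarrow> 'k::real_normed_field) \<Rightarrow> (nat \<Rightarrow> 'k) \<Rightarrow> (nat \<Rightarrow> nat) \<Rightarrow> nat \<Rightarrow> (real \<Rightarrow> 'k)" where
  "TGA \<Psi> c \<rho> N = (\<Sum>j<N. c (\<rho> j) *\<^sub>F \<Psi> (\<rho> j))"

text \<open>When coefficients have equal modulus, the bound is required for every way of breaking ties.\<close>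

definition greedy_basis :: "real \<Rightarrow> (nat \<Rightarrow> real \<Rightarrow> 'k::real_normed_field) \<Rightarrow> bool" where
  "greedy_basis p \<Psi> \<longleftrightarrow> schauder_basis p \<Psi> \<and> normalized p \<Psi> \<and>
     (\<exists>C. \<forall>f\<in>Lp p. \<forall>c \<rho>. expansion p \<Psi> f c \<longrightarrow> decreasing_ordering c \<rho> \<longrightarrow>
        (\<forall>N\<ge>1. Lnorm p (f - TGA \<Psi> c \<rho> N) \<le> C * sigma_N p (range \<Psi>) N f))"

text \<open>
  \<open>\<phi> n\<close> is the dictionary element selected at step \<open>n + 1\<close>, \<open>G n\<close> is the \<open>n\<close>-th approximant and
  \<open>f - G n\<close> the \<open>n\<close>-th remainder. Once a remainder vanishes nothing more is selected, and all later
  remainders vanish.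
\<close>

definition WCGA_run ::
    "real \<Rightarrow> (real \<Rightarrow> 'k::real_normed_field) set \<Rightarrow> real \<Rightarrow> (real \<Rightarrow> 'k)
      \<Rightarrow> (nat \<Rightarrow> real \<Rightarrow> 'k) \<Rightarrow> (nat \<Rightarrow> real \<Rightarrow> 'k) \<Rightarrow> bool" where
  "WCGA_run p D \<tau> f \<phi> G \<longleftrightarrow> G 0 = 0 \<and>
     (\<forall>n. if Lnorm p (f - G n) = 0
          then G (Suc n) \<in> Lp p \<and> Lnorm p (f - G (Suc n)) = 0
          else \<phi> n \<in> D \<and>
            (\<exists>F. norming_functional p (f - G n) F \<and>
                 norm (F (\<phi> n)) \<ge> \<tau> * (SUP g\<in>D. norm (F g))) \<and>
            G (Suc n) \<in> fscale.span (\<phi> ` {..n}) \<and>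
            Lnorm p (f - G (Suc n)) = Lp_dist p f (fscale.span (\<phi> ` {..n})))"

definition conjugate_exponent :: "real \<Rightarrow> real" where
  "conjugate_exponent p = p / (p - 1)"

definition \<alpha> :: "real \<Rightarrow> real" where
  "\<alpha> p = (if p \<le> 2 then 1 else 2 / conjugate_exponent p)"

end

theory Submission
  imports Defs
begin

text \<open>
  A greedy basis is unconditional and democratic, and in \<open>L\<^sup>p\<close> the sum of any \<open>N\<close> basis elements has
  norm at least a constant times \<open>N\<^bsup>1/p\<^esup>\<close>: for \<open>p \<ge> 2\<close> by Clarkson's inequality, for \<open>p < 2\<close> because
  otherwise the basis would be equivalent to that of \<open>\<ell>\<^sup>2\<close>. Hence the coefficients of \<open>f\<close> on a set \<open>A\<close>
  have absolute sum at most \<open>V |A|\<^bsup>1/p'\<^esup> \<parallel>f\<parallel>\<close>. If \<open>h\<close> is the current remainder and \<open>A\<close> a set of not yet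
  selected indices outside of which the unselected part of a near-best \<open>N\<close>-term approximant is
  small compared to \<open>h\<close>, the norming functional of \<open>h\<close> is then at least a constant times
  \<open>|A|\<^bsup>-1/p'\<^esup>\<close> on some basis element, and since the norm is smooth of power type \<open>q = min p 2\<close>, the next
  step shrinks the remainder by a factor \<open>1 - \<kappa> |A|\<^bsup>-\<alpha>\<^esup>\<close> with \<open>\<alpha> = q'/p'\<close>. Running through sets \<open>A\<close> of
  dyadically increasing sizes until the first size at which the unselected part drops by a large
  factor, one selects a proportional number of the missing indices; by superadditivity of \<open>t\<^sup>\<alpha>\<close> all
  indices are exhausted, or the error is already small, after \<open>O(N\<^sup>\<alpha>)\<close> steps.
\<close>

section \<open>Scalar inequalities\<close>

text \<open>Contracting with one fixed set of size N would cost a factor ln(||f|| / sigma_N(f)) in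
  the number of steps, and this ratio is unbounded. Hence the stages: each has to lower the
  remainder by a bounded factor only, and the steps of a whole phase are charged to the indices that
  it selects. The constants of the basis enter only the number of steps. The error constant stays 4:
  a remainder above 4 epsilon leaves half of its norm for the functional to see on A, after a
  quarter is given to the approximation error and a quarter to the indices outside A. For p < 2,
  cotype 2 alone would bound sums of N basis elements below by N^(1/2) only, and the same argument
  would end with the exponent p'/2 > 1 in place of 1. Cotype serves instead to show that some
  coefficient functionals are small on bounded functions; such a functional sees a fixed amount of
  one layer of values, and disjoint layers add p-th powers.\<close>

lemma young_powr:
  fixes x y r :: real
  assumes "0 \<le> r" "r \<le> 1" "0 \<le> x" "0 \<le> y"
  shows "x powr r * y powr (1 - r) \<le> r * x + (1 - r) * y"
proof (cases "x = 0 \<or> y = 0")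
  case True
  with assms show ?thesis by auto
next
  case False
  with assms show ?thesis
    using Youngs_inequality_0[of r "1 - r" x y] by auto
qed

lemma powr_add_superadditive:
  fixes x y s :: real
  assumes "1 \<le> s" "0 \<le> x" "0 \<le> y"
  shows "x powr s + y powr s \<le> (x + y) powr s"
proof -
  have *: "u powr s \<le> u * (x + y) powr (s - 1)" if "0 \<le> u" "u \<le> x + y" for u
  proof -
    have "u powr s = u * u powr (s - 1)"
      using that powr_mult_base[of u "s - 1"] by simp
    also have "\<dots> \<le> u * (x + y) powr (s - 1)"
      using that assms by (intro mult_left_mono powr_mono2) auto
    finally show ?thesis .
  qed
  have "x powr s + y powr s \<le> (x + y) * (x + y) powr (s - 1)"
    using *[of x] *[of y] assms by (simp add: distrib_right)
  also have "\<dots> = (x + y) powr s"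
    using powr_mult_base[of "x + y" "s - 1"] assms by simp
  finally show ?thesis .
qed

lemma powr_add_subadditive:
  fixes x y s :: real
  assumes "0 < s" "s \<le> 1" "0 \<le> x" "0 \<le> y"
  shows "(x + y) powr s \<le> x powr s + y powr s"
proof -
  have "x + y = (x powr s) powr (1/s) + (y powr s) powr (1/s)"
    using assms by (simp add: powr_powr)
  also have "\<dots> \<le> (x powr s + y powr s) powr (1/s)"
    using assms by (intro powr_add_superadditive) auto
  finally have "(x + y) powr s \<le> ((x powr s + y powr s) powr (1/s)) powr s"
    using assms by (intro powr_mono2) auto
  then show ?thesis using assms by (simp add: powr_powr)
qed

text \<open>The tangent of the convex function t^s at z lies below it: u^s >= z^s + s z^(s-1) (u -
  z). The terms are arranged so that Young's inequality proves it, without derivatives and with z =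
  0 allowed.\<close>

lemma powr_tangent_ineq:
  fixes u z s :: real
  assumes "1 \<le> s" "0 \<le> u" "0 \<le> z"
  shows "s * (u * z powr (s - 1)) \<le> u powr s + (s - 1) * z powr s"
proof -
  have "s * (1 - 1/s) = s - 1" using assms by (simp add: field_simps)
  then have "s * (u * z powr (s - 1)) = s * ((u powr s) powr (1/s) * (z powr s) powr (1 - 1/s))"
    using assms by (simp add: powr_powr)
  also have "\<dots> \<le> s * (1/s * u powr s + (1 - 1/s) * z powr s)"
    using assms by (intro mult_left_mono young_powr) auto
  also have "\<dots> = u powr s + (s - 1) * z powr s"
    using assms by (simp add: field_simps)
  finally show ?thesis .
qed

lemma powr_convex_ineq:
  fixes x y s t :: real
  assumes "1 \<le> s" "0 \<le> x" "0 \<le> y" "0 \<le> t" "t \<le> 1"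
  shows "((1 - t) * x + t * y) powr s \<le> (1 - t) * x powr s + t * y powr s"
proof -
  define z where "z = (1 - t) * x + t * y"
  have z: "z \<ge> 0" using assms by (simp add: z_def)
  define w where "w = z powr (s - 1)"
  have "s * z powr s = s * (z * w)"
    using powr_mult_base[of z "s - 1"] z by (simp add: w_def)
  also have "\<dots> = (1 - t) * (s * (x * w)) + t * (s * (y * w))"
    by (simp add: z_def algebra_simps)
  also have "\<dots> \<le> (1 - t) * (x powr s + (s - 1) * z powr s) + t * (y powr s + (s - 1) * z powr s)"
    unfolding w_def using assms z by (intro add_mono mult_left_mono powr_tangent_ineq) auto
  finally show ?thesis unfolding z_def[symmetric] by (simp add: algebra_simps)
qed

lemma powr_concave_ineq:
  fixes x y s t :: real
  assumes "0 < s" "s \<le> 1" "0 \<le> x" "0 \<le> y" "0 \<le> t" "t \<le> 1"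
  shows "(1 - t) * x powr s + t * y powr s \<le> ((1 - t) * x + t * y) powr s"
proof -
  have "((1 - t) * x powr s + t * y powr s) powr (1/s)
      \<le> (1 - t) * (x powr s) powr (1/s) + t * (y powr s) powr (1/s)"
    using assms by (intro powr_convex_ineq) auto
  also have "\<dots> = (1 - t) * x + t * y"
    using assms by (simp add: powr_powr)
  finally have "(((1 - t) * x powr s + t * y powr s) powr (1/s)) powr s \<le> ((1 - t) * x + t * y) powr s"
    using assms by (intro powr_mono2) auto
  then show ?thesis using assms by (simp add: powr_powr)
qed

section \<open>Powers of norms in real inner product spaces\<close>

lemma norm_powr_conv:
  fixes a :: "'a::real_normed_vector"
  shows "norm a powr p = ((norm a)\<^sup>2) powr (p/2)"
proof -
  have "(norm a)\<^sup>2 = norm a powr 2" by simp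
  then show ?thesis by (simp add: powr_powr del: powr_numeral)
qed

lemma norm_add_powr_conv:
  fixes a b :: "'a::real_inner"
  shows "norm (a + b) powr p = ((norm a)\<^sup>2 + (norm b)\<^sup>2 + 2 * inner a b) powr (p/2)"
    and "norm (a - b) powr p = ((norm a)\<^sup>2 + (norm b)\<^sup>2 - 2 * inner a b) powr (p/2)"
  by (simp_all add: norm_powr_conv[of _ p] power2_norm_eq_inner inner_add inner_diff inner_commute algebra_simps)

lemma two_inner_le:
  fixes a b :: "'a::real_inner"
  shows "\<bar>2 * inner a b\<bar> \<le> (norm a)\<^sup>2 + (norm b)\<^sup>2"
proof -
  have "\<bar>inner a b\<bar> \<le> norm a * norm b" by (rule Cauchy_Schwarz_ineq2)
  moreover have "0 \<le> (norm a - norm b)\<^sup>2" by simp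
  ultimately show ?thesis by (simp add: power2_diff)
qed

text \<open>With X = |a|^2 + |b|^2 and Y = 2 <a,b> the right side is (X+Y)^(p/2) + (X-Y)^(p/2), so
  convexity and superadditivity of t^(p/2) suffice. For p <= 2 both inequalities reverse, which
  gives \<open>clarkson_le\<close>.\<close>

lemma clarkson_ge:
  fixes a b :: "'a::real_inner"
  assumes "2 \<le> p"
  shows "2 * norm a powr p + 2 * norm b powr p \<le> norm (a + b) powr p + norm (a - b) powr p"
proof -
  define X Y where "X = (norm a)\<^sup>2 + (norm b)\<^sup>2" and "Y = 2 * inner a b"
  have Y: "\<bar>Y\<bar> \<le> X" unfolding X_def Y_def by (rule two_inner_le)
  have "norm a powr p + norm b powr p \<le> X powr (p/2)"
    unfolding norm_powr_conv[of _ p] X_def using assms by (intro powr_add_superadditive) auto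
  also have "X powr (p/2) = ((1 - 1/2) * (X + Y) + 1/2 * (X - Y)) powr (p/2)"
    by (simp add: field_simps)
  also have "\<dots> \<le> (1 - 1/2) * (X + Y) powr (p/2) + 1/2 * (X - Y) powr (p/2)"
    using assms Y by (intro powr_convex_ineq) auto
  finally show ?thesis
    unfolding norm_add_powr_conv[of a b p] X_def[symmetric] Y_def[symmetric] by simp
qed

lemma clarkson_le:
  fixes a b :: "'a::real_inner"
  assumes "0 < p" "p \<le> 2"
  shows "norm (a + b) powr p + norm (a - b) powr p \<le> 2 * norm a powr p + 2 * norm b powr p"
proof -
  define X Y where "X = (norm a)\<^sup>2 + (norm b)\<^sup>2" and "Y = 2 * inner a b"
  have Y: "\<bar>Y\<bar> \<le> X" unfolding X_def Y_def by (rule two_inner_le)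
  have "(1 - 1/2) * (X + Y) powr (p/2) + 1/2 * (X - Y) powr (p/2)
      \<le> ((1 - 1/2) * (X + Y) + 1/2 * (X - Y)) powr (p/2)"
    using assms Y by (intro powr_concave_ineq) auto
  also have "\<dots> = X powr (p/2)" by (simp add: field_simps)
  also have "\<dots> \<le> norm a powr p + norm b powr p"
    unfolding norm_powr_conv[of _ p] X_def using assms by (intro powr_add_subadditive) auto
  finally show ?thesis
    unfolding norm_add_powr_conv[of a b p] X_def[symmetric] Y_def[symmetric] by simp
qed

text \<open>A mean value bound with the power taken at the larger point x. In the application the
  smaller point may be 0 while the exponent \<open>\<theta> - 1\<close> is negative. For exponents
  below 1 the bound survives because y x^(theta-1) <= y^theta.\<close>

lemma powr_diff_le_linear:
  fixes x y \<theta> :: real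
  assumes "0 \<le> \<theta>" "0 \<le> y" "y \<le> x"
  shows "x powr \<theta> - y powr \<theta> \<le> max 1 \<theta> * ((x - y) * x powr (\<theta> - 1))"
proof (cases "1 \<le> \<theta>")
  case True
  have "x powr \<theta> = x * x powr (\<theta> - 1)" using powr_mult_base[of x "\<theta> - 1"] assms by simp
  then show ?thesis
    using powr_tangent_ineq[OF True, of y x] assms True by (simp add: max_def algebra_simps)
next
  case False
  have "y * x powr (\<theta> - 1) \<le> y powr \<theta>"
  proof (cases "y = 0")
    case y: False
    then have "y * x powr (\<theta> - 1) \<le> y * y powr (\<theta> - 1)"
      using assms False by (intro mult_left_mono powr_mono2') auto
    then show ?thesis using powr_mult_base[of y "\<theta> - 1"] assms by simp
  qed simp
  moreover have "x powr \<theta> = x * x powr (\<theta> - 1)" using powr_mult_base[of x "\<theta> - 1"] assms by simp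
  ultimately show ?thesis using False by (simp add: max_def algebra_simps)
qed

lemma norm_powr_smooth_le2:
  fixes a b :: "'a::real_inner"
  assumes "1 < p" "p \<le> 2" "0 \<le> \<mu>" "\<mu> \<le> 1"
  shows "norm (a + \<mu> *\<^sub>R b) powr p + norm (a - \<mu> *\<^sub>R b) powr p
    \<le> 2 * norm a powr p + 2 * \<mu> powr p * (norm a powr p + norm b powr p)"
proof -
  have "norm (a + \<mu> *\<^sub>R b) powr p + norm (a - \<mu> *\<^sub>R b) powr p
      \<le> 2 * norm a powr p + 2 * norm (\<mu> *\<^sub>R b) powr p"
    using assms by (intro clarkson_le) auto
  also have "norm (\<mu> *\<^sub>R b) powr p = \<mu> powr p * norm b powr p"
    using assms by (simp add: powr_mult)
  also have "2 * norm a powr p + 2 * (\<mu> powr p * norm b powr p) \<le>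
    2 * norm a powr p + 2 * \<mu> powr p * (norm a powr p + norm b powr p)"
    by (simp add: algebra_simps)
  finally show ?thesis .
qed

text \<open>The two powers are (X+y)^r and (X-y)^r with r = p/2. Tangents at both points, compared
  at A = |a|^2, leave terms in mu^2 |b|^2 and y times the difference of two (r-1)-th powers. That
  difference is of order y, and y^2 is of order mu^2 by the Cauchy-Schwarz inequality; so no term of
  first order in mu remains.\<close>

lemma norm_powr_smooth_ge2:
  fixes p :: real
  assumes "2 \<le> p"
  obtains K where "K \<ge> 0"
    "\<And>(a::'a::real_inner) b \<mu>. 0 \<le> \<mu> \<Longrightarrow> \<mu> \<le> 1 \<Longrightarrow>
       norm (a + \<mu> *\<^sub>R b) powr p + norm (a - \<mu> *\<^sub>R b) powr p
         \<le> 2 * norm a powr p + K * \<mu> powr 2 * (norm a powr p + norm b powr p)"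
proof -
  define r m where "r = p / 2" and "m = max 1 (r - 1)"
  have r: "1 \<le> r" and m: "0 \<le> m" using assms by (auto simp: r_def m_def)
  \<comment> \<open>The part 2r comes from the terms in mu^2 |b|^2, the part 8rm from the terms in
    y^2, and 4^r from x <= 2(A+B).\<close>
  define K where "K = (2 * r + 8 * r * m) * 4 powr r"
  have "norm (a + \<mu> *\<^sub>R b) powr p + norm (a - \<mu> *\<^sub>R b) powr p
         \<le> 2 * norm a powr p + K * \<mu> powr 2 * (norm a powr p + norm b powr p)"
    if \<mu>: "0 \<le> \<mu>" "\<mu> \<le> 1" for a b :: 'a and \<mu>
  proof -
    define A B Y where "A = (norm a)\<^sup>2" and "B = (norm b)\<^sup>2" and "Y = 2 * (\<mu> * inner a b)"
    define X y where "X = A + \<mu>\<^sup>2 * B" and "y = \<bar>Y\<bar>"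
    define x where "x = X + y"
    have AB: "0 \<le> A" "0 \<le> B" by (auto simp: A_def B_def)
    have \<mu>2: "0 \<le> \<mu>\<^sup>2" "\<mu>\<^sup>2 \<le> 1" using \<mu> by (auto simp: power_le_one)
    have y: "0 \<le> y" "y \<le> X"
      using two_inner_le[of a "\<mu> *\<^sub>R b"] \<mu>
      by (simp_all add: y_def X_def Y_def A_def B_def power_mult_distrib)
    have x: "0 \<le> x" "A \<le> x" "x \<le> 2 * (A + B)"
      using y AB mult_right_mono[OF \<mu>2(2), of B] \<mu>2 by (auto simp: x_def X_def)
    have tangent: "z powr r \<le> A powr r + r * ((z - A) * z powr (r - 1))" if "0 \<le> z" for z
      using powr_tangent_ineq[OF r AB(1) that] powr_mult_base[OF that, of "r - 1"]
      by (simp add: algebra_simps)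
    have "norm (a + \<mu> *\<^sub>R b) powr p + norm (a - \<mu> *\<^sub>R b) powr p = (X + Y) powr r + (X - Y) powr r"
      unfolding norm_add_powr_conv X_def Y_def A_def B_def r_def by (simp add: power_mult_distrib)
    also have "\<dots> = x powr r + (X - y) powr r" by (cases "0 \<le> Y") (auto simp: x_def y_def)
    also have "\<dots> \<le> (A powr r + r * ((x - A) * x powr (r - 1)))
        + (A powr r + r * ((X - y - A) * (X - y) powr (r - 1)))"
      using x y by (intro add_mono tangent) auto
    also have "\<dots> = 2 * A powr r + r * (\<mu>\<^sup>2 * B * (x powr (r - 1) + (X - y) powr (r - 1)))
        + r * (y * (x powr (r - 1) - (X - y) powr (r - 1)))"
      by (simp add: x_def X_def algebra_simps)
    also have "\<dots> \<le> 2 * A powr r + r * (\<mu>\<^sup>2 * B * (x powr (r - 1) + x powr (r - 1)))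
        + r * (y * (m * ((x - (X - y)) * x powr (r - 1 - 1))))"
      unfolding m_def using r y AB \<mu>2
      by (intro add_mono mult_left_mono powr_mono2 powr_diff_le_linear) (auto simp: x_def)
    also have "\<dots> = 2 * A powr r + 2 * r * \<mu>\<^sup>2 * (B * x powr (r - 1)) + 2 * r * m * (y\<^sup>2 * x powr (r - 1 - 1))"
      by (simp add: x_def power2_eq_square algebra_simps)
    finally have main: "norm (a + \<mu> *\<^sub>R b) powr p + norm (a - \<mu> *\<^sub>R b) powr p
        \<le> 2 * A powr r + 2 * r * \<mu>\<^sup>2 * (B * x powr (r - 1)) + 2 * r * m * (y\<^sup>2 * x powr (r - 1 - 1))" .
    have h1: "y\<^sup>2 * x powr (r - 1 - 1) \<le> 4 * \<mu>\<^sup>2 * (B * x powr (r - 1))"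
    proof -
      have "(inner a b)\<^sup>2 \<le> A * B"
        using Cauchy_Schwarz_ineq[of a b] by (simp add: A_def B_def power2_norm_eq_inner)
      then have "\<mu>\<^sup>2 * (inner a b)\<^sup>2 \<le> \<mu>\<^sup>2 * (x * B)"
        using mult_right_mono[OF x(2) AB(2)] \<mu>2 by (intro mult_left_mono) auto
      then have "y\<^sup>2 \<le> 4 * \<mu>\<^sup>2 * (B * x)" by (simp add: y_def Y_def power_mult_distrib mult_ac)
      then have "y\<^sup>2 * x powr (r - 1 - 1) \<le> 4 * \<mu>\<^sup>2 * (B * x) * x powr (r - 1 - 1)"
        by (intro mult_right_mono) auto
      then show ?thesis using powr_mult_base[OF x(1), of "r - 1 - 1"] by (simp add: mult.assoc)
    qed
    have h2: "B * x powr (r - 1) \<le> 4 powr r * (A powr r + B powr r)"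
    proof -
      have "B * x powr (r - 1) \<le> 2 * (A + B) * (2 * (A + B)) powr (r - 1)"
        using AB x r by (intro mult_mono powr_mono2) auto
      also have "\<dots> = (4 * ((1 - 1/2) * A + 1/2 * B)) powr r"
        using powr_mult_base[of "2 * (A + B)" "r - 1"] AB by (simp add: algebra_simps)
      also have "\<dots> = 4 powr r * ((1 - 1/2) * A + 1/2 * B) powr r" by (rule powr_mult)
      also have "\<dots> \<le> 4 powr r * ((1 - 1/2) * A powr r + 1/2 * B powr r)"
        using AB r by (intro mult_left_mono powr_convex_ineq) auto
      also have "\<dots> \<le> 4 powr r * (A powr r + B powr r)"
        by (intro mult_left_mono add_mono mult_left_le_one_le) auto
      finally show ?thesis .
    qed
    note main
    also have "2 * A powr r + 2 * r * \<mu>\<^sup>2 * (B * x powr (r - 1)) + 2 * r * m * (y\<^sup>2 * x powr (r - 1 - 1))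
        \<le> 2 * A powr r + 2 * r * \<mu>\<^sup>2 * (B * x powr (r - 1)) + 2 * r * m * (4 * \<mu>\<^sup>2 * (B * x powr (r - 1)))"
      using r m by (intro add_left_mono mult_left_mono h1) auto
    also have "\<dots> = 2 * A powr r + (2 * r + 8 * r * m) * \<mu>\<^sup>2 * (B * x powr (r - 1))"
      by (simp add: algebra_simps)
    also have "\<dots> \<le> 2 * A powr r + (2 * r + 8 * r * m) * \<mu>\<^sup>2 * (4 powr r * (A powr r + B powr r))"
      using r m \<mu>2 by (intro add_left_mono mult_left_mono h2) auto
    also have "\<dots> = 2 * A powr r + K * \<mu> powr 2 * (A powr r + B powr r)"
      using \<mu> by (simp add: K_def mult_ac)
    finally show ?thesis unfolding A_def B_def r_def norm_powr_conv[of a p] norm_powr_conv[of b p] .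
  qed
  moreover have "K \<ge> 0" using r m by (simp add: K_def)
  ultimately show ?thesis using that by blast
qed

lemma norm_powr_smooth:
  fixes p :: real
  assumes "1 < p"
  obtains K where "K \<ge> 1"
    "\<And>(a::'a::real_inner) b \<mu>. 0 \<le> \<mu> \<Longrightarrow> \<mu> \<le> 1 \<Longrightarrow>
       norm (a + \<mu> *\<^sub>R b) powr p + norm (a - \<mu> *\<^sub>R b) powr p
         \<le> 2 * norm a powr p + K * \<mu> powr (min p 2) * (norm a powr p + norm b powr p)"
proof (cases "p \<le> 2")
  case True
  then show ?thesis
    using assms norm_powr_smooth_le2 by (intro that[of 2]) (auto simp: min_def)
next
  case False
  then obtain K where K: "K \<ge> 0"
    "\<And>(a::'a::real_inner) b \<mu>. 0 \<le> \<mu> \<Longrightarrow> \<mu> \<le> 1 \<Longrightarrow>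
       norm (a + \<mu> *\<^sub>R b) powr p + norm (a - \<mu> *\<^sub>R b) powr p
         \<le> 2 * norm a powr p + K * \<mu> powr 2 * (norm a powr p + norm b powr p)"
    using norm_powr_smooth_ge2[of p, where 'a='a] by auto
  show ?thesis
  proof (rule that[of "K + 1"])
    fix a b :: 'a and \<mu> :: real assume \<mu>: "0 \<le> \<mu>" "\<mu> \<le> 1"
    have "K * \<mu> powr 2 * (norm a powr p + norm b powr p)
        \<le> (K + 1) * \<mu> powr 2 * (norm a powr p + norm b powr p)"
      by (intro mult_right_mono) auto
    then show "norm (a + \<mu> *\<^sub>R b) powr p + norm (a - \<mu> *\<^sub>R b) powr p
         \<le> 2 * norm a powr p + (K + 1) * \<mu> powr (min p 2) * (norm a powr p + norm b powr p)"
      using K(2)[OF \<mu>, of a b] False by (auto simp: min_def)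
  qed (use K in auto)
qed

section \<open>The spaces \<open>L\<^sup>p\<close>\<close>

text \<open>The Euclidean structure provides the real inner product for the Clarkson inequalities
  and the sign averages, so that the real and the complex case share one proof.\<close>

class Lp_scalar = real_normed_field + euclidean_space

instance real :: Lp_scalar ..
instance complex :: Lp_scalar ..

abbreviation unit_interval_measure :: "real measure" (\<open>\<I>\<close>)
  where "\<I> \<equiv> lebesgue_on {0..1}"

lemma finite_measure_I: "finite_measure \<I>"
  by (rule finite_measure_lebesgue_on) simp

lemma measure_I_space: "measure \<I> {0..1} = 1" "measure \<I> (space \<I>) = 1"
  by (auto simp: measure_restrict_space)

lemma integrable_const_I [simp, intro]: "integrable \<I> (\<lambda>_. c::real)"
  using finite_measure.integrable_const[OF finite_measure_I] .

lemma integral_const_I [simp]: "integral\<^sup>L \<I> (\<lambda>_. c::real) = c"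
  using measure_I_space by simp

lemma sum_fun_apply: "(\<Sum>i\<in>A. g i) x = (\<Sum>i\<in>A. g i x)"
  by (induction A rule: infinite_finite_induct) auto

lemma sum_fscale_apply: "(\<Sum>i\<in>A. a i *\<^sub>F g i) x = (\<Sum>i\<in>A. a i * g i x)"
  by (simp add: sum_fun_apply fscale_def)

lemma fscale_apply [simp]: "(a *\<^sub>F f) x = a * f x"
  by (simp add: fscale_def)

definition Lint :: "real \<Rightarrow> (real \<Rightarrow> 'k::Lp_scalar) \<Rightarrow> real"
  where "Lint p f = integral\<^sup>L \<I> (\<lambda>x. norm (f x) powr p)"

lemma LpD:
  fixes f :: "real \<Rightarrow> 'k::Lp_scalar"
  assumes "f \<in> Lp p"
  shows "f \<in> borel_measurable \<I>" "integrable \<I> (\<lambda>x. norm (f x) powr p)"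
  using assms by (auto simp: Lp_def)

lemma Lnorm_eq_Lint:
  fixes f :: "real \<Rightarrow> 'k::Lp_scalar"
  shows "Lnorm p f = Lint p f powr (1/p)"
  by (simp add: Lnorm_def Lint_def)

lemma Lint_nonneg: "Lint p f \<ge> 0"
  unfolding Lint_def by (rule Bochner_Integration.integral_nonneg) auto

lemma Lnorm_nonneg [simp]: "Lnorm p f \<ge> 0"
  by (simp add: Lnorm_def)

lemma Lint_eq_Lnorm: "0 < p \<Longrightarrow> Lint p f = Lnorm p f powr p"
  using Lint_nonneg[of p f] by (simp add: Lnorm_eq_Lint powr_powr)

lemma Lp_dominated:
  fixes f :: "real \<Rightarrow> 'k::Lp_scalar"
  assumes "f \<in> borel_measurable \<I>" "integrable \<I> h" "\<And>x. norm (f x) powr p \<le> h x"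
  shows "f \<in> Lp p"
proof -
  have "integrable \<I> (\<lambda>x. norm (f x) powr p)"
    by (rule Bochner_Integration.integrable_bound[OF assms(2)])
      (use assms(1,3) in \<open>auto intro!: AE_I2 intro: order_trans[OF _ abs_ge_self]\<close>)
  then show ?thesis using assms by (simp add: Lp_def)
qed

lemma Lint_le_integral:
  fixes f :: "real \<Rightarrow> 'k::Lp_scalar"
  assumes "f \<in> Lp p" "integrable \<I> h" "\<And>x. norm (f x) powr p \<le> h x"
  shows "Lint p f \<le> integral\<^sup>L \<I> h"
  unfolding Lint_def using assms LpD[OF assms(1)] by (intro integral_mono) auto

lemma Lp_bounded:
  fixes f :: "real \<Rightarrow> 'k::Lp_scalar"
  assumes "f \<in> borel_measurable \<I>" "\<And>x. norm (f x) \<le> M" "0 \<le> p"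
  shows "f \<in> Lp p"
  by (rule Lp_dominated[of f "\<lambda>_. M powr p"]) (use assms in \<open>auto intro!: powr_mono2\<close>)

lemma Lnorm_le_powr:
  assumes "0 < p" "0 \<le> c" "Lint p f \<le> c powr p"
  shows "Lnorm p f \<le> c"
proof -
  have "Lnorm p f \<le> (c powr p) powr (1/p)"
    unfolding Lnorm_eq_Lint using assms Lint_nonneg by (intro powr_mono2) auto
  then show ?thesis using assms by (simp add: powr_powr)
qed

lemma Lp_mono:
  fixes f g :: "real \<Rightarrow> 'k::Lp_scalar"
  assumes "g \<in> Lp p" "f \<in> borel_measurable \<I>" "\<And>x. norm (f x) \<le> norm (g x)" "0 < p"
  shows "f \<in> Lp p"
  by (rule Lp_dominated[OF assms(2) LpD(2)[OF assms(1)]]) (use assms in \<open>auto intro!: powr_mono2\<close>)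

lemma Lint_mono:
  fixes f g :: "real \<Rightarrow> 'k::Lp_scalar"
  assumes "f \<in> Lp p" "g \<in> Lp p" "\<And>x. norm (f x) \<le> norm (g x)" "0 < p"
  shows "Lint p f \<le> Lint p g"
  unfolding Lint_def using assms LpD by (intro integral_mono) (auto intro!: powr_mono2)

lemma Lnorm_mono:
  fixes f g :: "real \<Rightarrow> 'k::Lp_scalar"
  assumes "f \<in> Lp p" "g \<in> Lp p" "\<And>x. norm (f x) \<le> norm (g x)" "0 < p"
  shows "Lnorm p f \<le> Lnorm p g"
  unfolding Lnorm_eq_Lint using Lint_mono[OF assms] Lint_nonneg assms by (intro powr_mono2) auto

lemma Lp_zero [simp]: "0 \<in> Lp p"
  by (simp add: Lp_def zero_fun_def)

lemma Lnorm_zero [simp]: "Lnorm p 0 = 0"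
  by (simp add: Lnorm_def zero_fun_def)

lemma Lp_scale [intro]:
  fixes f :: "real \<Rightarrow> 'k::Lp_scalar"
  assumes "f \<in> Lp p"
  shows "a *\<^sub>F f \<in> Lp p"
proof -
  have "a *\<^sub>F f \<in> borel_measurable \<I>"
    using LpD(1)[OF assms] by (simp add: fscale_def)
  then show ?thesis
    using LpD[OF assms] by (simp add: Lp_def norm_mult powr_mult)
qed

lemma Lint_scale: "Lint p (a *\<^sub>F f) = norm a powr p * Lint p f"
  by (simp add: Lint_def norm_mult powr_mult)

lemma Lnorm_scale:
  fixes f :: "real \<Rightarrow> 'k::Lp_scalar"
  shows "0 < p \<Longrightarrow> Lnorm p (a *\<^sub>F f) = norm a * Lnorm p f"
  by (simp add: Lnorm_eq_Lint Lint_scale powr_mult powr_powr Lint_nonneg)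

text \<open>The pointwise form of Minkowski's inequality: x + y is a + b times a convex combination
  of x/a and y/b. With a and b close to the norms of two functions, each of the terms (|x|/a)^p and
  (|y|/b)^p integrates to at most 1.\<close>

lemma norm_add_powr_weighted:
  fixes x y :: "'a::real_normed_vector" and a b :: real
  assumes "1 \<le> p" "0 < a" "0 < b"
  shows "norm (x + y) powr p
    \<le> (a + b) powr p * (a / (a + b) * (norm x / a) powr p + b / (a + b) * (norm y / b) powr p)"
proof -
  define t where "t = b / (a + b)"
  have t: "0 \<le> t" "t \<le> 1" "1 - t = a / (a + b)"
    using assms by (auto simp: t_def field_simps)
  have "norm (x + y) powr p \<le> (norm x + norm y) powr p"
    using assms by (intro powr_mono2 norm_triangle_ineq) auto
  also have "norm x + norm y = (a + b) * ((1 - t) * (norm x / a) + t * (norm y / b))"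
    unfolding t(3) unfolding t_def using assms
    by (simp add: distrib_left add_pos_pos less_imp_neq[symmetric])
  also have "\<dots> powr p = (a + b) powr p * ((1 - t) * (norm x / a) + t * (norm y / b)) powr p"
    by (rule powr_mult)
  also have "\<dots> \<le> (a + b) powr p * ((1 - t) * (norm x / a) powr p + t * (norm y / b) powr p)"
    using assms t by (intro mult_left_mono powr_convex_ineq) auto
  finally show ?thesis unfolding t(3) unfolding t_def .
qed

lemma Lp_add [intro]:
  fixes f g :: "real \<Rightarrow> 'k::Lp_scalar"
  assumes "1 \<le> p" "f \<in> Lp p" "g \<in> Lp p"
  shows "f + g \<in> Lp p"
proof (rule Lp_dominated)
  show "f + g \<in> borel_measurable \<I>"
    using LpD(1)[OF assms(2)] LpD(1)[OF assms(3)] by (simp add: plus_fun_def)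
  show "norm ((f + g) x) powr p \<le> 2 powr p * (1/2 * norm (f x) powr p + 1/2 * norm (g x) powr p)" for x
    using norm_add_powr_weighted[of p 1 1 "f x" "g x"] assms by simp
qed (use LpD[OF assms(2)] LpD[OF assms(3)] in auto)

lemma Lp_uminus [intro]:
  fixes f :: "real \<Rightarrow> 'k::Lp_scalar"
  shows "f \<in> Lp p \<Longrightarrow> - f \<in> Lp p"
  by (auto simp: Lp_def fun_Compl_def)

lemma Lp_diff [intro]:
  fixes f g :: "real \<Rightarrow> 'k::Lp_scalar"
  shows "1 \<le> p \<Longrightarrow> f \<in> Lp p \<Longrightarrow> g \<in> Lp p \<Longrightarrow> f - g \<in> Lp p"
  using Lp_add[of p f "- g"] Lp_uminus[of g p] by simp

lemma Lp_sum [intro]: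
  fixes g :: "'i \<Rightarrow> real \<Rightarrow> 'k::Lp_scalar"
  shows "1 \<le> p \<Longrightarrow> (\<And>i. i \<in> A \<Longrightarrow> g i \<in> Lp p) \<Longrightarrow> (\<Sum>i\<in>A. g i) \<in> Lp p"
  by (induction A rule: infinite_finite_induct) auto

lemma Lnorm_triangle:
  fixes f g :: "real \<Rightarrow> 'k::Lp_scalar"
  assumes p: "1 \<le> p" and f: "f \<in> Lp p" and g: "g \<in> Lp p"
  shows "Lnorm p (f + g) \<le> Lnorm p f + Lnorm p g"
proof (rule field_le_epsilon)
  fix e :: real assume "e > 0"
  \<comment> \<open>The added e/2 keeps a and b positive if one of the norms vanishes.\<close>
  define a b where "a = Lnorm p f + e/2" and "b = Lnorm p g + e/2"
  have ab: "a > 0" "b > 0" "Lnorm p f \<le> a" "Lnorm p g \<le> b"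
    using \<open>e > 0\<close> Lnorm_nonneg[of p f] Lnorm_nonneg[of p g] by (auto simp: a_def b_def simp del: Lnorm_nonneg)
  have scaled: "Lint p h / c powr p \<le> 1" if "c > 0" "Lnorm p h \<le> c" for c and h :: "real \<Rightarrow> 'k"
    using that powr_mono2[of p "Lnorm p h" c] p by (simp add: Lint_eq_Lnorm)
  have "Lint p (f + g) \<le> integral\<^sup>L \<I> (\<lambda>x. (a + b) powr p * (a / (a + b) * (norm (f x) / a) powr p + b / (a + b) * (norm (g x) / b) powr p))"
    using norm_add_powr_weighted[OF p ab(1,2)] f g p
    by (intro Lint_le_integral) (auto simp: powr_divide LpD)
  also have "\<dots> = (a + b) powr p * (a / (a + b) * (Lint p f / a powr p) + b / (a + b) * (Lint p g / b powr p))"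
    using f g by (simp add: Lint_def LpD powr_divide)
  also have "\<dots> \<le> (a + b) powr p * (a / (a + b) * 1 + b / (a + b) * 1)"
    using ab scaled by (intro mult_left_mono add_mono) auto
  also have "\<dots> = (a + b) powr p" using ab by (simp add: add_divide_distrib[symmetric])
  finally have "Lnorm p (f + g) \<le> a + b"
    using ab p by (intro Lnorm_le_powr) auto
  then show "Lnorm p (f + g) \<le> Lnorm p f + Lnorm p g + e"
    by (simp add: a_def b_def)
qed

lemma Lnorm_uminus [simp]: "Lnorm p (- f) = Lnorm p f"
  by (simp add: Lnorm_def)

lemma Lnorm_minus_commute: "Lnorm p (f - g) = Lnorm p (g - f)"
  by (simp add: Lnorm_def norm_minus_commute)

lemma Lnorm_triangle_diff:
  fixes f g :: "real \<Rightarrow> 'k::Lp_scalar"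
  assumes "1 \<le> p" "f \<in> Lp p" "g \<in> Lp p"
  shows "Lnorm p (f - g) \<le> Lnorm p f + Lnorm p g"
  using Lnorm_triangle[of p f "- g"] Lp_uminus[of g p] assms by simp

lemma Lnorm_le_add_diff:
  fixes f g :: "real \<Rightarrow> 'k::Lp_scalar"
  assumes "1 \<le> p" "f \<in> Lp p" "g \<in> Lp p"
  shows "Lnorm p f \<le> Lnorm p g + Lnorm p (f - g)"
  using Lnorm_triangle[of p g "f - g"] assms by auto

lemma Lnorm_triangle_sum:
  fixes g :: "'i \<Rightarrow> real \<Rightarrow> 'k::Lp_scalar"
  shows "1 \<le> p \<Longrightarrow> (\<And>i. i \<in> A \<Longrightarrow> g i \<in> Lp p) \<Longrightarrow> Lnorm p (\<Sum>i\<in>A. g i) \<le> (\<Sum>i\<in>A. Lnorm p (g i))"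
proof (induction A rule: infinite_finite_induct)
  case (insert x F)
  have "(\<Sum>i\<in>F. g i) \<in> Lp p" using insert.prems by (intro Lp_sum) auto
  then have "Lnorm p (\<Sum>i\<in>insert x F. g i) \<le> Lnorm p (g x) + Lnorm p (\<Sum>i\<in>F. g i)"
    using insert by (auto intro!: Lnorm_triangle)
  also have "\<dots> \<le> Lnorm p (g x) + (\<Sum>i\<in>F. Lnorm p (g i))"
    using insert by auto
  finally show ?case using insert.hyps by (metis (no_types, lifting) sum.insert)
qed auto

lemma Lnorm_tendsto:
  fixes f :: "real \<Rightarrow> 'k::Lp_scalar"
  assumes "1 \<le> p" "f \<in> Lp p" "\<And>n. s n \<in> Lp p" "(\<lambda>n. Lnorm p (f - s n)) \<longlonglongrightarrow> 0"
  shows "(\<lambda>n. Lnorm p (s n)) \<longlonglongrightarrow> Lnorm p f"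
proof (rule LIM_zero_cancel, rule Lim_null_comparison[OF _ assms(4)])
  show "\<forall>\<^sub>F n in sequentially. norm (Lnorm p (s n) - Lnorm p f) \<le> Lnorm p (f - s n)"
  proof (intro always_eventually allI)
    fix n
    show "norm (Lnorm p (s n) - Lnorm p f) \<le> Lnorm p (f - s n)"
      using Lnorm_le_add_diff[OF assms(1,2,3), of n] Lnorm_le_add_diff[OF assms(1,3,2), of n]
        Lnorm_minus_commute[of p f "s n"] by simp
  qed
qed

section \<open>Truncation of functions by their values\<close>

definition restr :: "(real \<Rightarrow> bool) \<Rightarrow> (real \<Rightarrow> 'k::Lp_scalar) \<Rightarrow> real \<Rightarrow> 'k" where
  "restr P f = (\<lambda>x. if P x then f x else 0)"

lemma restr_Lp:
  fixes f :: "real \<Rightarrow> 'k::Lp_scalar"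
  assumes "0 < p" "f \<in> Lp p" "Measurable.pred \<I> P"
  shows "restr P f \<in> Lp p" and "Lnorm p (restr P f) \<le> Lnorm p f"
proof -
  have [measurable]: "f \<in> borel_measurable \<I>" "Measurable.pred \<I> P"
    using assms LpD by auto
  have "restr P f \<in> borel_measurable \<I>" unfolding restr_def by measurable
  then show 1: "restr P f \<in> Lp p"
    by (rule Lp_mono[OF assms(2)]) (use assms in \<open>auto simp: restr_def\<close>)
  show "Lnorm p (restr P f) \<le> Lnorm p f"
    by (rule Lnorm_mono[OF 1 assms(2)]) (use assms in \<open>auto simp: restr_def\<close>)
qed

lemma restr_above_tendsto_0:
  fixes f :: "real \<Rightarrow> 'k::Lp_scalar"
  assumes p: "0 < p" and f: "f \<in> Lp p"
  shows "(\<lambda>n. Lnorm p (restr (\<lambda>x. real n < norm (f x)) f)) \<longlonglongrightarrow> 0"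
proof -
  have [measurable]: "f \<in> borel_measurable \<I>" using LpD[OF f] by auto
  have "(\<lambda>n. integral\<^sup>L \<I> (\<lambda>x. norm (restr (\<lambda>x. real n < norm (f x)) f x) powr p))
      \<longlonglongrightarrow> integral\<^sup>L \<I> (\<lambda>x. 0)"
  proof (rule integral_dominated_convergence[where w = "\<lambda>x. norm (f x) powr p"])
    show "AE x in \<I>. (\<lambda>n. norm (restr (\<lambda>x. real n < norm (f x)) f x) powr p) \<longlonglongrightarrow> 0"
    proof (rule AE_I2)
      fix x
      obtain m :: nat where "norm (f x) \<le> real m" using real_arch_simple by blast
      then have "norm (restr (\<lambda>x. real n < norm (f x)) f x) powr p = 0" if "n \<ge> m" for n
        using that by (auto simp: restr_def)
      then show "(\<lambda>n. norm (restr (\<lambda>x. real n < norm (f x)) f x) powr p) \<longlonglongrightarrow> 0"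
        by (intro tendsto_eventually) (auto simp: eventually_sequentially)
    qed
    show "AE x in \<I>. norm (norm (restr (\<lambda>x. real n < norm (f x)) f x) powr p) \<le> norm (f x) powr p" for n
      by (auto simp: restr_def)
    show "(\<lambda>x. norm (restr (\<lambda>x. real n < norm (f x)) f x) powr p) \<in> borel_measurable \<I>" for n
      unfolding restr_def by measurable
  qed (use LpD[OF f] in auto)
  then have "(\<lambda>n. Lint p (restr (\<lambda>x. real n < norm (f x)) f)) \<longlonglongrightarrow> 0"
    by (simp add: Lint_def)
  then have "(\<lambda>n. Lint p (restr (\<lambda>x. real n < norm (f x)) f) powr (1/p)) \<longlonglongrightarrow> 0"
    using p by (intro tendsto_zero_powrI[of _ _ _ "1/p"]) (auto simp: Lint_nonneg)
  then show ?thesis by (simp add: Lnorm_eq_Lint)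
qed

text \<open>Uniform smoothness of power type \<open>min p 2\<close>. Writing u = mu v with ||v|| <=
  ||f|| allows the pointwise inequality to be integrated with the same mu everywhere; convexity of
  t^p then leads from p-th powers back to norms.\<close>

lemma Lnorm_smooth:
  fixes p :: real
  assumes p: "1 < p"
  obtains K where "K \<ge> 1"
    "\<And>(f :: real \<Rightarrow> 'k::Lp_scalar) u \<mu>.
       f \<in> Lp p \<Longrightarrow> u \<in> Lp p \<Longrightarrow> 0 \<le> \<mu> \<Longrightarrow> \<mu> \<le> 1 \<Longrightarrow> Lnorm p u \<le> \<mu> * Lnorm p f \<Longrightarrow>
       Lnorm p (f + u) + Lnorm p (f - u) \<le> 2 * Lnorm p f * (1 + K * \<mu> powr (min p 2))"
proof -
  obtain K where K: "K \<ge> 1"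
    "\<And>(a::'k) b \<mu>. 0 \<le> \<mu> \<Longrightarrow> \<mu> \<le> 1 \<Longrightarrow>
       norm (a + \<mu> *\<^sub>R b) powr p + norm (a - \<mu> *\<^sub>R b) powr p
         \<le> 2 * norm a powr p + K * \<mu> powr (min p 2) * (norm a powr p + norm b powr p)"
    using norm_powr_smooth[OF p, where 'a='k] by auto
  have "Lnorm p (f + u) + Lnorm p (f - u) \<le> 2 * Lnorm p f * (1 + K * \<mu> powr (min p 2))"
    if f: "f \<in> Lp p" and u: "u \<in> Lp p" and \<mu>: "0 \<le> \<mu>" "\<mu> \<le> 1"
      and le: "Lnorm p u \<le> \<mu> * Lnorm p f"
    for f u :: "real \<Rightarrow> 'k" and \<mu>
  proof (cases "\<mu> = 0")
    case True
    with le have "Lnorm p u = 0" by (simp add: order_antisym)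
    then show ?thesis
      using Lnorm_triangle[of p f u] Lnorm_triangle_diff[of p f u] f u p True by simp
  next
    case False
    with \<mu> have \<mu>0: "\<mu> > 0" by simp
    define c where "c = 1 + K * \<mu> powr (min p 2)"
    have c: "c \<ge> 1" using K(1) by (simp add: c_def)
    define v where "v = of_real (1 / \<mu>) *\<^sub>F u"
    have v: "v \<in> Lp p" using u by (auto simp: v_def)
    have uv: "u x = \<mu> *\<^sub>R v x" for x
      using \<mu>0 by (simp add: v_def scaleR_conv_of_real of_real_divide)
    have "Lnorm p v = Lnorm p u / \<mu>" using p \<mu>0 by (simp add: v_def Lnorm_scale norm_divide)
    also have "\<dots> \<le> Lnorm p f" using le \<mu>0 by (simp add: field_simps)
    finally have vf: "Lint p v \<le> Lint p f" using p by (simp add: Lint_eq_Lnorm powr_mono2)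
    have fu: "f + u \<in> Lp p" "f - u \<in> Lp p" using f u p by auto
    have "Lint p (f + u) + Lint p (f - u) = integral\<^sup>L \<I> (\<lambda>x. norm ((f + u) x) powr p + norm ((f - u) x) powr p)"
      unfolding Lint_def using LpD(2)[OF fu(1)] LpD(2)[OF fu(2)] by simp
    also have "\<dots> \<le> integral\<^sup>L \<I> (\<lambda>x. 2 * norm (f x) powr p
        + K * \<mu> powr (min p 2) * (norm (f x) powr p + norm (v x) powr p))"
      using LpD(2)[OF fu(1)] LpD(2)[OF fu(2)] LpD(2)[OF f] LpD(2)[OF v] K(2)[OF \<mu>]
      by (intro integral_mono) (auto simp: uv)
    also have "\<dots> = 2 * Lint p f + K * \<mu> powr (min p 2) * (Lint p f + Lint p v)"
      unfolding Lint_def using LpD(2)[OF f] LpD(2)[OF v] by simp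
    also have "\<dots> \<le> 2 * Lint p f + K * \<mu> powr (min p 2) * (Lint p f + Lint p f)"
      using vf K(1) by (intro add_left_mono mult_left_mono) auto
    also have "\<dots> = 2 * c * Lint p f" by (simp add: c_def algebra_simps)
    \<comment> \<open>Since c >= 1, replacing c by c^p makes the p-th root equal to c itself, so the
      excess over 1 keeps its order in mu.\<close>
    also have "\<dots> \<le> 2 * c powr p * Lint p f"
      using c p powr_mono[of 1 p c] Lint_nonneg[of p f]
      by (intro mult_right_mono mult_left_mono) auto
    finally have 1: "(Lint p (f + u) + Lint p (f - u)) / 2 \<le> (c * Lnorm p f) powr p"
      using p by (simp add: powr_mult Lint_eq_Lnorm)
    have "((Lnorm p (f + u) + Lnorm p (f - u)) / 2) powr p
        = ((1 - 1/2) * Lnorm p (f + u) + 1/2 * Lnorm p (f - u)) powr p"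
      by (simp add: field_simps)
    also have "\<dots> \<le> (1 - 1/2) * Lnorm p (f + u) powr p + 1/2 * Lnorm p (f - u) powr p"
      using p by (intro powr_convex_ineq) auto
    also have "\<dots> \<le> (c * Lnorm p f) powr p"
      using 1 p by (simp add: Lint_eq_Lnorm add_divide_distrib)
    finally have "(Lnorm p (f + u) + Lnorm p (f - u)) / 2 \<le> c * Lnorm p f"
      using powr_less_mono2[of p "c * Lnorm p f" "(Lnorm p (f + u) + Lnorm p (f - u)) / 2"] p c
      by (meson Lnorm_nonneg leD leI less_trans mult_nonneg_nonneg order_trans zero_le_one zero_less_one)
    then show ?thesis by (simp add: c_def algebra_simps)
  qed
  then show ?thesis using K(1) that by blast
qed

section \<open>Counting the steps of the algorithm\<close>

text \<open>As 1 - delta <= exp(-delta), ln Q / delta contractions make up for the factor Q. The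
  contraction is available only above the level L, hence the argument by contradiction: if the level
  were never reached, every step would contract.\<close>

lemma geometric_decay_below:
  fixes r :: "nat \<Rightarrow> real"
  assumes anti: "antimono r" and L: "0 \<le> L" and Q: "1 \<le> Q" "r k \<le> Q * L" and n: "ln Q \<le> \<delta> * real n"
    and step: "\<And>m. k \<le> m \<Longrightarrow> L < r m \<Longrightarrow> r (Suc m) \<le> (1 - \<delta>) * r m"
  shows "r (k + n) \<le> L"
proof (rule ccontr)
  assume "\<not> r (k + n) \<le> L"
  then have big: "L < r (k + i)" if "i \<le> n" for i
    using antimonoD[OF anti, of "k + i" "k + n"] that by auto
  show False
  proof (cases "n = 0")
    case True
    with n Q have "Q = 1" using ln_gt_zero[of Q] by force
    with True Q big[of 0] show False by simp
  next
    case False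
    \<comment> \<open>If the factor were negative, the very first step would already bring r to at
      most 0, hence below the level.\<close>
    have d: "0 \<le> 1 - \<delta>"
    proof (rule ccontr)
      assume "\<not> 0 \<le> 1 - \<delta>"
      then have "(1 - \<delta>) * r k \<le> 0"
        using big[of 0] L by (intro mult_nonpos_nonneg) auto
      then show False using step[of k] big[of 0] big[of 1] False L by simp
    qed
    have "i \<le> n \<Longrightarrow> r (k + i) \<le> (1 - \<delta>) ^ i * r k" for i
    proof (induction i)
      case (Suc i)
      then have "r (k + Suc i) \<le> (1 - \<delta>) * r (k + i)"
        using step[of "k + i"] big[of i] by simp
      also have "\<dots> \<le> (1 - \<delta>) * ((1 - \<delta>) ^ i * r k)"
        using Suc d by (intro mult_left_mono) auto
      finally show ?case by (simp add: mult.assoc)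
    qed auto
    then have "r (k + n) \<le> (1 - \<delta>) ^ n * r k" by simp
    also have "\<dots> \<le> exp (- \<delta>) ^ n * (Q * L)"
      using d Q big[of 0] L exp_ge_add_one_self[of "- \<delta>"] by (intro mult_mono power_mono) auto
    also have "exp (- \<delta>) ^ n = exp (- (\<delta> * n))"
      by (simp add: exp_of_nat_mult[symmetric] mult.commute)
    also have "exp (- (\<delta> * n)) * (Q * L) \<le> exp (- ln Q) * (Q * L)"
      using n Q L by (intro mult_right_mono) auto
    also have "\<dots> = L" using Q by (simp add: exp_minus)
    finally show False using big[of n] by simp
  qed
qed

lemma powr_superadditive_nat:
  fixes M \<alpha> :: real
  assumes "1 \<le> \<alpha>" "0 \<le> M"
  shows "M * real a powr \<alpha> + M * real b powr \<alpha> \<le> M * real (a + b) powr \<alpha>"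
proof -
  have "M * (real a powr \<alpha> + real b powr \<alpha>) \<le> M * (real a + real b) powr \<alpha>"
    using assms by (intro mult_left_mono powr_add_superadditive) auto
  then show ?thesis by (simp add: distrib_left)
qed

text \<open>
  In the application \<open>r m\<close> is the norm of the \<open>m\<close>-th remainder, \<open>R m\<close> the part of the support of an
  almost optimal sparse approximant not yet selected, and \<open>e B\<close> the norm of the part of that
  approximant supported on \<open>B\<close>.
\<close>

locale greedy_process =
  fixes r :: "nat \<Rightarrow> real" and R :: "nat \<Rightarrow> 'i set" and e :: "'i set \<Rightarrow> real"
    and U \<epsilon> \<kappa> \<alpha> :: real
  assumes U: "1 \<le> U" and eps: "0 \<le> \<epsilon>" and kappa: "0 < \<kappa>" and alpha: "1 \<le> \<alpha>"
    and r_anti: "antimono r"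
    and R_anti: "antimono R" and finite_R: "finite (R 0)"
    and e_nonneg: "\<And>B. 0 \<le> e B" and e_empty: "e {} = 0"
    and e_mono: "\<And>A B. A \<subseteq> B \<Longrightarrow> B \<subseteq> R 0 \<Longrightarrow> e A \<le> U * e B"
    and upper: "\<And>m. 4 * \<epsilon> < r m \<Longrightarrow> r m \<le> \<epsilon> + e (R m)"
    and lower: "\<And>m. 4 * \<epsilon> < r m \<Longrightarrow> e (R m) \<le> U * (r m + \<epsilon>)"
    and contract: "\<And>m A s. 4 * \<epsilon> < r m \<Longrightarrow> A \<subseteq> R m \<Longrightarrow> card A \<le> s \<Longrightarrow> 1 \<le> s \<Longrightarrow>
        4 * e (R m - A) \<le> r m \<Longrightarrow> r (Suc m) \<le> (1 - \<kappa> / real s powr \<alpha>) * r m"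
begin

lemma R_subset: "k \<le> m \<Longrightarrow> R m \<subseteq> R k"
  using R_anti by (rule antimonoD)

lemma finite_R_all: "finite (R m)"
  using finite_subset[OF R_subset[of 0 m] finite_R] by simp

text \<open>This plays the role of the best s-term error of the unselected part at time k. Only
  restrictions of the given approximant compete, so the family is finite and the minimum is
  attained.\<close>

definition best_residual :: "nat \<Rightarrow> nat \<Rightarrow> real" where
  "best_residual k s = Min ((\<lambda>A. e (R k - A)) ` {A. A \<subseteq> R k \<and> card A \<le> s})"

lemma finite_choices: "finite {A. A \<subseteq> R k \<and> card A \<le> s}"
  by (rule finite_subset[of _ "Pow (R k)"]) (auto simp: finite_R_all)

lemma best_residual_attained:
  obtains A where "A \<subseteq> R k" "card A \<le> s" "best_residual k s = e (R k - A)"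
proof -
  have "{A. A \<subseteq> R k \<and> card A \<le> s} \<noteq> {}" by (auto intro: exI[of _ "{}"])
  then have "best_residual k s \<in> (\<lambda>A. e (R k - A)) ` {A. A \<subseteq> R k \<and> card A \<le> s}"
    unfolding best_residual_def using finite_choices by (intro Min_in) auto
  then show ?thesis using that by auto
qed

lemma best_residual_le: "A \<subseteq> R k \<Longrightarrow> card A \<le> s \<Longrightarrow> best_residual k s \<le> e (R k - A)"
  unfolding best_residual_def using finite_choices by (intro Min_le) auto

lemma best_residual_nonneg: "0 \<le> best_residual k s"
  by (rule best_residual_attained[of k s]) (auto simp: e_nonneg)

lemma best_residual_0: "best_residual k 0 = e (R k)"
proof (rule best_residual_attained[of k 0])
  fix A assume "A \<subseteq> R k" "card A \<le> 0" "best_residual k 0 = e (R k - A)"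
  moreover from this have "A = {}" using finite_subset[OF _ finite_R_all] by auto
  ultimately show ?thesis by simp
qed

lemma best_residual_eq_0: "card (R k) \<le> s \<Longrightarrow> best_residual k s = 0"
  using best_residual_le[of "R k" k s] best_residual_nonneg[of k s] e_empty by simp

text \<open>The sizes are 0, 1, 2, 4, and so on. Size 0 stands for the full unselected part, the
  level at which a phase begins; it allows a phase to end after a single stage.\<close>

definition stage_size :: "nat \<Rightarrow> nat" where
  "stage_size j = (case j of 0 \<Rightarrow> 0 | Suc i \<Rightarrow> 2 ^ i)"

text \<open>Enough steps with factor 1 - kappa / s^alpha to gain 16 U^2, the quotient of the level 4
  U E at which a stage begins and the level E / (4 U) to which it may have to descend.\<close>

definition stage_length :: "nat \<Rightarrow> nat" where
  "stage_length s = nat \<lceil>ln (16 * U\<^sup>2) / \<kappa> * real s powr \<alpha>\<rceil>"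

definition stage_const :: real where
  "stage_const = ln (16 * U\<^sup>2) / \<kappa> + 1"

text \<open>The factor 2 bounds the geometric sum of the stage lengths of a phase, and 2^alpha comes
  from comparing the last stage size 2^l with at most twice the number x of indices charged.\<close>

definition total_const :: real where
  "total_const = 2 * 2 powr \<alpha> * stage_const"

lemma sixteen_U2: "1 \<le> 16 * U\<^sup>2"
proof -
  have "1 \<le> U\<^sup>2" using U by simp
  then show ?thesis by linarith
qed

lemma stage_const_ge_1: "1 \<le> stage_const"
  using sixteen_U2 kappa by (simp add: stage_const_def)

lemma stage_length_le:
  assumes "1 \<le> s"
  shows "real (stage_length s) \<le> stage_const * real s powr \<alpha>"
proof -
  have "1 \<le> real s powr \<alpha>" using assms alpha by (intro ge_one_powr_ge_zero) auto
  moreover have "0 \<le> ln (16 * U\<^sup>2) / \<kappa> * real s powr \<alpha>"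
    using sixteen_U2 kappa by (intro mult_nonneg_nonneg divide_nonneg_pos) auto
  ultimately show ?thesis
    unfolding stage_length_def stage_const_def distrib_right by linarith
qed

text \<open>One set A attaining the minimum for size s is fixed during the stage. Its part not yet
  selected stays admissible for \<open>contract\<close>: the unselected indices outside A have
  e-value at most U times the best residual, which is small as long as the remainder exceeds 4 U
  times that residual. So the remainder decays until it meets one of the first two levels, or until
  the time of the stage has brought it down by 16 U^2 to the third.\<close>

lemma single_stage:
  assumes km: "k \<le> m" and start: "r m \<le> max (4 * \<epsilon>) (4 * U * best_residual k (stage_size j))"
  shows "r (m + stage_length (stage_size (Suc j))) \<le>
    max (4 * \<epsilon>) (max (4 * U * best_residual k (stage_size (Suc j))) (best_residual k (stage_size j) / (4 * U)))"
    (is "_ \<le> ?L")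
proof -
  define s where "s = stage_size (Suc j)"
  have s: "1 \<le> s" by (simp add: s_def stage_size_def)
  obtain A where A: "A \<subseteq> R k" "card A \<le> s" "best_residual k s = e (R k - A)"
    by (rule best_residual_attained)
  have "r (m + stage_length s) \<le> ?L"
  proof (rule geometric_decay_below[OF r_anti])
    show "0 \<le> ?L" using eps by simp
    show "1 \<le> 16 * U\<^sup>2" by (rule sixteen_U2)
    have "4 * U * best_residual k (stage_size j) = 16 * U\<^sup>2 * (best_residual k (stage_size j) / (4 * U))"
      using U by (simp add: power2_eq_square)
    also have "\<dots> \<le> 16 * U\<^sup>2 * ?L" by (intro mult_left_mono) auto
    finally have 1: "4 * U * best_residual k (stage_size j) \<le> 16 * U\<^sup>2 * ?L" .
    have "1 * (4 * \<epsilon>) \<le> 16 * U\<^sup>2 * ?L" using sixteen_U2 eps by (intro mult_mono) auto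
    with 1 start show "r m \<le> 16 * U\<^sup>2 * ?L" by linarith
    have "ln (16 * U\<^sup>2) = \<kappa> / real s powr \<alpha> * (ln (16 * U\<^sup>2) / \<kappa> * real s powr \<alpha>)"
      using s kappa by simp
    also have "\<dots> \<le> \<kappa> / real s powr \<alpha> * real (stage_length s)"
      using kappa unfolding stage_length_def by (intro mult_left_mono) (linarith, simp)
    finally show "ln (16 * U\<^sup>2) \<le> \<kappa> / real s powr \<alpha> * real (stage_length s)" .
  next
    fix m' assume m': "m \<le> m'" "?L < r m'"
    then have big: "4 * \<epsilon> < r m'" "4 * U * best_residual k s < r m'" by (auto simp: s_def)
    have "card (A \<inter> R m') \<le> s"
      using A card_mono[of A "A \<inter> R m'"] finite_subset[OF A(1) finite_R_all] by auto
    moreover have "e (R m' - A \<inter> R m') \<le> U * e (R k - A)"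
      using R_subset[of k m'] R_subset[of 0 k] m' km by (intro e_mono) auto
    ultimately show "r (Suc m') \<le> (1 - \<kappa> / real s powr \<alpha>) * r m'"
      using big s A(3) by (intro contract[of m' "A \<inter> R m'"]) auto
  qed
  then show ?thesis by (simp add: s_def)
qed

lemma stage_lengths_sum:
  "(\<Sum>j\<le>l. real (stage_length (2 ^ j))) \<le> 2 * stage_const * (2 ^ l) powr \<alpha>"
proof (induction l)
  case 0
  show ?case using stage_length_le[of 1] stage_const_ge_1 by simp
next
  case (Suc l)
  have "2 \<le> (2::real) powr \<alpha>" using alpha powr_mono[of 1 \<alpha> 2] by simp
  then have "2 * stage_const * (2 ^ l) powr \<alpha> \<le> 2 powr \<alpha> * stage_const * (2 ^ l) powr \<alpha>"
    using stage_const_ge_1 by (intro mult_right_mono) auto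
  also have "\<dots> = stage_const * (2 ^ Suc l) powr \<alpha>" by (simp add: powr_mult)
  finally have "2 * stage_const * (2 ^ l) powr \<alpha> \<le> stage_const * (2 ^ Suc l) powr \<alpha>" .
  moreover have "real (stage_length (2 ^ Suc l)) \<le> stage_const * (2 ^ Suc l) powr \<alpha>"
    using stage_length_le[of "2 ^ Suc l"] by simp
  ultimately show ?case using Suc by simp
qed

text \<open>Let E j be the best residual at stage size j and l the first j where E drops by the
  factor 16 U^2. Before l the drops are moderate, so every stage ends at 4 U times the next residual
  and the following stage can start. After the stage that begins at l the remainder is at most E l /
  (4 U) or 4 epsilon. In the first case \<open>lower\<close> gives an unselected part below E l,
  which by minimality of E l means that more than \<open>stage_size l\<close> indices were selected
  meanwhile. The time spent is a geometric sum, comparable with the alpha-th power of that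
  number.\<close>

lemma phase:
  assumes k: "4 * \<epsilon> < r k"
  obtains d x where "1 \<le> x" "x \<le> card (R k)" "real d \<le> total_const * real x powr \<alpha>"
    "r (k + d) \<le> 4 * \<epsilon> \<or> card (R (k + d)) + x \<le> card (R k)"
proof -
  define E where "E j = best_residual k (stage_size j)" for j
  have E_nonneg: "0 \<le> E j" for j by (simp add: E_def best_residual_nonneg)
  define P where "P l \<longleftrightarrow> 16 * U\<^sup>2 * E (Suc l) \<le> E l" for l
  \<comment> \<open>The large drop occurs at the latest when the stage size reaches the number of
    missing indices, because the residual is 0 from then on.\<close>
  have "P (card (R k))"
  proof -
    have "card (R k) \<le> stage_size (Suc (card (R k)))" by (simp add: stage_size_def less_imp_le)
    then show ?thesis unfolding P_def E_def using best_residual_eq_0 best_residual_nonneg by simp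
  qed
  define l where "l = (LEAST l. P l)"
  have Pl: "P l" unfolding l_def by (rule LeastI) fact
  have notP: "\<not> P j" if "j < l" for j using that not_less_Least unfolding l_def by blast
  define t where "t j = k + (\<Sum>i<j. stage_length (2 ^ i))" for j
  have t_Suc: "t (Suc j) = t j + stage_length (stage_size (Suc j))" for j
    by (simp add: t_def stage_size_def)
  have "R k \<noteq> {}" using upper[OF k] k eps e_empty by auto
  have r_t: "j \<le> l \<Longrightarrow> r (t j) \<le> max (4 * \<epsilon>) (4 * U * E j)" for j
  proof (induction j)
    case 0
    have "r k \<le> \<epsilon> + E 0" using upper[OF k] by (simp add: E_def stage_size_def best_residual_0)
    then have "r k \<le> 4 * E 0" using k eps E_nonneg[of 0] by linarith
    also have "\<dots> \<le> 4 * U * E 0" using U E_nonneg[of 0] by (intro mult_right_mono) auto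
    finally show ?case by (simp add: t_def)
  next
    case (Suc j)
    then have "E j < 16 * U\<^sup>2 * E (Suc j)" using notP[of j] by (simp add: P_def)
    then have "E j / (4 * U) \<le> 4 * U * E (Suc j)"
      using U by (simp add: field_simps power2_eq_square)
    moreover have "r (t (Suc j)) \<le> max (4 * \<epsilon>) (max (4 * U * E (Suc j)) (E j / (4 * U)))"
      using Suc single_stage[of k "t j" j] unfolding t_Suc E_def by (simp add: t_def)
    ultimately show ?case by linarith
  qed
  have "4 * U * E (Suc l) \<le> E l / (4 * U)"
    using Pl U by (simp add: P_def field_simps power2_eq_square)
  moreover have "r (t (Suc l)) \<le> max (4 * \<epsilon>) (max (4 * U * E (Suc l)) (E l / (4 * U)))"
    using r_t[of l] single_stage[of k "t l" l] unfolding t_Suc E_def by (simp add: t_def)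
  ultimately have fin: "r (t (Suc l)) \<le> max (4 * \<epsilon>) (E l / (4 * U))" by linarith
  define d where "d = (\<Sum>i<Suc l. stage_length (2 ^ i))"
  have td: "t (Suc l) = k + d" by (simp add: t_def d_def)
  \<comment> \<open>With at most \<open>stage_size l\<close> new indices the unselected part would
    still be at least E l, hence one more.\<close>
  define x where "x = stage_size l + 1"
  have x1: "1 \<le> x" by (simp add: x_def)
  have x2: "x \<le> card (R k)"
  proof (cases l)
    case 0
    then show ?thesis using \<open>R k \<noteq> {}\<close> finite_R_all[of k]
      by (simp add: x_def stage_size_def Suc_le_eq card_gt_0_iff)
  next
    case (Suc l')
    then have "E l' < 16 * U\<^sup>2 * E l" using notP[of l'] by (simp add: P_def)
    then have "E l \<noteq> 0" using E_nonneg[of l'] by auto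
    then show ?thesis using best_residual_eq_0[of k "stage_size l"] by (force simp: E_def x_def)
  qed
  have "2 ^ l \<le> 2 * x" by (cases l) (auto simp: x_def stage_size_def)
  then have "real (2 ^ l) \<le> real (2 * x)" by (rule of_nat_mono)
  then have "(2 ^ l) powr \<alpha> \<le> (2 * real x) powr \<alpha>" using alpha by (intro powr_mono2) auto
  then have "2 * stage_const * (2 ^ l) powr \<alpha> \<le> 2 * stage_const * (2 * real x) powr \<alpha>"
    using stage_const_ge_1 by (intro mult_left_mono) auto
  then have "real d \<le> 2 * stage_const * (2 * real x) powr \<alpha>"
    using stage_lengths_sum[of l] unfolding d_def lessThan_Suc_atMost by simp
  then have x3: "real d \<le> total_const * real x powr \<alpha>"
    by (simp add: total_const_def powr_mult mult_ac)
  have x4: "r (k + d) \<le> 4 * \<epsilon> \<or> card (R (k + d)) + x \<le> card (R k)"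
  proof (cases "r (k + d) \<le> 4 * \<epsilon>")
    case False
    then have big: "4 * \<epsilon> < r (k + d)" by simp
    with fin td have small: "r (k + d) \<le> E l / (4 * U)" by simp
    have "e (R (k + d)) \<le> U * (r (k + d) + \<epsilon>)" by (rule lower[OF big])
    also have "\<dots> \<le> U * (2 * r (k + d))" using big eps U by (intro mult_left_mono) auto
    also have "\<dots> \<le> U * (2 * (E l / (4 * U)))" using small U by (intro mult_left_mono) auto
    also have "\<dots> = E l / 2" using U by simp
    finally have "e (R (k + d)) \<le> E l / 2" .
    moreover have "E l > 0"
      using small big eps U by (smt (verit) divide_nonpos_pos)
    ultimately have less: "e (R (k + d)) < E l" by simp
    have sub: "R (k + d) \<subseteq> R k" by (rule R_subset) simp
    have "\<not> card (R k - R (k + d)) \<le> stage_size l"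
    proof
      assume "card (R k - R (k + d)) \<le> stage_size l"
      then have "E l \<le> e (R k - (R k - R (k + d)))"
        unfolding E_def by (intro best_residual_le) auto
      also have "R k - (R k - R (k + d)) = R (k + d)" using sub by auto
      finally show False using less by simp
    qed
    moreover have "card (R k - R (k + d)) = card (R k) - card (R (k + d))"
      using sub finite_R_all by (intro card_Diff_subset) auto
    ultimately show ?thesis unfolding x_def by linarith
  qed simp
  show ?thesis using that x1 x2 x3 x4 by blast
qed

lemma total_const_pos: "0 < total_const"
  using stage_const_ge_1 by (simp add: total_const_def)

text \<open>Induction over the number of missing indices: a phase that selects x of them costs at
  most \<open>total_const\<close> times x^alpha, and since alpha >= 1 the budget for the remaining
  ones is still available. The strict bound by n + 1 fits the floor in the final number of
  steps.\<close>

lemma remainder_bound_from: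
  assumes "total_const * real (card (R k)) powr \<alpha> < real n + 1"
  shows "r (k + n) \<le> 4 * \<epsilon>"
  using assms
proof (induction "card (R k)" arbitrary: k n rule: less_induct)
  case less
  show ?case
  proof (cases "4 * \<epsilon> < r k")
    case False
    then show ?thesis using antimonoD[OF r_anti, of k "k + n"] by simp
  next
    case True
    from phase[OF True] obtain d x where x: "1 \<le> x" "x \<le> card (R k)"
      and d: "real d \<le> total_const * real x powr \<alpha>"
      and alt: "r (k + d) \<le> 4 * \<epsilon> \<or> card (R (k + d)) + x \<le> card (R k)" by blast
    have "total_const * real x powr \<alpha> \<le> total_const * real (card (R k)) powr \<alpha>"
      using x alpha total_const_pos by (intro mult_left_mono powr_mono2) auto
    with d less.prems have "real d < real n + 1" by simp
    then have dn: "d \<le> n" by linarith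
    show ?thesis
      using alt
    proof
      assume "r (k + d) \<le> 4 * \<epsilon>"
      then show ?thesis using antimonoD[OF r_anti, of "k + d" "k + n"] dn by simp
    next
      assume c: "card (R (k + d)) + x \<le> card (R k)"
      have "total_const * real (card (R (k + d))) powr \<alpha> + total_const * real x powr \<alpha>
          \<le> total_const * real (card (R (k + d)) + x) powr \<alpha>"
        using alpha total_const_pos by (intro powr_superadditive_nat) auto
      also have "\<dots> \<le> total_const * real (card (R k)) powr \<alpha>"
        using c alpha total_const_pos by (intro mult_left_mono powr_mono2 of_nat_mono) auto
      also have "\<dots> < real n + 1" by (rule less.prems)
      finally have "r (k + d + (n - d)) \<le> 4 * \<epsilon>"
        using d dn c x by (intro less.hyps) (auto simp: of_nat_diff)
      then show ?thesis using dn by simp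
    qed
  qed
qed

theorem remainder_bound:
  assumes "card (R 0) \<le> N"
  shows "r (nat \<lfloor>total_const * real N powr \<alpha>\<rfloor>) \<le> 4 * \<epsilon>"
proof -
  have "total_const * real (card (R 0)) powr \<alpha> \<le> total_const * real N powr \<alpha>"
    using assms alpha total_const_pos by (intro mult_left_mono powr_mono2) auto
  also have "\<dots> < real (nat \<lfloor>total_const * real N powr \<alpha>\<rfloor>) + 1"
    using total_const_pos by (simp add: of_nat_nat floor_less_iff)
  finally show ?thesis using remainder_bound_from[of 0] by simp
qed

end

section \<open>Greedy bases are unconditional and democratic\<close>

lemma finite_sorted_enumeration:
  fixes h :: "'a \<Rightarrow> real"
  assumes "finite A"
  obtains xs where "distinct xs" "set xs = A" "sorted_wrt (\<lambda>x y. h y \<le> h x) xs"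
proof -
  obtain ys where ys: "set ys = A" "distinct ys"
    using finite_distinct_list[OF assms] by blast
  have "sorted_wrt (\<lambda>x y. h y \<le> h x) (sort_key (\<lambda>x. - h x) ys)"
    using sorted_sort_key[of "\<lambda>x. - h x" ys] by (simp add: sorted_map sorted_wrt_map)
  then show ?thesis using ys by (intro that[of "sort_key (\<lambda>x. - h x) ys"]) auto
qed

text \<open>An ordering must list infinitely many distinct indices although the support is finite: B
  sorted by modulus, then the rest of the support sorted, then an enumeration of all other indices,
  where the coefficients vanish.\<close>

lemma decreasing_ordering_starting_with:
  fixes c :: "nat \<Rightarrow> 'k::real_normed_field"
  assumes B: "finite B" and supp: "finite {k. c k \<noteq> 0}"
    and dom: "\<And>i j. i \<in> B \<Longrightarrow> j \<notin> B \<Longrightarrow> norm (c j) \<le> norm (c i)"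
  obtains \<rho> where "decreasing_ordering c \<rho>" "\<rho> ` {..<card B} = B"
proof -
  define T where "T = {k. c k \<noteq> 0} - B"
  obtain xs where xs: "distinct xs" "set xs = B" "sorted_wrt (\<lambda>x y. norm (c y) \<le> norm (c x)) xs"
    using finite_sorted_enumeration[OF B, of "\<lambda>x. norm (c x)"] by blast
  have "finite T" using supp by (simp add: T_def)
  then obtain ys where ys: "distinct ys" "set ys = T" "sorted_wrt (\<lambda>x y. norm (c y) \<le> norm (c x)) ys"
    using finite_sorted_enumeration[of T "\<lambda>x. norm (c x)"] by blast
  define L where "L = xs @ ys"
  have L: "distinct L" "set L = B \<union> T" using xs ys by (auto simp: L_def T_def)
  have sorted: "sorted_wrt (\<lambda>x y. norm (c y) \<le> norm (c x)) L"
    using xs ys dom by (auto simp: L_def sorted_wrt_append T_def)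
  define Z where "Z = UNIV - set L"
  have Z: "infinite Z" unfolding Z_def by (simp add: Diff_infinite_finite)
  have cZ: "c k = 0" if "k \<in> Z" for k using that L by (auto simp: Z_def T_def)
  define \<rho> where "\<rho> j = (if j < length L then L ! j else enumerate Z (j - length L))" for j
  have inZ: "\<rho> j \<in> Z" if "\<not> j < length L" for j
    using that enumerate_in_set[OF Z] by (simp add: \<rho>_def)
  have inL: "\<rho> j \<in> set L" if "j < length L" for j using that by (simp add: \<rho>_def)
  have "inj \<rho>"
  proof (rule injI)
    fix i j assume eq: "\<rho> i = \<rho> j"
    have "i < length L \<longleftrightarrow> j < length L" using eq inL inZ unfolding Z_def by (metis DiffD2)
    then show "i = j"
      using eq L(1) enumerate_Ex inj_enumerate[OF Z]
      by (cases "i < length L") (auto simp: \<rho>_def nth_eq_iff_index_eq dest: injD)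
  qed
  moreover have "{k. c k \<noteq> 0} \<subseteq> range \<rho>"
  proof
    fix k assume "k \<in> {k. c k \<noteq> 0}"
    then have "k \<in> set L" using L by (auto simp: T_def)
    then obtain j where "j < length L" "L ! j = k" by (auto simp: in_set_conv_nth)
    then show "k \<in> range \<rho>" by (intro image_eqI[of _ _ j]) (auto simp: \<rho>_def)
  qed
  moreover have "antimono (\<lambda>j. norm (c (\<rho> j)))"
  proof (rule antimonoI)
    fix i j :: nat assume ij: "i \<le> j"
    show "norm (c (\<rho> j)) \<le> norm (c (\<rho> i))"
    proof (cases "j < length L")
      case True
      then show ?thesis using ij sorted_wrt_nth_less[OF sorted, of i j]
        by (cases "i = j") (auto simp: \<rho>_def)
    next
      case False
      then show ?thesis using cZ[OF inZ] by simp
    qed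
  qed
  moreover have "\<rho> ` {..<card B} = B"
  proof -
    have len: "card B = length xs" using xs distinct_card by force
    have "\<rho> j = xs ! j" if "j < length xs" for j
      using that by (simp add: \<rho>_def L_def nth_append)
    then have "\<rho> ` {..<card B} = (!) xs ` {..<length xs}" unfolding len by (intro image_cong) auto
    also have "\<dots> = set xs" by (auto simp: set_conv_nth)
    finally show ?thesis using xs by simp
  qed
  ultimately show ?thesis using that unfolding decreasing_ordering_def by blast
qed

lemma Lp_dist_le: "g \<in> S \<Longrightarrow> Lp_dist p f S \<le> Lnorm p (f - g)"
  unfolding Lp_dist_def by (rule cINF_lower) (auto intro: bdd_belowI[of _ 0] simp: Lnorm_def)

text \<open>Coefficients in [0,1] give a point in the convex hull of the sums over subsets; the
  induction averages between dropping and keeping one index. Bounds for coordinate projections thus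
  pass to multipliers in [0,1] without loss.\<close>

lemma Lnorm_convex_combination_le:
  fixes x :: "'i \<Rightarrow> real \<Rightarrow> 'k::Lp_scalar"
  assumes p: "1 \<le> p" and "finite A" and v: "v \<in> Lp p" and x: "\<And>i. i \<in> A \<Longrightarrow> x i \<in> Lp p"
    and t: "\<And>i. i \<in> A \<Longrightarrow> 0 \<le> t i \<and> t i \<le> (1::real)"
    and M: "\<And>B. B \<subseteq> A \<Longrightarrow> Lnorm p (v + (\<Sum>i\<in>B. x i)) \<le> M"
  shows "Lnorm p (v + (\<Sum>i\<in>A. of_real (t i) *\<^sub>F x i)) \<le> M"
  using assms(2-)
proof (induction A arbitrary: v rule: finite_induct)
  case empty
  then show ?case using empty(4)[of "{}"] by simp
next
  case (insert j A)
  define w where "w = (\<Sum>i\<in>A. of_real (t i) *\<^sub>F x i)"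
  have xj: "x j \<in> Lp p" using insert by simp
  have w: "w \<in> Lp p" unfolding w_def using insert p by (intro Lp_sum) auto
  have tj: "0 \<le> t j" "t j \<le> 1" using insert by auto
  have 1: "Lnorm p (v + w) \<le> M"
    unfolding w_def using insert.prems by (intro insert.IH) auto
  have 2: "Lnorm p ((v + x j) + w) \<le> M"
    unfolding w_def
  proof (rule insert.IH)
    show "v + x j \<in> Lp p" by (rule Lp_add[OF p insert.prems(1) xj])
    fix B assume "B \<subseteq> A"
    then have "finite B" "j \<notin> B" using insert.hyps finite_subset by auto
    then have "v + (\<Sum>i\<in>insert j B. x i) = v + x j + (\<Sum>i\<in>B. x i)"
      by (simp only: sum.insert add.assoc not_False_eq_True)
    then show "Lnorm p (v + x j + (\<Sum>i\<in>B. x i)) \<le> M"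
      using insert.prems(4)[of "insert j B"] \<open>B \<subseteq> A\<close> by (metis insert_mono)
  qed (use insert.prems in auto)
  have eq: "v + (\<Sum>i\<in>insert j A. of_real (t i) *\<^sub>F x i)
      = of_real (1 - t j) *\<^sub>F (v + w) + of_real (t j) *\<^sub>F ((v + x j) + w)"
    using insert.hyps by (auto simp: w_def fun_eq_iff algebra_simps)
  have "Lnorm p (v + (\<Sum>i\<in>insert j A. of_real (t i) *\<^sub>F x i))
      \<le> Lnorm p (of_real (1 - t j) *\<^sub>F (v + w)) + Lnorm p (of_real (t j) *\<^sub>F ((v + x j) + w))"
    unfolding eq using p insert.prems(1) w xj by (intro Lnorm_triangle) auto
  also have "\<dots> = (1 - t j) * Lnorm p (v + w) + t j * Lnorm p ((v + x j) + w)"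
    using p tj by (simp add: Lnorm_scale del: of_real_diff)
  also have "\<dots> \<le> (1 - t j) * M + t j * M"
    using 1 2 tj by (intro add_mono mult_left_mono) auto
  also have "\<dots> = M" by (simp add: algebra_simps)
  finally show ?case .
qed

locale greedy_Lp =
  fixes p :: real and \<Psi> :: "nat \<Rightarrow> real \<Rightarrow> 'k::Lp_scalar"
  assumes p: "1 < p" and greedy: "greedy_basis p \<Psi>"
begin

lemma p1: "1 \<le> p" and p0: "0 < p"
  using p by auto

lemma Psi_Lp [simp]: "\<Psi> k \<in> Lp p"
  using greedy by (simp add: greedy_basis_def schauder_basis_def)

lemma Psi_norm [simp]: "Lnorm p (\<Psi> k) = 1"
  using greedy by (simp add: greedy_basis_def normalized_def)

lemma ex_expansion: "f \<in> Lp p \<Longrightarrow> \<exists>c. expansion p \<Psi> f c"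
  using greedy by (auto simp: greedy_basis_def schauder_basis_def)

lemma expansion_unique:
  "f \<in> Lp p \<Longrightarrow> expansion p \<Psi> f c \<Longrightarrow> expansion p \<Psi> f d \<Longrightarrow> c = d"
  using greedy unfolding greedy_basis_def schauder_basis_def by blast

definition comb :: "(nat \<Rightarrow> 'k) \<Rightarrow> nat set \<Rightarrow> real \<Rightarrow> 'k" where
  "comb a S = (\<Sum>k\<in>S. a k *\<^sub>F \<Psi> k)"

lemma comb_Lp [simp]: "comb a S \<in> Lp p"
  unfolding comb_def using p by (intro Lp_sum) auto

lemma comb_empty [simp]: "comb a {} = 0"
  by (simp add: comb_def)

lemma comb_cong: "(\<And>k. k \<in> S \<Longrightarrow> a k = b k) \<Longrightarrow> comb a S = comb b S"
  unfolding comb_def by (intro sum.cong) auto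

lemma comb_Un: "finite A \<Longrightarrow> finite B \<Longrightarrow> A \<inter> B = {} \<Longrightarrow> comb a (A \<union> B) = comb a A + comb a B"
  unfolding comb_def by (rule sum.union_disjoint)

lemma comb_diff: "finite S \<Longrightarrow> A \<subseteq> S \<Longrightarrow> comb a (S - A) = comb a S - comb a A"
  unfolding comb_def by (rule sum_diff)

lemma comb_add: "comb (\<lambda>k. a k + b k) S = comb a S + comb b S"
  by (simp add: comb_def fun_eq_iff sum_fscale_apply distrib_right sum.distrib)

lemma comb_scale: "comb (\<lambda>k. t * a k) S = t *\<^sub>F comb a S"
  by (simp add: comb_def fun_eq_iff sum_fscale_apply sum_distrib_left mult.assoc)

lemma comb_zero_outside: "finite S \<Longrightarrow> A \<subseteq> S \<Longrightarrow> comb (\<lambda>k. if k \<in> A then a k else 0) S = comb a A"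
proof -
  assume S: "finite S" "A \<subseteq> S"
  have "comb (\<lambda>k. if k \<in> A then a k else 0) S = (\<Sum>k\<in>S. if k \<in> A then a k *\<^sub>F \<Psi> k else 0)"
    unfolding comb_def by (intro sum.cong) (auto simp: fun_eq_iff)
  also have "\<dots> = (\<Sum>k\<in>S \<inter> A. a k *\<^sub>F \<Psi> k)"
    by (rule sum.inter_restrict[symmetric, OF S(1)])
  also have "S \<inter> A = A" using S by auto
  finally show ?thesis unfolding comb_def .
qed

lemma expansion_comb:
  assumes "finite S"
  shows "expansion p \<Psi> (comb a S) (\<lambda>k. if k \<in> S then a k else 0)"
proof -
  obtain M where M: "S \<subseteq> {..<M}"
    using finite_nat_iff_bounded[of S] assms by blast
  have "comb a S - (\<Sum>k<n. (if k \<in> S then a k else 0) *\<^sub>F \<Psi> k) = 0" if "n \<ge> M" for n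
    using comb_zero_outside[of "{..<n}" S a] that M by (force simp: comb_def)
  then have "\<forall>\<^sub>F n in sequentially. Lnorm p (comb a S - (\<Sum>k<n. (if k \<in> S then a k else 0) *\<^sub>F \<Psi> k)) = 0"
    unfolding eventually_sequentially by (metis Lnorm_zero)
  then show ?thesis unfolding expansion_def by (rule tendsto_eventually)
qed

lemma comb_eqD:
  assumes "finite S" "finite T" "comb a S = comb b T"
  shows "(if k \<in> S then a k else 0) = (if k \<in> T then b k else 0)"
proof -
  have "(\<lambda>k. if k \<in> S then a k else 0) = (\<lambda>k. if k \<in> T then b k else 0)"
    using expansion_comb[of S a] expansion_comb[of T b] assms
    by (intro expansion_unique[of "comb a S"]) auto
  then show ?thesis by meson
qed

lemma inj_Psi: "inj \<Psi>"
proof (rule injI)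
  fix i j assume "\<Psi> i = \<Psi> j"
  then have "comb (\<lambda>_. 1) {i} = comb (\<lambda>_. 1) {j}"
    by (simp add: comb_def)
  from comb_eqD[OF _ _ this, of i] show "i = j" by (auto split: if_splits)
qed

definition greedy_const :: "real \<Rightarrow> bool" where
  "greedy_const C \<longleftrightarrow> 1 \<le> C \<and>
     (\<forall>f\<in>Lp p. \<forall>c \<rho>. expansion p \<Psi> f c \<longrightarrow> decreasing_ordering c \<rho> \<longrightarrow>
        (\<forall>N\<ge>1. Lnorm p (f - TGA \<Psi> c \<rho> N) \<le> C * sigma_N p (range \<Psi>) N f))"

definition K :: real where
  "K = (SOME C. greedy_const C)"

lemma sigma_nonneg: "0 \<le> sigma_N p (range \<Psi>) N f"
  unfolding sigma_N_def Lp_dist_def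
proof (rule cINF_greatest)
  show "Sigma_N (range \<Psi>) N \<noteq> {}"
    unfolding Sigma_N_def by (auto intro!: exI[of _ "{}"])
qed auto

lemma K_ge_1: "1 \<le> K"
  and K_greedy: "f \<in> Lp p \<Longrightarrow> expansion p \<Psi> f c \<Longrightarrow> decreasing_ordering c \<rho> \<Longrightarrow> 1 \<le> N \<Longrightarrow>
    Lnorm p (f - TGA \<Psi> c \<rho> N) \<le> K * sigma_N p (range \<Psi>) N f"
proof -
  obtain C where C: "\<forall>f\<in>Lp p. \<forall>c \<rho>. expansion p \<Psi> f c \<longrightarrow> decreasing_ordering c \<rho> \<longrightarrow>
        (\<forall>N\<ge>1. Lnorm p (f - TGA \<Psi> c \<rho> N) \<le> C * sigma_N p (range \<Psi>) N f)"
    using greedy by (auto simp: greedy_basis_def)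
  have "greedy_const (max 1 C)"
    unfolding greedy_const_def
  proof (intro conjI ballI allI impI)
    fix f c \<rho> and N :: nat
    assume *: "f \<in> Lp p" "expansion p \<Psi> f c" "decreasing_ordering c \<rho>" "1 \<le> N"
    then have "Lnorm p (f - TGA \<Psi> c \<rho> N) \<le> C * sigma_N p (range \<Psi>) N f" using C by blast
    also have "\<dots> \<le> max 1 C * sigma_N p (range \<Psi>) N f"
      using sigma_nonneg by (intro mult_right_mono) auto
    finally show "Lnorm p (f - TGA \<Psi> c \<rho> N) \<le> max 1 C * sigma_N p (range \<Psi>) N f" .
  qed simp
  then have "greedy_const K"
    unfolding K_def by (rule someI)
  then show "1 \<le> K" "f \<in> Lp p \<Longrightarrow> expansion p \<Psi> f c \<Longrightarrow> decreasing_ordering c \<rho> \<Longrightarrow> 1 \<le> N \<Longrightarrow>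
    Lnorm p (f - TGA \<Psi> c \<rho> N) \<le> K * sigma_N p (range \<Psi>) N f"
    unfolding greedy_const_def by blast+
qed

lemma comb_in_Sigma:
  assumes "finite A" "card A \<le> N"
  shows "comb a A \<in> Sigma_N (range \<Psi>) N"
proof -
  have inj: "inj_on \<Psi> A" using inj_Psi by (rule inj_on_subset) simp
  have "comb a A = (\<Sum>g\<in>\<Psi> ` A. a (inv \<Psi> g) *\<^sub>F g)"
    using inj inj_Psi by (simp add: comb_def sum.reindex)
  then show ?thesis
    unfolding Sigma_N_def using assms card_image[OF inj]
    by (auto intro!: exI[of _ "\<Psi> ` A"] exI[of _ "\<lambda>g. a (inv \<Psi> g)"])
qed

lemma Sigma_combE:
  assumes "g \<in> Sigma_N (range \<Psi>) N"
  obtains A a where "finite A" "card A \<le> N" "g = comb a A"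
proof -
  from assms obtain D b where D: "D \<subseteq> range \<Psi>" "finite D" "card D \<le> N" "g = (\<Sum>d\<in>D. b d *\<^sub>F d)"
    by (auto simp: Sigma_N_def)
  then obtain A where A: "D = \<Psi> ` A" by (auto simp: subset_image_iff)
  have inj: "inj_on \<Psi> A" using inj_Psi by (rule inj_on_subset) simp
  show ?thesis
    using D A inj by (intro that[of A "b \<circ> \<Psi>"])
      (auto simp: comb_def sum.reindex finite_image_iff card_image)
qed

lemma sigma_le: "finite A \<Longrightarrow> card A \<le> N \<Longrightarrow> sigma_N p (range \<Psi>) N f \<le> Lnorm p (f - comb a A)"
  unfolding sigma_N_def by (intro Lp_dist_le comb_in_Sigma)

text \<open>The form in which the greedy inequality is applied from here on. As it is assumed for
  every way of breaking ties, any set B of coefficients that dominate the others, even weakly, may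
  be the set taken first.\<close>

lemma greedy_comb:
  assumes S: "finite S" "B \<subseteq> S" "B \<noteq> {}"
    and dom: "\<And>i j. i \<in> B \<Longrightarrow> j \<in> S - B \<Longrightarrow> norm (a j) \<le> norm (a i)"
  shows "Lnorm p (comb a (S - B)) \<le> K * sigma_N p (range \<Psi>) (card B) (comb a S)"
proof -
  define c where "c k = (if k \<in> S then a k else 0)" for k
  have B: "finite B" using S finite_subset by auto
  obtain \<rho> where \<rho>: "decreasing_ordering c \<rho>" "\<rho> ` {..<card B} = B"
  proof (rule decreasing_ordering_starting_with[OF B, of c])
    show "finite {k. c k \<noteq> 0}" by (rule finite_subset[OF _ S(1)]) (auto simp: c_def)
    show "norm (c j) \<le> norm (c i)" if "i \<in> B" "j \<notin> B" for i j
      using that dom[of i j] S by (auto simp: c_def)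
  qed
  have "inj_on \<rho> {..<card B}"
    using \<rho>(1) unfolding decreasing_ordering_def by (meson inj_on_subset subset_UNIV)
  then have "TGA \<Psi> c \<rho> (card B) = (\<Sum>k\<in>\<rho> ` {..<card B}. c k *\<^sub>F \<Psi> k)"
    by (simp add: TGA_def sum.reindex)
  also have "\<dots> = comb a B"
    unfolding \<rho>(2) comb_def using S by (intro sum.cong) (auto simp: c_def)
  finally have TGA: "TGA \<Psi> c \<rho> (card B) = comb a B" .
  have "Lnorm p (comb a S - TGA \<Psi> c \<rho> (card B)) \<le> K * sigma_N p (range \<Psi>) (card B) (comb a S)"
    using expansion_comb[OF S(1), of a] \<rho>(1) B S(3)
    by (intro K_greedy) (auto simp: c_def[abs_def] Suc_le_eq card_gt_0_iff)
  then show ?thesis unfolding TGA using comb_diff[OF S(1,2)] by simp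
qed

text \<open>
  Raising all coefficients on \<open>A\<close> by a large constant makes \<open>comb a (S - A)\<close> the greedy remainder
  of an element whose best \<open>card A\<close>-term error is at most the norm of \<open>comb a S\<close>.
\<close>

lemma unconditional_compl:
  assumes S: "finite S" "A \<subseteq> S"
  shows "Lnorm p (comb a (S - A)) \<le> K * Lnorm p (comb a S)"
proof (cases "A = {}")
  case True
  then show ?thesis using mult_right_mono[OF K_ge_1, of "Lnorm p (comb a S)"] by simp
next
  case False
  have A: "finite A" using S finite_subset by auto
  define t where "t = 2 * (\<Sum>k\<in>S. norm (a k))"
  have t: "norm (a j) \<le> t / 2" if "j \<in> S" for j
    using member_le_sum[of j S "\<lambda>k. norm (a k)"] S that by (simp add: t_def)
  define b where "b k = a k + (if k \<in> A then of_real t else 0)" for k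
  have "Lnorm p (comb b (S - A)) \<le> K * sigma_N p (range \<Psi>) (card A) (comb b S)"
  proof (rule greedy_comb[OF S False])
    fix i j assume ij: "i \<in> A" "j \<in> S - A"
    have "0 \<le> t" by (simp add: t_def sum_nonneg)
    have "norm (a j) \<le> t - norm (a i)" using t[of j] t[of i] ij S by auto
    also have "\<dots> \<le> norm (of_real t + a i)"
      using norm_diff_ineq[of "of_real t :: 'k" "a i"] \<open>0 \<le> t\<close> by simp
    finally show "norm (b j) \<le> norm (b i)" using ij by (simp add: b_def add.commute)
  qed
  also have "comb b (S - A) = comb a (S - A)" by (rule comb_cong) (auto simp: b_def)
  also have "sigma_N p (range \<Psi>) (card A) (comb b S) \<le> Lnorm p (comb b S - comb (\<lambda>_. of_real t) A)"
    by (rule sigma_le[OF A order_refl])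
  also have "comb b S = comb a S + comb (\<lambda>_. of_real t) A"
    unfolding b_def comb_add comb_zero_outside[OF S] ..
  finally show ?thesis using K_ge_1 by simp
qed

lemma unconditional:
  assumes "finite S" "A \<subseteq> S"
  shows "Lnorm p (comb a A) \<le> K * Lnorm p (comb a S)"
proof -
  have "S - (S - A) = A" using assms by auto
  then show ?thesis using unconditional_compl[of S "S - A" a] assms by auto
qed

lemma unconditional_multiplier:
  assumes S: "finite S" and t: "\<And>k. k \<in> S \<Longrightarrow> 0 \<le> t k \<and> t k \<le> (1::real)"
  shows "Lnorm p (comb (\<lambda>k. of_real (t k) * a k) S) \<le> K * Lnorm p (comb a S)"
proof -
  have eq: "comb (\<lambda>k. of_real (t k) * a k) S = 0 + (\<Sum>k\<in>S. of_real (t k) *\<^sub>F (a k *\<^sub>F \<Psi> k))"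
    by (simp add: comb_def fun_eq_iff sum_fun_apply mult.assoc)
  show ?thesis
    unfolding eq
  proof (rule Lnorm_convex_combination_le[OF p1 S])
    fix B assume "B \<subseteq> S"
    then show "Lnorm p (0 + (\<Sum>i\<in>B. a i *\<^sub>F \<Psi> i)) \<le> K * Lnorm p (comb a S)"
      using unconditional[OF S] by (simp add: comb_def)
  qed (use t in auto)
qed

text \<open>All coefficients on the union have modulus 1, so the algorithm may take B first and
  leaves the part on A. Removing A instead is a competitor with at most \<open>card B\<close> terms
  and leaves the part on B.\<close>

lemma democratic_disjoint:
  assumes fin: "finite A" "finite B" and "A \<inter> B = {}" and "B \<noteq> {}" and "card A \<le> card B"
    and unit: "\<And>k. k \<in> A \<union> B \<Longrightarrow> norm (a k) = 1"
  shows "Lnorm p (comb a A) \<le> K * Lnorm p (comb a B)"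
proof -
  have "Lnorm p (comb a ((A \<union> B) - B)) \<le> K * sigma_N p (range \<Psi>) (card B) (comb a (A \<union> B))"
    using assms by (intro greedy_comb) auto
  also have "(A \<union> B) - B = A" using assms by auto
  also have "sigma_N p (range \<Psi>) (card B) (comb a (A \<union> B)) \<le> Lnorm p (comb a (A \<union> B) - comb a A)"
    using assms by (intro sigma_le) auto
  also have "comb a (A \<union> B) = comb a A + comb a B"
    using assms by (intro comb_Un) auto
  finally show ?thesis using K_ge_1 by simp
qed

text \<open>The disjoint case is applied twice, through a third set that is disjoint from both A and
  B; each passage costs a factor \<open>K\<close>.\<close>

lemma democratic:
  assumes fin: "finite A" "finite B" and card: "card A = card B"
    and unit: "\<And>k. k \<in> A \<Longrightarrow> norm (a k) = 1" "\<And>k. k \<in> B \<Longrightarrow> norm (b k) = 1"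
  shows "Lnorm p (comb a A) \<le> K\<^sup>2 * Lnorm p (comb b B)"
proof (cases "A = {}")
  case False
  then have B: "B \<noteq> {}" using card fin by auto
  have "infinite (UNIV - (A \<union> B))" using fin by (simp add: Diff_infinite_finite)
  then obtain D where D: "finite D" "card D = card A" "D \<subseteq> UNIV - (A \<union> B)"
    using infinite_arbitrarily_large by blast
  have D0: "D \<noteq> {}" using D False fin by auto
  have "Lnorm p (comb a A) = Lnorm p (comb (\<lambda>k. if k \<in> A then a k else 1) A)"
    by (intro arg_cong[of _ _ "Lnorm p"] comb_cong) auto
  also have "\<dots> \<le> K * Lnorm p (comb (\<lambda>k. if k \<in> A then a k else 1) D)"
    using D D0 fin unit by (intro democratic_disjoint) auto
  also have "comb (\<lambda>k. if k \<in> A then a k else 1) D = comb (\<lambda>k. if k \<in> B then b k else 1) D"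
    using D by (intro comb_cong) auto
  also have "Lnorm p \<dots> \<le> K * Lnorm p (comb (\<lambda>k. if k \<in> B then b k else 1) B)"
    using D B fin unit card by (intro democratic_disjoint) auto
  also have "comb (\<lambda>k. if k \<in> B then b k else 1) B = comb b B"
    by (intro comb_cong) auto
  finally show ?thesis using K_ge_1 by (simp add: power2_eq_square mult.assoc)
qed (use K_ge_1 in simp)

end

section \<open>Lower \<open>p\<close>-estimates and sums of coefficients\<close>

lemma Lint_clarkson_ge:
  fixes f g :: "real \<Rightarrow> 'k::Lp_scalar"
  assumes p: "2 \<le> p" and f: "f \<in> Lp p" and g: "g \<in> Lp p"
  shows "2 * Lint p f + 2 * Lint p g \<le> Lint p (f + g) + Lint p (f - g)"
proof -
  have fg: "f + g \<in> Lp p" "f - g \<in> Lp p"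
    using p by (auto intro!: Lp_add[OF _ f g] Lp_diff[OF _ f g])
  have "2 * Lint p f + 2 * Lint p g = integral\<^sup>L \<I> (\<lambda>x. 2 * norm (f x) powr p + 2 * norm (g x) powr p)"
    unfolding Lint_def using LpD(2)[OF f] LpD(2)[OF g] by simp
  also have "\<dots> \<le> integral\<^sup>L \<I> (\<lambda>x. norm ((f + g) x) powr p + norm ((f - g) x) powr p)"
    using LpD(2)[OF f] LpD(2)[OF g] LpD(2)[OF fg(1)] LpD(2)[OF fg(2)] clarkson_ge[OF p]
    by (intro integral_mono) auto
  also have "\<dots> = Lint p (f + g) + Lint p (f - g)"
    unfolding Lint_def using LpD(2)[OF fg(1)] LpD(2)[OF fg(2)] by simp
  finally show ?thesis .
qed

text \<open>The increment of n^s is at least s n^(s-1). This drives the induction that sums the weak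
  estimates n^(s-1) to n^s / s.\<close>

lemma powr_pred_concave:
  fixes s :: real and n :: nat
  assumes "0 < s" "s \<le> 1" "1 \<le> n"
  shows "real (n - 1) powr s + s * real n powr (s - 1) \<le> real n powr s"
proof -
  have n: "real n > 0" using assms by simp
  have "real (n - 1) powr s * real n powr (1 - s) \<le> s * real (n - 1) + (1 - s) * real n"
    using assms by (intro young_powr) auto
  also have "\<dots> = real n - s" using assms by (simp add: of_nat_diff algebra_simps)
  finally have "(real (n - 1) powr s * real n powr (1 - s)) * real n powr (s - 1)
      \<le> (real n - s) * real n powr (s - 1)"
    by (intro mult_right_mono) auto
  moreover have "real n powr (1 - s) * real n powr (s - 1) = 1"
    using n by (simp add: powr_add[symmetric])
  moreover have "real n * real n powr (s - 1) = real n powr s"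
    using powr_mult_base[of "real n" "s - 1"] by simp
  ultimately show ?thesis by (simp add: left_diff_distrib mult.assoc)
qed

context greedy_Lp
begin

text \<open>One set and one unimodular choice of coefficients for each cardinality are enough,
  because \<open>democratic\<close> transfers the bound to all others.\<close>

definition lower_p_estimate :: "real \<Rightarrow> bool" where
  "lower_p_estimate \<delta> \<longleftrightarrow> 0 < \<delta> \<and> (\<forall>N. \<exists>B a. finite B \<and> card B = N \<and> (\<forall>k\<in>B. norm (a k) = 1) \<and>
     \<delta> * real N powr (1/p) \<le> Lnorm p (comb a B))"

text \<open>By Clarkson's inequality one of f + psi and f - psi has p-th power of the norm at least
  ||f||^p + 1 for a normalized psi, so signs can be chosen one after the other.\<close>

lemma lower_p_estimate_ge2:
  assumes p2: "2 \<le> p"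
  shows "lower_p_estimate 1"
proof -
  have signs: "\<exists>a. (\<forall>k. norm (a k) = 1) \<and> real (card B) \<le> Lint p (comb a B)" if "finite B" for B
    using that
  proof (induction B rule: finite_induct)
    case empty
    show ?case by (auto intro!: exI[of _ "\<lambda>_. 1"] simp: Lint_nonneg)
  next
    case (insert j B)
    then obtain a where a: "\<And>k. norm (a k) = 1" "real (card B) \<le> Lint p (comb a B)" by auto
    have Psi: "Lint p (\<Psi> j) = 1" using p0 by (simp add: Lint_eq_Lnorm)
    have "2 * Lint p (comb a B) + 2 * Lint p (\<Psi> j) \<le> Lint p (comb a B + \<Psi> j) + Lint p (comb a B - \<Psi> j)"
      using p2 by (intro Lint_clarkson_ge) auto
    then have "real (card B) + 1 \<le> Lint p (comb a B + \<Psi> j) \<or> real (card B) + 1 \<le> Lint p (comb a B - \<Psi> j)"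
      using a(2) Psi by linarith
    moreover have "comb (a(j := s)) (insert j B) = comb a B + s *\<^sub>F \<Psi> j" for s
    proof -
      have "comb (a(j := s)) (insert j B) = comb (a(j := s)) B + comb (a(j := s)) {j}"
        using comb_Un[of B "{j}" "a(j := s)"] insert.hyps by simp
      also have "comb (a(j := s)) B = comb a B" using insert.hyps by (intro comb_cong) auto
      also have "comb (a(j := s)) {j} = s *\<^sub>F \<Psi> j" unfolding comb_def by simp
      finally show ?thesis .
    qed
    moreover have "f + 1 *\<^sub>F \<Psi> j = f + \<Psi> j" "f + (-1) *\<^sub>F \<Psi> j = f - \<Psi> j" for f
      by (auto simp: fun_eq_iff)
    ultimately have "\<exists>s. norm s = 1 \<and> real (card B) + 1 \<le> Lint p (comb (a(j := s)) (insert j B))"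
      by (metis norm_minus_cancel norm_one)
    then obtain s where "norm s = 1" "real (card B) + 1 \<le> Lint p (comb (a(j := s)) (insert j B))"
      by blast
    then show ?case using a(1) insert.hyps
      by (intro exI[of _ "a(j := s)"] conjI) (simp_all add: add.commute del: fun_upd_apply, simp)
  qed
  have "\<exists>B a. finite B \<and> card B = N \<and> (\<forall>k\<in>B. norm (a k) = 1) \<and>
     1 * real N powr (1/p) \<le> Lnorm p (comb a B)" for N
  proof -
    obtain a where a: "\<forall>k. norm (a k) = 1" "real N \<le> Lint p (comb a {..<N})"
      using signs[of "{..<N}"] by auto
    then have "real N powr (1/p) \<le> Lnorm p (comb a {..<N})"
      unfolding Lnorm_eq_Lint using p0 by (intro powr_mono2) auto
    then show ?thesis using a by (intro exI[of _ "{..<N}"] exI[of _ a]) auto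
  qed
  then show ?thesis by (simp add: lower_p_estimate_def)
qed

text \<open>The coefficients on A are scaled down to the common modulus |a i|. In
  \<open>K ^ 4\<close>, democracy accounts for two factors, the multiplier |a i| / |a k| <= 1 for
  one and the restriction from S to A for one.\<close>

lemma weak_lp_bound:
  assumes lower: "lower_p_estimate \<delta>" and S: "finite S" "A \<subseteq> S" and i: "i \<in> A"
    and min: "\<And>k. k \<in> A \<Longrightarrow> norm (a i) \<le> norm (a k)"
  shows "norm (a i) * real (card A) powr (1/p) \<le> K ^ 4 / \<delta> * Lnorm p (comb a S)"
proof (cases "a i = 0")
  case True
  then show ?thesis using K_ge_1 lower by (simp add: lower_p_estimate_def)
next
  case False
  define t where "t = norm (a i)"
  have t: "t > 0" using False by (simp add: t_def)
  have A: "finite A" using S finite_subset by auto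
  have delta: "0 < \<delta>" using lower by (simp add: lower_p_estimate_def)
  have pos: "norm (a k) > 0" if "k \<in> A" for k using min[OF that] t unfolding t_def by linarith
  define s where "s k = a k / of_real (norm (a k))" for k
  obtain B b where B: "finite B" "card B = card A" "\<And>k. k \<in> B \<Longrightarrow> norm (b k) = 1"
     "\<delta> * real (card A) powr (1/p) \<le> Lnorm p (comb b B)"
    using lower unfolding lower_p_estimate_def by metis
  have "Lnorm p (comb b B) \<le> K\<^sup>2 * Lnorm p (comb s A)"
  proof (rule democratic)
    fix k assume "k \<in> A"
    then show "norm (s k) = 1" using pos[of k] by (simp add: s_def norm_divide)
  qed (use A B in auto)
  with B(4) have "\<delta> * real (card A) powr (1/p) \<le> K\<^sup>2 * Lnorm p (comb s A)" by simp
  then have "t * (\<delta> * real (card A) powr (1/p)) \<le> t * (K\<^sup>2 * Lnorm p (comb s A))"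
    using t by (intro mult_left_mono) auto
  also have "\<dots> = K\<^sup>2 * Lnorm p (of_real t *\<^sub>F comb s A)"
    using t p0 by (simp add: Lnorm_scale)
  also have "of_real t *\<^sub>F comb s A = comb (\<lambda>k. of_real (t / norm (a k)) * a k) A"
    unfolding comb_scale[symmetric] by (intro comb_cong) (simp add: s_def)
  also have "K\<^sup>2 * Lnorm p (comb (\<lambda>k. of_real (t / norm (a k)) * a k) A) \<le> K\<^sup>2 * (K * Lnorm p (comb a A))"
    using t min pos A by (intro mult_left_mono unconditional_multiplier) (auto simp: t_def divide_le_eq)
  also have "\<dots> \<le> K\<^sup>2 * (K * (K * Lnorm p (comb a S)))"
    using K_ge_1 S by (intro mult_left_mono unconditional) auto
  finally have "t * (\<delta> * real (card A) powr (1/p)) \<le> K ^ 4 * Lnorm p (comb a S)"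
    by (simp add: power_numeral_reduce mult_ac)
  then show ?thesis using delta by (simp add: t_def field_simps)
qed

text \<open>The coefficient of least modulus on a set of n indices is at most a constant times
  n^(-1/p). It is removed and the argument repeated; summing n^(-1/p) gives n^(1-1/p) /
  (1-1/p).\<close>

lemma sum_coeff_bound:
  assumes lower: "lower_p_estimate \<delta>" and S: "finite S" and "A \<subseteq> S"
  shows "(\<Sum>k\<in>A. norm (a k))
    \<le> K ^ 4 / \<delta> / (1 - 1/p) * real (card A) powr (1 - 1/p) * Lnorm p (comb a S)"
  using assms(3)
proof (induction "card A" arbitrary: A)
  case 0
  then have "A = {}" using S finite_subset by fastforce
  then show ?case by simp
next
  case (Suc n)
  define s where "s = 1 - 1/p"
  have s: "0 < s" "s \<le> 1" using p by (auto simp: s_def)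
  define D where "D = K ^ 4 / \<delta> * Lnorm p (comb a S)"
  have D: "0 \<le> D" using K_ge_1 lower by (auto simp: D_def lower_p_estimate_def)
  have A: "finite A" "A \<noteq> {}" using Suc S finite_subset by auto
  obtain i where i: "i \<in> A" "\<And>k. k \<in> A \<Longrightarrow> norm (a i) \<le> norm (a k)"
    using ex_min_if_finite[of "(\<lambda>k. norm (a k)) ` A"] A by (auto simp: not_less)
  have c: "card A = Suc n" "card (A - {i}) = n" using Suc i A by auto
  have 1: "norm (a i) * real (card A) powr (1/p) \<le> D"
    unfolding D_def by (rule weak_lp_bound[OF lower S Suc.prems i(1)]) (rule i(2))
  have "norm (a i) = norm (a i) * real (card A) powr (1/p) * real (card A) powr (s - 1)"
    using c by (simp add: s_def powr_add[symmetric] mult.assoc)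
  also have "\<dots> \<le> D * real (card A) powr (s - 1)"
    using 1 by (intro mult_right_mono) auto
  finally have 2: "norm (a i) \<le> D * real (Suc n) powr (s - 1)" by (simp add: c)
  have 3: "(\<Sum>k\<in>A - {i}. norm (a k)) \<le> D / s * real n powr s"
    using Suc(1)[of "A - {i}"] Suc.prems c by (auto simp: s_def D_def mult_ac)
  have "(\<Sum>k\<in>A. norm (a k)) = norm (a i) + (\<Sum>k\<in>A - {i}. norm (a k))"
    using A i by (intro sum.remove) auto
  also have "\<dots> \<le> D * real (Suc n) powr (s - 1) + D / s * real n powr s"
    using 2 3 by simp
  also have "\<dots> = D / s * (real n powr s + s * real (Suc n) powr (s - 1))"
    using s by (simp add: field_simps)
  also have "\<dots> \<le> D / s * real (Suc n) powr s"
    using powr_pred_concave[of s "Suc n"] s D by (intro mult_left_mono) auto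
  finally show ?case by (simp add: s_def D_def c mult_ac)
qed

end

section \<open>Bounded functionals\<close>

lemma Lp_dual_add: "F \<in> Lp_dual p \<Longrightarrow> f \<in> Lp p \<Longrightarrow> g \<in> Lp p \<Longrightarrow> F (f + g) = F f + F g"
  and Lp_dual_scale: "F \<in> Lp_dual p \<Longrightarrow> f \<in> Lp p \<Longrightarrow> F (a *\<^sub>F f) = a * F f"
  by (auto simp: Lp_dual_def)

lemma Lp_dual_sum:
  fixes g :: "'i \<Rightarrow> real \<Rightarrow> 'k::Lp_scalar"
  assumes p: "1 \<le> p" and F: "F \<in> Lp_dual p" and "\<And>i. i \<in> A \<Longrightarrow> g i \<in> Lp p"
  shows "F (\<Sum>i\<in>A. a i *\<^sub>F g i) = (\<Sum>i\<in>A. a i * F (g i))"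
proof -
  have "0 *\<^sub>F 0 = (0 :: real \<Rightarrow> 'k)" by (simp add: fun_eq_iff)
  then have F0: "F 0 = 0" using Lp_dual_scale[OF F, of 0 0] by simp
  show ?thesis
    using assms(3)
  proof (induction A rule: infinite_finite_induct)
    case (infinite A)
    show ?case by (simp only: sum.infinite[OF infinite(1)] F0)
  next
    case empty
    show ?case by (simp only: sum.empty F0)
  next
    case (insert j A)
    have "F (\<Sum>i\<in>insert j A. a i *\<^sub>F g i) = F (a j *\<^sub>F g j + (\<Sum>i\<in>A. a i *\<^sub>F g i))"
      by (simp only: sum.insert[OF insert.hyps])
    also have "\<dots> = F (a j *\<^sub>F g j) + F (\<Sum>i\<in>A. a i *\<^sub>F g i)"
      using insert.prems p by (intro Lp_dual_add[OF F] Lp_scale Lp_sum) auto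
    also have "F (\<Sum>i\<in>A. a i *\<^sub>F g i) = (\<Sum>i\<in>A. a i * F (g i))"
      using insert.prems by (intro insert.IH) auto
    also have "F (a j *\<^sub>F g j) = a j * F (g j)"
      using insert.prems by (intro Lp_dual_scale[OF F]) auto
    finally show ?case by (simp only: sum.insert[OF insert.hyps])
  qed
qed

lemma dual_norm_bdd:
  fixes F :: "(real \<Rightarrow> 'k::Lp_scalar) \<Rightarrow> 'k"
  assumes F: "F \<in> Lp_dual p"
  shows "bdd_above ((\<lambda>f. norm (F f)) ` {f \<in> Lp p. Lnorm p f \<le> 1})"
proof -
  obtain C where C: "\<And>g. g \<in> Lp p \<Longrightarrow> norm (F g) \<le> C * Lnorm p g"
    using F unfolding Lp_dual_def by blast
  show ?thesis
  proof (rule bdd_aboveI2)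
    fix h :: "real \<Rightarrow> 'k" assume "h \<in> {f \<in> Lp p. Lnorm p f \<le> 1}"
    moreover have "C * Lnorm p h \<le> \<bar>C\<bar> * 1" if "Lnorm p h \<le> 1"
      using that by (intro mult_mono) auto
    ultimately show "norm (F h) \<le> \<bar>C\<bar>"
      using C[of h] by auto
  qed
qed

lemma dual_norm_bound:
  fixes g :: "real \<Rightarrow> 'k::Lp_scalar"
  assumes p: "1 \<le> p" and F: "F \<in> Lp_dual p" and g: "g \<in> Lp p"
  shows "norm (F g) \<le> dual_norm p F * Lnorm p g"
proof (cases "Lnorm p g = 0")
  case True
  obtain C where "\<And>g. g \<in> Lp p \<Longrightarrow> norm (F g) \<le> C * Lnorm p g"
    using F unfolding Lp_dual_def by blast
  from this[OF g] show ?thesis using True by simp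
next
  case False
  define c where "c = Lnorm p g"
  have c: "c > 0" using False Lnorm_nonneg[of p g] unfolding c_def by linarith
  have "of_real (1 / c) *\<^sub>F g \<in> Lp p" "Lnorm p (of_real (1 / c) *\<^sub>F g) \<le> 1"
    using g c p by (auto simp: Lnorm_scale norm_divide c_def[symmetric] simp del: of_real_divide)
  then have "of_real (1 / c) *\<^sub>F g \<in> {f \<in> Lp p. Lnorm p f \<le> 1}" by blast
  then have "norm (F (of_real (1 / c) *\<^sub>F g)) \<le> dual_norm p F"
    unfolding dual_norm_def using cSUP_upper[OF _ dual_norm_bdd[OF F]] by blast
  also have "F (of_real (1 / c) *\<^sub>F g) = of_real (1 / c) * F g"
    by (rule Lp_dual_scale[OF F g])
  finally have "norm (F g) / c \<le> dual_norm p F" using c by (simp add: norm_mult norm_divide)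
  then show ?thesis using c by (simp add: c_def divide_le_eq)
qed

lemma norming_functional_bound:
  fixes f g :: "real \<Rightarrow> 'k::Lp_scalar"
  assumes "1 \<le> p" and "norming_functional p f F" and "g \<in> Lp p"
  shows "norm (F g) \<le> Lnorm p g"
  using dual_norm_bound[of p F g] assms by (simp add: norming_functional_def)

lemma aligned_unit:
  fixes a b :: "'k::real_normed_field"
  obtains \<omega> where "norm \<omega> = 1" "norm (a + \<omega> * b) = norm a + norm b"
proof (cases "a = 0 \<or> b = 0")
  case True
  then show ?thesis by (intro that[of 1]) auto
next
  case False
  define \<omega> where "\<omega> = of_real (norm b / norm a) * a / b"
  have "a + \<omega> * b = a * of_real (1 + norm b / norm a)"
    using False by (simp add: \<omega>_def algebra_simps)
  then have "norm (a + \<omega> * b) = norm a * \<bar>1 + norm b / norm a\<bar>"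
    by (simp only: norm_mult norm_of_real)
  also have "\<bar>1 + norm b / norm a\<bar> = 1 + norm b / norm a" by (intro abs_of_nonneg add_nonneg_nonneg) auto
  also have "norm a * (1 + norm b / norm a) = norm a + norm b" using False by (simp add: field_simps)
  finally show ?thesis using False by (intro that[of \<omega>]) (auto simp: \<omega>_def norm_mult norm_divide)
qed

text \<open>
  Bounded functionals are uniformly small on tails: a function with a norm-one part on which the
  functional is almost maximal, glued to a disjointly supported tail on which it is not small, would
  exceed the norm of the functional, since \<open>(1 + t\<^sup>p)\<^sup>1\<^sup>/\<^sup>p - 1 = o(t)\<close>.
\<close>

lemma functional_tail_small:
  fixes F :: "(real \<Rightarrow> 'k::Lp_scalar) \<Rightarrow> 'k"
  assumes p: "1 < p" and F: "F \<in> Lp_dual p" and eps: "0 < \<epsilon>" and b: "0 \<le> b"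
  shows "\<exists>M0>0. \<forall>M\<ge>M0. \<forall>f\<in>Lp p. Lnorm p f \<le> b \<longrightarrow> norm (F (restr (\<lambda>x. M < norm (f x)) f)) \<le> \<epsilon>"
proof -
  have p1: "1 \<le> p" and p0: "0 < p" using p by auto
  define s where "s = dual_norm p F"
  have ne: "{f \<in> Lp p. Lnorm p f \<le> 1} \<noteq> {}" by (auto intro: exI[of _ 0])
  have "norm (F 0) \<le> s"
    unfolding s_def dual_norm_def by (rule cSUP_upper[OF _ dual_norm_bdd[OF F]]) simp
  then have s: "0 \<le> s" using norm_ge_zero order_trans by blast
  \<comment> \<open>With this t the excess s t^p b^p is at most t epsilon / 2, which is possible
    because p > 1. The summand 1 keeps the denominator positive.\<close>
  define t where "t = (\<epsilon> / (2 * (s * b powr p + 1))) powr (1 / (p - 1))"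
  have den: "0 < s * b powr p + 1" using s by (simp add: add_nonneg_pos)
  have t: "0 < t" using eps den by (simp add: t_def)
  have tp: "s * t powr p * b powr p \<le> t * \<epsilon> / 2"
  proof -
    have "t powr (p - 1) = \<epsilon> / (2 * (s * b powr p + 1))"
      using eps den p by (simp add: t_def powr_powr)
    then have "t powr p = t * (\<epsilon> / (2 * (s * b powr p + 1)))"
      using powr_mult_base[of t "p - 1"] t by simp
    then have "s * t powr p * b powr p = t * \<epsilon> / 2 * (s * b powr p / (s * b powr p + 1))"
      by simp
    also have "\<dots> \<le> t * \<epsilon> / 2 * 1"
      using t eps den by (intro mult_left_mono) auto
    finally show ?thesis by simp
  qed
  \<comment> \<open>The losses add up to t epsilon: one quarter because g is only almost maximal,
    one quarter from the piece w of g that is cut out, and one half from the excess of the norm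
    above 1.\<close>
  define \<eta> \<rho> where "\<eta> = \<epsilon> * t / 4" and "\<rho> = \<epsilon> * t / (4 * (s + 1))"
  have eta: "0 < \<eta>" and rho: "0 < \<rho>" using eps t s by (auto simp: \<eta>_def \<rho>_def)
  have s_rho: "s * \<rho> \<le> \<epsilon> * t / 4"
  proof -
    have "s * \<rho> = \<epsilon> * t / 4 * (s / (s + 1))" by (simp add: \<rho>_def)
    also have "\<dots> \<le> \<epsilon> * t / 4 * 1" using eps t s by (intro mult_left_mono) auto
    finally show ?thesis by simp
  qed
  have "s - \<eta> < s" using eta by simp
  then obtain g where g: "g \<in> Lp p" "Lnorm p g \<le> 1" "s - \<eta> < norm (F g)"
    unfolding s_def dual_norm_def using less_cSUP_iff[OF ne dual_norm_bdd[OF F]] by auto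
  obtain n :: nat where n: "Lnorm p (restr (\<lambda>x. real n < norm (g x)) g) < \<rho> / 2"
    using order_tendstoD(2)[OF restr_above_tendsto_0[OF p0 g(1)], of "\<rho> / 2"] rho
    by (auto simp: eventually_sequentially)
  have [measurable]: "g \<in> borel_measurable \<I>" using LpD[OF g(1)] by auto
  \<comment> \<open>Where |f| > M, the part of g bounded by n is at most (n/M) |f|, so its norm is
    at most n b / M, which is below rho / 2 for such M.\<close>
  define M0 where "M0 = 2 * real n * b / \<rho> + 1"
  have "0 < M0" using b rho by (simp add: M0_def add_nonneg_pos)
  moreover have "norm (F (restr (\<lambda>x. M < norm (f x)) f)) \<le> \<epsilon>"
    if M: "M0 \<le> M" and f: "f \<in> Lp p" "Lnorm p f \<le> b" for M f
  proof -
    have [measurable]: "f \<in> borel_measurable \<I>" using LpD[OF f(1)] by auto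
    have M_pos: "0 < M" using M \<open>0 < M0\<close> by simp
    define E where "E x \<longleftrightarrow> M < norm (f x)" for x
    have [measurable]: "Measurable.pred \<I> E" unfolding E_def by measurable
    define u v w where "u = restr E f" and "v = restr (\<lambda>x. \<not> E x) g" and "w = restr E g"
    have u: "u \<in> Lp p" "Lnorm p u \<le> b" and v: "v \<in> Lp p" "Lnorm p v \<le> 1" and w: "w \<in> Lp p"
      using restr_Lp[OF p0 f(1), of E] restr_Lp[OF p0 g(1), of "\<lambda>x. \<not> E x"] restr_Lp[OF p0 g(1), of E] f(2) g(2)
      by (auto simp: u_def v_def w_def)
    have "Lnorm p w \<le> \<rho>"
    proof -
      define w1 w2 where "w1 = restr (\<lambda>x. E x \<and> real n < norm (g x)) g"
        and "w2 = restr (\<lambda>x. E x \<and> \<not> real n < norm (g x)) g"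
      have w12: "w1 \<in> Lp p" "w2 \<in> Lp p" unfolding w1_def w2_def by (rule restr_Lp[OF p0 g(1)], measurable)+
      have "w = w1 + w2" by (auto simp: w_def w1_def w2_def restr_def fun_eq_iff)
      then have "Lnorm p w \<le> Lnorm p w1 + Lnorm p w2" using Lnorm_triangle[OF p1 w12] by simp
      also have "Lnorm p w1 \<le> Lnorm p (restr (\<lambda>x. real n < norm (g x)) g)"
        by (rule Lnorm_mono[OF w12(1) restr_Lp(1)[OF p0 g(1)] _ p0]) (measurable, auto simp: w1_def restr_def)
      also have "Lnorm p w2 \<le> Lnorm p (of_real (real n / M) *\<^sub>F f)"
      proof (rule Lnorm_mono[OF w12(2) Lp_scale[OF f(1)] _ p0])
        fix x
        show "norm (w2 x) \<le> norm ((of_real (real n / M) *\<^sub>F f) x)"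
        proof (cases "E x \<and> \<not> real n < norm (g x)")
          case True
          then have "norm (w2 x) \<le> real n / M * M" using M_pos by (simp add: w2_def restr_def)
          also have "\<dots> \<le> real n / M * norm (f x)"
            using True M_pos by (intro mult_left_mono) (auto simp: E_def)
          also have "\<dots> = norm ((of_real (real n / M) *\<^sub>F f) x)"
            using M_pos by (simp add: norm_mult norm_divide)
          finally show ?thesis .
        qed (auto simp: w2_def restr_def)
      qed
      also have "\<dots> = real n / M * Lnorm p f" using p0 M_pos by (simp add: Lnorm_scale norm_divide)
      also have "\<dots> \<le> real n / M * b" using f M_pos by (intro mult_left_mono) auto
      also have "\<dots> \<le> \<rho> / 2"
      proof -
        have "2 * real n * b / \<rho> \<le> M" using M by (simp add: M0_def)
        then have "2 * real n * b \<le> M * \<rho>" using rho by (simp add: divide_le_eq)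
        then show ?thesis using M_pos by (simp add: field_simps)
      qed
      finally show ?thesis using n by simp
    qed
    have "norm (F w) \<le> s * Lnorm p w"
      unfolding s_def by (rule dual_norm_bound[OF p1 F w])
    also have "\<dots> \<le> s * \<rho>" using s \<open>Lnorm p w \<le> \<rho>\<close> by (rule mult_left_mono[rotated])
    finally have Fw: "norm (F w) \<le> \<epsilon> * t / 4" using s_rho by simp
    have "g = v + w" by (auto simp: v_def w_def restr_def fun_eq_iff)
    then have "F g = F v + F w" using Lp_dual_add[OF F v(1) w] by simp
    then have Fv: "s - \<eta> - \<epsilon> * t / 4 \<le> norm (F v)"
      using g(3) Fw norm_triangle_ineq[of "F v" "F w"] by simp
    obtain \<omega> where \<omega>: "norm \<omega> = 1" "norm (F v + \<omega> * (of_real t * F u)) = norm (F v) + norm (of_real t * F u)"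
      by (rule aligned_unit)
    define h where "h = v + (\<omega> * of_real t) *\<^sub>F u"
    have h: "h \<in> Lp p" unfolding h_def using u v p1 by (intro Lp_add Lp_scale) auto
    have "F h = F v + (\<omega> * of_real t) * F u"
      unfolding h_def using Lp_dual_add[OF F v(1) Lp_scale[OF u(1)]] Lp_dual_scale[OF F u(1)] by simp
    then have Fh: "norm (F h) = norm (F v) + t * norm (F u)"
      using \<omega>(2) t by (simp add: mult.assoc norm_mult)
    define c where "c = 1 + t powr p * b powr p"
    have "Lint p h \<le> integral\<^sup>L \<I> (\<lambda>x. norm (v x) powr p + t powr p * norm (u x) powr p)"
    proof (rule Lint_le_integral[OF h])
      show "integrable \<I> (\<lambda>x. norm (v x) powr p + t powr p * norm (u x) powr p)"
        using LpD(2)[OF u(1)] LpD(2)[OF v(1)] by auto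
      show "norm (h x) powr p \<le> norm (v x) powr p + t powr p * norm (u x) powr p" for x
        using t \<omega>(1) by (auto simp: h_def u_def v_def restr_def norm_mult powr_mult)
    qed
    also have "\<dots> = Lint p v + t powr p * Lint p u"
      unfolding Lint_def using LpD(2)[OF u(1)] LpD(2)[OF v(1)] by simp
    also have "\<dots> \<le> 1 + t powr p * b powr p"
    proof (intro add_mono mult_left_mono)
      show "Lint p v \<le> 1" using p0 v(2) by (simp add: Lint_eq_Lnorm powr_le1)
      show "Lint p u \<le> b powr p" using p0 u(2) by (simp add: Lint_eq_Lnorm powr_mono2)
    qed auto
    also have "\<dots> = c powr 1" by (simp add: c_def)
    also have "\<dots> \<le> c powr p" using p by (intro powr_mono) (auto simp: c_def)
    finally have "Lnorm p h \<le> c" by (intro Lnorm_le_powr[OF p0]) (auto simp: c_def)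
    have "norm (F v) + t * norm (F u) \<le> s * Lnorm p h"
      unfolding Fh[symmetric] s_def by (rule dual_norm_bound[OF p1 F h])
    also have "\<dots> \<le> s * c" using s \<open>Lnorm p h \<le> c\<close> by (rule mult_left_mono[rotated])
    also have "\<dots> \<le> s + t * \<epsilon> / 2" using tp by (simp add: c_def algebra_simps)
    finally have "t * norm (F u) \<le> t * \<epsilon>"
      using Fv by (simp add: \<eta>_def algebra_simps)
    then have "norm (F u) \<le> \<epsilon>" using t by simp
    then show ?thesis by (simp add: u_def E_def[abs_def])
  qed
  ultimately show ?thesis by blast
qed

section \<open>Averages over signs\<close>

text \<open>A choice of signs on A is encoded by the subset carrying the sign +1, so that averages
  over signs become finite sums over \<open>Pow A\<close>.\<close>

definition sgn_of :: "'i set \<Rightarrow> 'i \<Rightarrow> real" where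
  "sgn_of B k = (if k \<in> B then 1 else - 1)"

lemma sum_Pow_insert:
  assumes "finite A" "j \<notin> A"
  shows "(\<Sum>B\<in>Pow (insert j A). h B) = (\<Sum>B\<in>Pow A. h B + h (insert j B))"
proof -
  have "inj_on (insert j) (Pow A)"
  proof (rule inj_onI)
    fix B C assume "B \<in> Pow A" "C \<in> Pow A" and eq: "insert j B = insert j C"
    then have "j \<notin> B" "j \<notin> C" using assms by auto
    then show "B = C" using eq by (simp add: insert_ident)
  qed
  moreover have "Pow A \<inter> insert j ` Pow A = {}" using assms by blast
  ultimately show ?thesis
    using assms by (simp add: Pow_insert sum.union_disjoint sum.reindex sum.distrib)
qed

lemma signed_sum_insert:
  fixes x :: "'i \<Rightarrow> 'a::real_vector"
  assumes "finite A" "j \<notin> A" "B \<subseteq> A"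
  shows "(\<Sum>k\<in>insert j A. sgn_of B k *\<^sub>R x k) = (\<Sum>k\<in>A. sgn_of B k *\<^sub>R x k) - x j"
    and "(\<Sum>k\<in>insert j A. sgn_of (insert j B) k *\<^sub>R x k) = (\<Sum>k\<in>A. sgn_of B k *\<^sub>R x k) + x j"
proof -
  have "(\<Sum>k\<in>A. sgn_of (insert j B) k *\<^sub>R x k) = (\<Sum>k\<in>A. sgn_of B k *\<^sub>R x k)"
    using assms by (intro sum.cong) (auto simp: sgn_of_def)
  then show "(\<Sum>k\<in>insert j A. sgn_of (insert j B) k *\<^sub>R x k) = (\<Sum>k\<in>A. sgn_of B k *\<^sub>R x k) + x j"
    using assms by (simp add: sgn_of_def)
  show "(\<Sum>k\<in>insert j A. sgn_of B k *\<^sub>R x k) = (\<Sum>k\<in>A. sgn_of B k *\<^sub>R x k) - x j"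
    using assms by (auto simp: sgn_of_def)
qed

lemma sum_Pow_signed_insert:
  fixes x :: "'i \<Rightarrow> 'a::real_vector" and \<Phi> :: "'a \<Rightarrow> real"
  assumes "finite A" "j \<notin> A"
  shows "(\<Sum>B\<in>Pow (insert j A). \<Phi> (\<Sum>k\<in>insert j A. sgn_of B k *\<^sub>R x k))
    = (\<Sum>B\<in>Pow A. \<Phi> ((\<Sum>k\<in>A. sgn_of B k *\<^sub>R x k) - x j) + \<Phi> ((\<Sum>k\<in>A. sgn_of B k *\<^sub>R x k) + x j))"
  unfolding sum_Pow_insert[OF assms]
  using assms by (intro sum.cong) (auto simp: signed_sum_insert simp del: sum.insert)

lemma signs_second_moment:
  fixes x :: "'i \<Rightarrow> 'a::real_inner"
  assumes "finite A"
  shows "(\<Sum>B\<in>Pow A. (norm (\<Sum>k\<in>A. sgn_of B k *\<^sub>R x k))\<^sup>2) = 2 ^ card A * (\<Sum>k\<in>A. (norm (x k))\<^sup>2)"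
  using assms
proof (induction A rule: finite_induct)
  case (insert j A)
  have par: "(norm (y - x j))\<^sup>2 + (norm (y + x j))\<^sup>2 = 2 * (norm y)\<^sup>2 + 2 * (norm (x j))\<^sup>2" for y
    by (simp add: power2_norm_eq_inner inner_add inner_diff inner_commute)
  have "card (Pow A) = 2 ^ card A" using insert by (simp add: card_Pow)
  then show ?case
    unfolding sum_Pow_signed_insert[OF insert.hyps, of "\<lambda>y. (norm y)\<^sup>2"] par
    using insert by (simp add: sum.distrib sum_distrib_left[symmetric] algebra_simps)
qed simp

text \<open>In |y - x|^4 + |y + x|^4 the odd terms cancel and the even ones are at most 2|y|^4 +
  12|y|^2|x|^2 + 2|x|^4. The constant 3 closes the induction, since 3(c+S)^2 = 3S^2 + 6cS + 3c^2 has
  room for the last term.\<close>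

lemma signs_fourth_moment:
  fixes x :: "'i \<Rightarrow> 'a::real_inner"
  assumes "finite A"
  shows "(\<Sum>B\<in>Pow A. (norm (\<Sum>k\<in>A. sgn_of B k *\<^sub>R x k)) ^ 4) \<le> 3 * 2 ^ card A * (\<Sum>k\<in>A. (norm (x k))\<^sup>2)\<^sup>2"
  using assms
proof (induction A rule: finite_induct)
  case (insert j A)
  define c where "c = (norm (x j))\<^sup>2"
  define S where "S = (\<Sum>k\<in>A. (norm (x k))\<^sup>2)"
  define Y where "Y B = (\<Sum>k\<in>A. sgn_of B k *\<^sub>R x k)" for B
  have p4: "norm y ^ 4 = ((norm y)\<^sup>2)\<^sup>2" for y :: 'a by simp
  have four: "norm (y - x j) ^ 4 + norm (y + x j) ^ 4 \<le> 2 * norm y ^ 4 + 12 * (norm y)\<^sup>2 * c + 2 * c\<^sup>2" for y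
  proof -
    define a where "a = (norm y)\<^sup>2"
    define i where "i = inner y (x j)"
    have m: "(norm (y - x j))\<^sup>2 = a + c - 2 * i" "(norm (y + x j))\<^sup>2 = a + c + 2 * i"
      by (simp_all add: a_def c_def i_def power2_norm_eq_inner inner_add inner_diff inner_commute)
    have "i\<^sup>2 \<le> (norm y * norm (x j))\<^sup>2"
      unfolding i_def using Cauchy_Schwarz_ineq2[of y "x j"] by (rule abs_le_square_iff[THEN iffD1, OF order_trans]) auto
    then have "i\<^sup>2 \<le> a * c" by (simp add: a_def c_def power_mult_distrib)
    moreover have "norm (y - x j) ^ 4 + norm (y + x j) ^ 4 = 2 * a\<^sup>2 + 4 * a * c + 2 * c\<^sup>2 + 8 * i\<^sup>2"
      unfolding p4 m by (simp add: power2_eq_square algebra_simps)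
    ultimately show ?thesis unfolding p4[of y] a_def[symmetric] by (simp add: algebra_simps)
  qed
  have "(\<Sum>B\<in>Pow (insert j A). (norm (\<Sum>k\<in>insert j A. sgn_of B k *\<^sub>R x k)) ^ 4)
      = (\<Sum>B\<in>Pow A. norm (Y B - x j) ^ 4 + norm (Y B + x j) ^ 4)"
    unfolding Y_def by (rule sum_Pow_signed_insert[OF insert.hyps, of "\<lambda>y. norm y ^ 4"])
  also have "\<dots> \<le> (\<Sum>B\<in>Pow A. 2 * norm (Y B) ^ 4 + 12 * (norm (Y B))\<^sup>2 * c + 2 * c\<^sup>2)"
    by (intro sum_mono four)
  also have "\<dots> = 2 * (\<Sum>B\<in>Pow A. norm (Y B) ^ 4) + 12 * c * (\<Sum>B\<in>Pow A. (norm (Y B))\<^sup>2) + 2 * c\<^sup>2 * 2 ^ card A"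
    using insert.hyps by (simp add: sum.distrib sum_distrib_left card_Pow mult_ac)
  also have "(\<Sum>B\<in>Pow A. (norm (Y B))\<^sup>2) = 2 ^ card A * S"
    unfolding Y_def S_def by (rule signs_second_moment[OF insert.hyps(1)])
  also have "2 * (\<Sum>B\<in>Pow A. norm (Y B) ^ 4) + 12 * c * (2 ^ card A * S) + 2 * c\<^sup>2 * 2 ^ card A
      \<le> 2 * (3 * 2 ^ card A * S\<^sup>2) + 12 * c * (2 ^ card A * S) + 6 * c\<^sup>2 * 2 ^ card A"
    using insert.IH by (intro add_mono mult_left_mono mult_right_mono) (auto simp: Y_def S_def c_def)
  also have "\<dots> = 3 * 2 ^ card (insert j A) * (c + S)\<^sup>2"
    using insert.hyps by (simp add: power2_eq_square algebra_simps)
  finally show ?case using insert.hyps by (simp add: c_def S_def)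
qed simp

text \<open>Jensen's inequality for the concave power t^(p/2), applied to the second moment and
  written as Young's inequality against the mean S.\<close>

lemma signs_moment_le:
  fixes x :: "'i \<Rightarrow> 'a::real_inner"
  assumes A: "finite A" and p: "0 < p" "p \<le> 2"
  shows "(\<Sum>B\<in>Pow A. norm (\<Sum>k\<in>A. sgn_of B k *\<^sub>R x k) powr p) \<le> 2 ^ card A * (\<Sum>k\<in>A. (norm (x k))\<^sup>2) powr (p/2)"
proof -
  define S where "S = (\<Sum>k\<in>A. (norm (x k))\<^sup>2)"
  define Y where "Y B = (norm (\<Sum>k\<in>A. sgn_of B k *\<^sub>R x k))\<^sup>2" for B
  have sumY: "(\<Sum>B\<in>Pow A. Y B) = 2 ^ card A * S"
    unfolding Y_def S_def by (rule signs_second_moment[OF A])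
  have "0 \<le> S" by (simp add: S_def sum_nonneg)
  show ?thesis
  proof (cases "S = 0")
    case True
    then have "Y B = 0" if "B \<in> Pow A" for B
      using sumY sum_nonneg_eq_0_iff[of "Pow A" Y] A that by (simp add: Y_def)
    then show ?thesis by (simp add: Y_def)
  next
    case False
    with \<open>0 \<le> S\<close> have S: "0 < S" by simp
    have "(\<Sum>B\<in>Pow A. Y B powr (p/2) * S powr (1 - p/2)) \<le> (\<Sum>B\<in>Pow A. p/2 * Y B + (1 - p/2) * S)"
      using p S by (intro sum_mono young_powr) (auto simp: Y_def)
    also have "\<dots> = p/2 * (\<Sum>B\<in>Pow A. Y B) + (1 - p/2) * (2 ^ card A * S)"
      using A by (simp only: sum.distrib sum_distrib_left[symmetric] sum_constant card_Pow of_nat_power of_nat_numeral)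
    also have "\<dots> = 2 ^ card A * S"
      by (simp add: sumY algebra_simps)
    finally have "(\<Sum>B\<in>Pow A. Y B powr (p/2)) * S powr (1 - p/2) \<le> 2 ^ card A * S powr (p/2) * S powr (1 - p/2)"
      using S by (simp add: sum_distrib_right[symmetric] mult.assoc powr_add[symmetric])
    then have "(\<Sum>B\<in>Pow A. Y B powr (p/2)) \<le> 2 ^ card A * S powr (p/2)"
      using S by simp
    then show ?thesis unfolding Y_def S_def norm_powr_conv[of _ p] .
  qed
qed

text \<open>
  Khinchine's inequality from below: \<open>t\<^sup>r \<ge> (t - t\<^sup>2/6)/6\<close> for \<open>1/2 \<le> r \<le> 1\<close> reduces it to the second
  and fourth moments.
\<close>

lemma signs_moment_ge:
  fixes x :: "'i \<Rightarrow> 'a::real_inner"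
  assumes A: "finite A" and p: "0 < p" "p \<le> 2"
  shows "2 ^ card A / 12 * (\<Sum>k\<in>A. (norm (x k))\<^sup>2) powr (p/2) \<le> (\<Sum>B\<in>Pow A. norm (\<Sum>k\<in>A. sgn_of B k *\<^sub>R x k) powr p)"
proof -
  define S where "S = (\<Sum>k\<in>A. (norm (x k))\<^sup>2)"
  define Y where "Y B = (norm (\<Sum>k\<in>A. sgn_of B k *\<^sub>R x k))\<^sup>2" for B
  have sumY: "(\<Sum>B\<in>Pow A. Y B) = 2 ^ card A * S"
    unfolding Y_def S_def by (rule signs_second_moment[OF A])
  have sumY2: "(\<Sum>B\<in>Pow A. (Y B)\<^sup>2) \<le> 3 * 2 ^ card A * S\<^sup>2"
    using signs_fourth_moment[OF A, of x] by (simp add: Y_def S_def)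
  have "0 \<le> S" by (simp add: S_def sum_nonneg)
  have point: "(t - t\<^sup>2 / 6) / 6 \<le> t powr (p/2)" if t: "0 \<le> t" for t
  proof (cases "t \<le> 6")
    case True
    have "t / 6 \<le> (t / 6) powr (p/2)"
      using powr_mono'[of "p/2" 1 "t/6"] p t True by simp
    also have "\<dots> \<le> t powr (p/2)" using t p by (intro powr_mono2) auto
    finally have "t / 6 \<le> t powr (p/2)" .
    moreover have "(t - t\<^sup>2 / 6) / 6 \<le> t / 6" by simp
    ultimately show ?thesis by (rule order_trans[rotated])
  next
    case False
    then have "6 * t \<le> t\<^sup>2" by (simp add: power2_eq_square)
    then have "(t - t\<^sup>2 / 6) / 6 \<le> 0" by simp
    also have "0 \<le> t powr (p/2)" by simp
    finally show ?thesis .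
  qed
  show ?thesis
  proof (cases "S = 0")
    case True
    then show ?thesis by (simp add: S_def[symmetric] sum_nonneg)
  next
    case False
    with \<open>0 \<le> S\<close> have S: "0 < S" by simp
    \<comment> \<open>In the mean Y/S equals 1 and its square is at most 3, whence the constant (1 -
      3/6)/6 = 1/12.\<close>
    have "2 ^ card A / 12 = (2 ^ card A * S / S - 3 * 2 ^ card A * S\<^sup>2 / (6 * S\<^sup>2)) / 6"
      using S by simp
    also have "\<dots> \<le> ((\<Sum>B\<in>Pow A. Y B) / S - (\<Sum>B\<in>Pow A. (Y B)\<^sup>2) / (6 * S\<^sup>2)) / 6"
      unfolding sumY using sumY2 S by (intro divide_right_mono diff_left_mono) auto
    also have "\<dots> = (\<Sum>B\<in>Pow A. (Y B / S - (Y B / S)\<^sup>2 / 6) / 6)"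
      by (simp add: sum_divide_distrib sum_subtractf power_divide mult.commute diff_divide_distrib)
    also have "\<dots> \<le> (\<Sum>B\<in>Pow A. (Y B / S) powr (p/2))"
      using S by (intro sum_mono point) (simp add: Y_def)
    also have "\<dots> = (\<Sum>B\<in>Pow A. Y B powr (p/2)) / S powr (p/2)"
      by (simp add: powr_divide sum_divide_distrib)
    finally have "2 ^ card A / 12 * S powr (p/2) \<le> (\<Sum>B\<in>Pow A. Y B powr (p/2))"
      using S by (simp add: le_divide_eq)
    then show ?thesis unfolding Y_def S_def norm_powr_conv[of _ p] .
  qed
qed

text \<open>Hoelder's inequality with the exponents 1/r and 1/(1-r): Young's inequality after both
  sums are normalized to 1.\<close>

lemma sum_powr_weighted_le:
  fixes u w :: "'i \<Rightarrow> real"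
  assumes r: "0 \<le> r" "r \<le> 1" and u: "\<And>k. k \<in> A \<Longrightarrow> 0 \<le> u k" and w: "\<And>k. k \<in> A \<Longrightarrow> 0 \<le> w k"
  shows "(\<Sum>k\<in>A. u k powr r * w k powr (1 - r)) \<le> (\<Sum>k\<in>A. u k) powr r * (\<Sum>k\<in>A. w k) powr (1 - r)"
proof -
  define U W where "U = (\<Sum>k\<in>A. u k)" and "W = (\<Sum>k\<in>A. w k)"
  have UW: "0 \<le> U" "0 \<le> W" unfolding U_def W_def using u w by (auto intro: sum_nonneg)
  show ?thesis
  proof (cases "finite A \<and> U \<noteq> 0 \<and> W \<noteq> 0")
    case True
    then have pos: "0 < U" "0 < W" using UW by auto
    have "(\<Sum>k\<in>A. u k powr r * w k powr (1 - r)) / (U powr r * W powr (1 - r))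
        = (\<Sum>k\<in>A. (u k / U) powr r * (w k / W) powr (1 - r))"
      by (simp add: powr_divide sum_divide_distrib)
    also have "\<dots> \<le> (\<Sum>k\<in>A. r * (u k / U) + (1 - r) * (w k / W))"
      using r u w pos by (intro sum_mono young_powr) auto
    also have "\<dots> = r * (U / U) + (1 - r) * (W / W)"
      by (simp add: sum.distrib sum_distrib_left[symmetric] sum_divide_distrib[symmetric] U_def W_def)
    also have "\<dots> = 1" using pos by simp
    finally show ?thesis using pos by (simp add: divide_le_eq U_def W_def)
  next
    case False
    have "u k powr r * w k powr (1 - r) = 0" if "finite A" "k \<in> A" for k
      using False that u w sum_nonneg_eq_0_iff[of A u] sum_nonneg_eq_0_iff[of A w]
      unfolding U_def W_def by auto
    then have "(\<Sum>k\<in>A. u k powr r * w k powr (1 - r)) = 0"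
      by (cases "finite A") (auto intro: sum.neutral)
    then show ?thesis by simp
  qed
qed

lemma signed_sum_apply:
  "(\<Sum>k\<in>A. of_real (sgn_of B k) *\<^sub>F x k) t = (\<Sum>k\<in>A. sgn_of B k *\<^sub>R x k t)"
  unfolding sum_fscale_apply by (simp add: scaleR_conv_of_real)

lemma integral_signs_le:
  fixes x :: "'i \<Rightarrow> real \<Rightarrow> 'k::Lp_scalar"
  assumes p: "1 \<le> p" "p \<le> 2" and A: "finite A" and x: "\<And>k. k \<in> A \<Longrightarrow> x k \<in> Lp p"
    and b: "\<And>k t. k \<in> A \<Longrightarrow> norm (x k t) \<le> b k"
  shows "(\<Sum>B\<in>Pow A. Lint p (\<Sum>k\<in>A. of_real (sgn_of B k) *\<^sub>F x k)) \<le> 2 ^ card A * (\<Sum>k\<in>A. (b k)\<^sup>2) powr (p/2)"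
proof -
  have L: "(\<Sum>k\<in>A. of_real (sgn_of B k) *\<^sub>F x k) \<in> Lp p" for B
    using p x by (intro Lp_sum Lp_scale) auto
  have int: "integrable \<I> (\<lambda>t. norm (\<Sum>k\<in>A. sgn_of B k *\<^sub>R x k t) powr p)" for B
    using LpD(2)[OF L[of B]] unfolding signed_sum_apply .
  have "(\<Sum>B\<in>Pow A. Lint p (\<Sum>k\<in>A. of_real (sgn_of B k) *\<^sub>F x k))
      = integral\<^sup>L \<I> (\<lambda>t. \<Sum>B\<in>Pow A. norm (\<Sum>k\<in>A. sgn_of B k *\<^sub>R x k t) powr p)"
    unfolding Lint_def signed_sum_apply using int by (simp add: Bochner_Integration.integral_sum)
  also have "\<dots> \<le> integral\<^sup>L \<I> (\<lambda>t. 2 ^ card A * (\<Sum>k\<in>A. (b k)\<^sup>2) powr (p/2))"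
  proof (rule integral_mono)
    fix t
    have "(\<Sum>k\<in>A. (norm (x k t))\<^sup>2) powr (p/2) \<le> (\<Sum>k\<in>A. (b k)\<^sup>2) powr (p/2)"
      using p b by (intro powr_mono2 sum_mono power_mono) (auto intro: sum_nonneg)
    then show "(\<Sum>B\<in>Pow A. norm (\<Sum>k\<in>A. sgn_of B k *\<^sub>R x k t) powr p) \<le> 2 ^ card A * (\<Sum>k\<in>A. (b k)\<^sup>2) powr (p/2)"
      using p by (intro order_trans[OF signs_moment_le[OF A, of p "\<lambda>k. x k t"] mult_left_mono]) auto
  qed (use int in auto)
  finally show ?thesis by (simp add: measure_I_space)
qed

text \<open>Khinchine's inequality at each point bounds the square function by the average over
  signs. Hoelder's inequality with the weights w_k^(1-p/2), where w_k is the squared norm of x_k,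
  then compares the square function with the norms: with these weights the integral of the left side
  is exactly W.\<close>

lemma cotype_two:
  fixes x :: "'i \<Rightarrow> real \<Rightarrow> 'k::Lp_scalar"
  assumes p: "1 \<le> p" "p \<le> 2" and A: "finite A" and x: "\<And>k. k \<in> A \<Longrightarrow> x k \<in> Lp p"
    and M: "\<And>B. B \<subseteq> A \<Longrightarrow> Lnorm p (\<Sum>k\<in>A. of_real (sgn_of B k) *\<^sub>F x k) \<le> M"
  shows "(\<Sum>k\<in>A. (Lnorm p (x k))\<^sup>2) powr (p/2) \<le> 12 * M powr p"
proof -
  define w where "w k = (Lnorm p (x k))\<^sup>2" for k
  define W where "W = (\<Sum>k\<in>A. w k)"
  have W: "0 \<le> W" by (simp add: W_def w_def sum_nonneg)
  have L: "(\<Sum>k\<in>A. of_real (sgn_of B k) *\<^sub>F x k) \<in> Lp p" for B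
    using p x by (intro Lp_sum Lp_scale) auto
  have int: "integrable \<I> (\<lambda>t. norm (\<Sum>k\<in>A. sgn_of B k *\<^sub>R x k t) powr p)" for B
    using LpD(2)[OF L[of B]] unfolding signed_sum_apply .
  have Lw: "Lint p (x k) = w k powr (p/2)" for k
    using p norm_powr_conv[of "Lnorm p (x k)" p] by (simp add: w_def Lint_eq_Lnorm)
  have "2 ^ card A / 12 * (\<Sum>k\<in>A. Lint p (x k) * w k powr (1 - p/2))
      = integral\<^sup>L \<I> (\<lambda>t. 2 ^ card A / 12 * (\<Sum>k\<in>A. norm (x k t) powr p * w k powr (1 - p/2)))"
    unfolding Lint_def using LpD(2)[OF x] by (simp add: Bochner_Integration.integral_sum)
  also have "\<dots> \<le> integral\<^sup>L \<I> (\<lambda>t. W powr (1 - p/2) * (\<Sum>B\<in>Pow A. norm (\<Sum>k\<in>A. sgn_of B k *\<^sub>R x k t) powr p))"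
  proof (rule integral_mono)
    fix t
    have "(\<Sum>k\<in>A. norm (x k t) powr p * w k powr (1 - p/2))
        \<le> (\<Sum>k\<in>A. (norm (x k t))\<^sup>2) powr (p/2) * W powr (1 - p/2)"
      unfolding norm_powr_conv[of _ p] W_def using p by (intro sum_powr_weighted_le) (auto simp: w_def)
    then have "2 ^ card A / 12 * (\<Sum>k\<in>A. norm (x k t) powr p * w k powr (1 - p/2))
        \<le> 2 ^ card A / 12 * ((\<Sum>k\<in>A. (norm (x k t))\<^sup>2) powr (p/2) * W powr (1 - p/2))"
      by (intro mult_left_mono) auto
    also have "\<dots> = W powr (1 - p/2) * (2 ^ card A / 12 * (\<Sum>k\<in>A. (norm (x k t))\<^sup>2) powr (p/2))"
      by simp
    also have "\<dots> \<le> W powr (1 - p/2) * (\<Sum>B\<in>Pow A. norm (\<Sum>k\<in>A. sgn_of B k *\<^sub>R x k t) powr p)"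
      using p by (intro mult_left_mono signs_moment_ge[OF A]) auto
    finally show "2 ^ card A / 12 * (\<Sum>k\<in>A. norm (x k t) powr p * w k powr (1 - p/2))
        \<le> W powr (1 - p/2) * (\<Sum>B\<in>Pow A. norm (\<Sum>k\<in>A. sgn_of B k *\<^sub>R x k t) powr p)" .
  qed (use int LpD(2)[OF x] in auto)
  also have "\<dots> = W powr (1 - p/2) * (\<Sum>B\<in>Pow A. Lint p (\<Sum>k\<in>A. of_real (sgn_of B k) *\<^sub>F x k))"
    unfolding Lint_def signed_sum_apply using int by (simp add: Bochner_Integration.integral_sum)
  also have "\<dots> \<le> W powr (1 - p/2) * (\<Sum>B\<in>Pow A. M powr p)"
    using M p by (intro mult_left_mono sum_mono) (auto simp: Lint_eq_Lnorm intro!: powr_mono2)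
  also have "\<dots> = 2 ^ card A * (W powr (1 - p/2) * M powr p)" using A by (simp add: card_Pow)
  finally have "(\<Sum>k\<in>A. Lint p (x k) * w k powr (1 - p/2)) \<le> 12 * M powr p * W powr (1 - p/2)"
    by (simp add: mult_ac)
  also have "(\<Sum>k\<in>A. Lint p (x k) * w k powr (1 - p/2)) = W"
    unfolding Lw W_def by (intro sum.cong) (auto simp: powr_add[symmetric] w_def)
  finally have *: "W \<le> 12 * M powr p * W powr (1 - p/2)" .
  show ?thesis
  proof (cases "W = 0")
    case False
    then have "W = W powr (p/2) * W powr (1 - p/2)" using W by (simp add: powr_add[symmetric])
    with * have "W powr (p/2) * W powr (1 - p/2) \<le> 12 * M powr p * W powr (1 - p/2)" by simp
    then have "W powr (p/2) \<le> 12 * M powr p" using False by simp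
    then show ?thesis by (simp add: W_def w_def)
  qed (simp add: W_def w_def)
qed

section \<open>The lower \<open>p\<close>-estimate for \<open>p < 2\<close>\<close>

lemma signs_orthogonal:
  assumes A: "finite A" and n: "n \<in> A"
  shows "(\<Sum>B\<in>Pow A. sgn_of B n * sgn_of B m) = (if n = m then 2 ^ card A else 0)"
proof (cases "n = m")
  case True
  moreover have "sgn_of B m * sgn_of B m = 1" for B by (simp add: sgn_of_def)
  ultimately show ?thesis using A by (simp add: card_Pow)
next
  case False
  define A' where "A' = A - {n}"
  have A': "A = insert n A'" "finite A'" "n \<notin> A'" using A n by (auto simp: A'_def)
  have "(\<Sum>B\<in>Pow A. sgn_of B n * sgn_of B m)
      = (\<Sum>B\<in>Pow A'. sgn_of B n * sgn_of B m + sgn_of (insert n B) n * sgn_of (insert n B) m)"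
    unfolding A'(1) by (rule sum_Pow_insert[OF A'(2,3)])
  also have "\<dots> = 0"
    using A'(3) False by (intro sum.neutral) (auto simp: sgn_of_def)
  finally show ?thesis using False by simp
qed

lemma norm_powr_disjoint_sum:
  fixes y :: "'i \<Rightarrow> 'a::real_normed_vector"
  assumes A: "finite A" and disj: "\<And>i j. i \<in> A \<Longrightarrow> j \<in> A \<Longrightarrow> i \<noteq> j \<Longrightarrow> y i = 0 \<or> y j = 0"
  shows "norm (\<Sum>i\<in>A. y i) powr p = (\<Sum>i\<in>A. norm (y i) powr p)"
proof (cases "\<exists>i\<in>A. y i \<noteq> 0")
  case True
  then obtain i where i: "i \<in> A" "y i \<noteq> 0" by blast
  then have 0: "y j = 0" if "j \<in> A - {i}" for j using disj[of i j] that by auto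
  have "(\<Sum>j\<in>A. y j) = y i + (\<Sum>j\<in>A - {i}. y j)" "(\<Sum>j\<in>A. norm (y j) powr p) = norm (y i) powr p + (\<Sum>j\<in>A - {i}. norm (y j) powr p)"
    using A i by (auto intro: sum.remove)
  then show ?thesis using 0 by simp
qed simp

lemma measurable_ident_I: "(\<lambda>x. x) \<in> borel_measurable \<I>"
  by (intro measurable_restrict_space1 measurable_completion) simp

context greedy_Lp
begin

section \<open>Coefficient functionals of the basis\<close>

definition coef :: "(real \<Rightarrow> 'k) \<Rightarrow> nat \<Rightarrow> 'k" where
  "coef f = (THE c. expansion p \<Psi> f c)"

lemma expansion_iff: "expansion p \<Psi> f c \<longleftrightarrow> (\<lambda>n. Lnorm p (f - comb c {..<n})) \<longlonglongrightarrow> 0"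
  by (simp add: expansion_def comb_def)

lemma coef_eqI: "f \<in> Lp p \<Longrightarrow> expansion p \<Psi> f c \<Longrightarrow> coef f = c"
  unfolding coef_def using expansion_unique by (intro the_equality)

lemma coef_expansion: "f \<in> Lp p \<Longrightarrow> expansion p \<Psi> f (coef f)"
  using ex_expansion[of f] coef_eqI[of f] by metis

lemma coef_tendsto: "f \<in> Lp p \<Longrightarrow> (\<lambda>n. Lnorm p (f - comb (coef f) {..<n})) \<longlonglongrightarrow> 0"
  using coef_expansion[of f] unfolding expansion_iff .

lemma coef_add:
  assumes f: "f \<in> Lp p" and g: "g \<in> Lp p"
  shows "coef (f + g) n = coef f n + coef g n"
proof -
  have "expansion p \<Psi> (f + g) (\<lambda>n. coef f n + coef g n)"
    unfolding expansion_iff comb_add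
  proof (rule tendsto_sandwich[OF _ _ tendsto_const])
    show "\<forall>\<^sub>F n in sequentially. Lnorm p (f + g - (comb (coef f) {..<n} + comb (coef g) {..<n}))
        \<le> Lnorm p (f - comb (coef f) {..<n}) + Lnorm p (g - comb (coef g) {..<n})"
    proof (intro always_eventually allI)
      fix n
      have "f + g - (comb (coef f) {..<n} + comb (coef g) {..<n}) = (f - comb (coef f) {..<n}) + (g - comb (coef g) {..<n})"
        by (rule add_diff_add)
      then show "Lnorm p (f + g - (comb (coef f) {..<n} + comb (coef g) {..<n}))
        \<le> Lnorm p (f - comb (coef f) {..<n}) + Lnorm p (g - comb (coef g) {..<n})"
        using Lnorm_triangle[OF p1 Lp_diff[OF p1 f comb_Lp] Lp_diff[OF p1 g comb_Lp]] by metis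
    qed
    show "(\<lambda>n. Lnorm p (f - comb (coef f) {..<n}) + Lnorm p (g - comb (coef g) {..<n})) \<longlonglongrightarrow> 0"
      using tendsto_add[OF coef_tendsto[OF f] coef_tendsto[OF g]] by simp
  qed simp
  from coef_eqI[OF Lp_add[OF p1 f g] this] show ?thesis by simp
qed

lemma coef_scale:
  assumes f: "f \<in> Lp p"
  shows "coef (a *\<^sub>F f) n = a * coef f n"
proof -
  have "Lnorm p (a *\<^sub>F f - a *\<^sub>F comb (coef f) {..<n}) = norm a * Lnorm p (f - comb (coef f) {..<n})" for n
    using Lnorm_scale[OF p0, of a "f - comb (coef f) {..<n}"]
    by (simp only: fscale.scale_right_diff_distrib)
  then have "expansion p \<Psi> (a *\<^sub>F f) (\<lambda>n. a * coef f n)"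
    unfolding expansion_iff comb_scale
    using tendsto_mult_right_zero[OF coef_tendsto[OF f], of "norm a"] by simp
  from coef_eqI[OF Lp_scale[OF f] this] show ?thesis by simp
qed

lemma coef_comb: "finite S \<Longrightarrow> coef (comb a S) k = (if k \<in> S then a k else 0)"
  using coef_eqI[OF comb_Lp expansion_comb[of S a]] by simp

lemma comb_coef_bound:
  assumes f: "f \<in> Lp p" and A: "finite A"
  shows "Lnorm p (comb (coef f) A) \<le> K * Lnorm p f"
proof (rule LIMSEQ_le_const)
  show "(\<lambda>n. K * Lnorm p (comb (coef f) {..<n})) \<longlonglongrightarrow> K * Lnorm p f"
    by (intro tendsto_mult tendsto_const Lnorm_tendsto[OF p1 f comb_Lp coef_tendsto[OF f]])
  obtain M where "A \<subseteq> {..<M}" using finite_nat_iff_bounded[of A] A by blast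
  then have "A \<subseteq> {..<n}" if "n \<ge> M" for n using that by auto
  then show "\<exists>M. \<forall>n\<ge>M. Lnorm p (comb (coef f) A) \<le> K * Lnorm p (comb (coef f) {..<n})"
    by (intro exI[of _ M] allI impI unconditional) auto
qed

lemma coef_bound:
  assumes "f \<in> Lp p"
  shows "norm (coef f n) \<le> K * Lnorm p f"
proof -
  have "comb (coef f) {n} = coef f n *\<^sub>F \<Psi> n" by (simp add: comb_def)
  then have "Lnorm p (comb (coef f) {n}) = norm (coef f n)" using Lnorm_scale[OF p0, of "coef f n" "\<Psi> n"] by simp
  then show ?thesis using comb_coef_bound[OF assms, of "{n}"] by simp
qed

lemma coef_dual: "(\<lambda>f. coef f n) \<in> Lp_dual p"
  unfolding Lp_dual_def using coef_add coef_scale coef_bound by blast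

lemma coef_sum:
  assumes "\<And>i. i \<in> A \<Longrightarrow> g i \<in> Lp p"
  shows "coef (\<Sum>i\<in>A. a i *\<^sub>F g i) n = (\<Sum>i\<in>A. a i * coef (g i) n)"
  by (rule Lp_dual_sum[OF p1 coef_dual assms])

lemma signed_comb:
  assumes S: "finite S"
  shows "comb (\<lambda>k. of_real (sgn_of B k) * a k) S = comb a (S \<inter> B) - comb a (S - B)"
proof -
  have "comb (\<lambda>k. of_real (sgn_of B k) * a k) S
      = comb (\<lambda>k. of_real (sgn_of B k) * a k) (S \<inter> B \<union> (S - B))"
    by (intro arg_cong2[of _ _ _ _ comb]) auto
  also have "\<dots> = comb (\<lambda>k. of_real (sgn_of B k) * a k) (S \<inter> B) + comb (\<lambda>k. of_real (sgn_of B k) * a k) (S - B)"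
    using S by (intro comb_Un) auto
  also have "comb (\<lambda>k. of_real (sgn_of B k) * a k) (S \<inter> B) = comb a (S \<inter> B)"
    by (intro comb_cong) (auto simp: sgn_of_def)
  also have "comb (\<lambda>k. of_real (sgn_of B k) * a k) (S - B) = comb (\<lambda>k. (-1) * a k) (S - B)"
    by (intro comb_cong) (auto simp: sgn_of_def)
  also have "comb (\<lambda>k. (-1) * a k) (S - B) = - comb a (S - B)"
    unfolding comb_scale by (simp add: fun_eq_iff)
  finally show ?thesis by (simp only: diff_conv_add_uminus)
qed

lemma signed_coef_bound:
  assumes f: "f \<in> Lp p" and S: "finite S"
  shows "Lnorm p (comb (\<lambda>k. of_real (sgn_of B k) * coef f k) S) \<le> 2 * K * Lnorm p f"
proof -
  have "Lnorm p (comb (\<lambda>k. of_real (sgn_of B k) * coef f k) S)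
      \<le> Lnorm p (comb (coef f) (S \<inter> B)) + Lnorm p (comb (coef f) (S - B))"
    unfolding signed_comb[OF S] by (rule Lnorm_triangle_diff[OF p1 comb_Lp comb_Lp])
  also have "\<dots> \<le> K * Lnorm p f + K * Lnorm p f"
    using S by (intro add_mono comb_coef_bound[OF f]) auto
  also have "\<dots> = 2 * K * Lnorm p f" by simp
  finally show ?thesis .
qed

lemma sum_comb: "(\<Sum>B\<in>X. comb (c B) A) = comb (\<lambda>n. \<Sum>B\<in>X. c B n) A"
  by (rule ext) (simp add: comb_def sum_fun_apply sum_fscale_apply sum_distrib_right sum.swap[of _ A X])

text \<open>
  If every coefficient functional is bounded below on the unit ball of \<open>L\<^sup>\<infinity>\<close>, averaging over signs
  the elements \<open>\<Sum> \<epsilon>\<^sub>m b\<^sub>m g\<^sub>m\<close>, with their \<open>n\<close>-th coefficients multiplied by \<open>\<epsilon>\<^sub>n\<close>, isolates the diagonal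
  and dominates the basis by the unit vectors of \<open>\<ell>\<^sup>2\<close>.
\<close>

lemma upper_two_estimate:
  assumes p2: "p \<le> 2" and delta: "0 < \<delta>"
    and g: "\<And>n. g n \<in> borel_measurable \<I>" "\<And>n x. norm (g n x) \<le> 1" "\<And>n. \<delta> \<le> norm (coef (g n) n)"
    and A: "finite A"
  shows "Lnorm p (comb a A) \<le> 4 * K / \<delta> * sqrt (\<Sum>k\<in>A. (norm (a k))\<^sup>2)"
proof -
  \<comment> \<open>The division makes a n the diagonal coefficient of b n g n, at the price of the
    factor 1 / delta in the l^2 norm.\<close>
  define b where "b n = a n / coef (g n) n" for n
  have nz: "coef (g n) n \<noteq> 0" for n using g(3)[of n] delta by auto
  have gLp: "g n \<in> Lp p" for n by (rule Lp_bounded[OF g(1,2)]) (use p0 in simp)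
  define S where "S = (\<Sum>k\<in>A. (norm (b k))\<^sup>2)"
  define \<sigma> where "\<sigma> = sqrt S"
  have S0: "0 \<le> S" by (simp add: S_def sum_nonneg)
  have sigma_le: "\<sigma> \<le> sqrt (\<Sum>k\<in>A. (norm (a k))\<^sup>2) / \<delta>"
  proof -
    have "S \<le> (\<Sum>k\<in>A. (norm (a k) / \<delta>)\<^sup>2)"
      unfolding S_def b_def using delta g(3) nz
      by (intro sum_mono power_mono) (auto simp: norm_divide intro!: divide_left_mono mult_pos_pos)
    also have "\<dots> = (\<Sum>k\<in>A. (norm (a k))\<^sup>2) / \<delta>\<^sup>2"
      by (simp add: power_divide sum_divide_distrib)
    finally have "\<sigma> \<le> sqrt ((\<Sum>k\<in>A. (norm (a k))\<^sup>2) / \<delta>\<^sup>2)" unfolding \<sigma>_def by (rule real_sqrt_le_mono)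
    then show ?thesis using delta by (simp add: real_sqrt_divide)
  qed
  have "Lnorm p (comb a A) \<le> 4 * K * \<sigma>"
  proof (cases "S = 0")
    case True
    then have "norm (b k) = 0" if "k \<in> A" for k
      using sum_nonneg_eq_0_iff[OF A, of "\<lambda>k. (norm (b k))\<^sup>2"] that by (auto simp: S_def)
    then have "a k = 0" if "k \<in> A" for k using nz that by (simp add: b_def)
    then have "comb a A = comb (\<lambda>k. 0 * a k) A" by (intro comb_cong) auto
    also have "\<dots> = 0" unfolding comb_scale by (simp add: fun_eq_iff)
    finally show ?thesis using True by (simp add: \<sigma>_def)
  next
    case False
    then have sig: "0 < \<sigma>" using S0 by (simp add: \<sigma>_def)
    define x where "x m = b m *\<^sub>F g m" for m
    have xLp: "x m \<in> Lp p" for m unfolding x_def by (rule Lp_scale[OF gLp])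
    define G where "G B = (\<Sum>m\<in>A. of_real (sgn_of B m) *\<^sub>F x m)" for B
    have GLp: "G B \<in> Lp p" for B unfolding G_def by (intro Lp_sum[OF p1] Lp_scale xLp)
    have "(\<Sum>B\<in>Pow A. Lint p (G B)) \<le> 2 ^ card A * S powr (p/2)"
      unfolding G_def S_def
    proof (rule integral_signs_le[OF p1 p2 A xLp])
      fix k t
      show "norm (x k t) \<le> norm (b k)" using g(2)[of k t] by (simp add: x_def norm_mult mult_left_le)
    qed
    also have "S powr (p/2) = \<sigma> powr p"
      using S0 by (simp add: \<sigma>_def powr_half_sqrt[symmetric] powr_powr)
    finally have int: "(\<Sum>B\<in>Pow A. Lint p (G B)) \<le> 2 ^ card A * \<sigma> powr p" .
    \<comment> \<open>The bound t <= 1 + t^p for t = ||G B|| / sigma controls the average of norms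
      by the average of p-th powers, which is at most sigma^p. The two summands contribute equally
      and turn 2K into 4K.\<close>
    have G_le: "Lnorm p (G B) \<le> \<sigma> + \<sigma> * (Lint p (G B) / \<sigma> powr p)" for B
    proof -
      define t where "t = Lnorm p (G B) / \<sigma>"
      have "0 \<le> t" using sig by (simp add: t_def)
      then have "t \<le> 1 + t powr p"
        using powr_mono[of 1 p t] p1 by (cases "t \<le> 1") (auto intro: add_increasing2)
      also have "t powr p = Lint p (G B) / \<sigma> powr p"
        using p0 by (simp add: t_def powr_divide Lint_eq_Lnorm)
      finally have "\<sigma> * t \<le> \<sigma> * (1 + Lint p (G B) / \<sigma> powr p)"
        using sig by (intro mult_left_mono) auto
      then show ?thesis using sig by (simp add: t_def distrib_left)
    qed
    have diag: "(\<Sum>B\<in>Pow A. of_real (sgn_of B n) * coef (G B) n) = 2 ^ card A * a n" if "n \<in> A" for n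
    proof -
      have "coef (G B) n = (\<Sum>m\<in>A. of_real (sgn_of B m) * (b m * coef (g m) n))" for B
      proof -
      have "coef (G B) n = (\<Sum>m\<in>A. of_real (sgn_of B m) * coef (x m) n)"
        unfolding G_def by (rule coef_sum[OF xLp])
      then show ?thesis by (simp only: x_def coef_scale[OF gLp])
    qed
      then have "(\<Sum>B\<in>Pow A. of_real (sgn_of B n) * coef (G B) n)
          = (\<Sum>B\<in>Pow A. \<Sum>m\<in>A. of_real (sgn_of B n * sgn_of B m) * (b m * coef (g m) n))"
        by (simp add: sum_distrib_left mult.assoc)
      also have "\<dots> = (\<Sum>m\<in>A. of_real (\<Sum>B\<in>Pow A. sgn_of B n * sgn_of B m) * (b m * coef (g m) n))"
        unfolding of_real_sum sum_distrib_right by (rule sum.swap)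
      also have "\<dots> = (\<Sum>m\<in>A. if n = m then 2 ^ card A * (b m * coef (g m) n) else 0)"
        unfolding signs_orthogonal[OF A that] by (intro sum.cong) auto
      also have "\<dots> = 2 ^ card A * (b n * coef (g n) n)" using A that by (simp add: sum.delta)
      finally show ?thesis using nz by (simp add: b_def)
    qed
    have "2 ^ card A * Lnorm p (comb a A) = Lnorm p (comb (\<lambda>n. 2 ^ card A * a n) A)"
      unfolding comb_scale Lnorm_scale[OF p0] by (simp add: norm_power)
    also have "comb (\<lambda>n. 2 ^ card A * a n) A = comb (\<lambda>n. \<Sum>B\<in>Pow A. of_real (sgn_of B n) * coef (G B) n) A"
      by (intro comb_cong) (simp add: diag)
    also have "\<dots> = (\<Sum>B\<in>Pow A. comb (\<lambda>n. of_real (sgn_of B n) * coef (G B) n) A)"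
      by (rule sum_comb[symmetric])
    also have "Lnorm p \<dots> \<le> (\<Sum>B\<in>Pow A. Lnorm p (comb (\<lambda>n. of_real (sgn_of B n) * coef (G B) n) A))"
      by (rule Lnorm_triangle_sum[OF p1 comb_Lp])
    also have "\<dots> \<le> (\<Sum>B\<in>Pow A. 2 * K * (\<sigma> + \<sigma> * (Lint p (G B) / \<sigma> powr p)))"
      using K_ge_1 G_le
      by (intro sum_mono order_trans[OF signed_coef_bound[OF GLp A] mult_left_mono]) auto
    also have "\<dots> = 2 * K * (\<sigma> * 2 ^ card A + \<sigma> * ((\<Sum>B\<in>Pow A. Lint p (G B)) / \<sigma> powr p))"
      using A by (simp add: sum_distrib_left[symmetric] sum.distrib sum_divide_distrib[symmetric] card_Pow)
    also have "\<dots> \<le> 2 * K * (\<sigma> * 2 ^ card A + \<sigma> * (2 ^ card A))"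
      using int sig K_ge_1 by (intro mult_left_mono add_left_mono) (auto simp: divide_le_eq)
    also have "\<dots> = 2 ^ card A * (4 * K * \<sigma>)" by simp
    finally show ?thesis by simp
  qed
  also have "\<dots> \<le> 4 * K * (sqrt (\<Sum>k\<in>A. (norm (a k))\<^sup>2) / \<delta>)"
    using sigma_le K_ge_1 by (intro mult_left_mono) auto
  finally show ?thesis by simp
qed

end

text \<open>Normalized indicators of N consecutive intervals of length 1/N: for j < N they have norm
  1 and disjoint supports, hence span an isometric copy of N-dimensional l^p.\<close>

definition step_fun :: "real \<Rightarrow> nat \<Rightarrow> nat \<Rightarrow> real \<Rightarrow> 'k::Lp_scalar" where
  "step_fun p N j = restr (\<lambda>x. real j / real N \<le> x \<and> x < (real j + 1) / real N) (\<lambda>_. of_real (real N powr (1/p)))"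

lemma step_fun_disjoint:
  assumes "0 < N" "i \<noteq> j"
  shows "step_fun p N i x = 0 \<or> step_fun p N j x = 0"
proof (rule ccontr)
  assume "\<not> ?thesis"
  then have "real i \<le> x * real N" "x * real N < real i + 1" "real j \<le> x * real N" "x * real N < real j + 1"
    using assms by (auto simp: step_fun_def restr_def field_simps split: if_splits)
  then have "real i < real j + 1" "real j < real i + 1" by linarith+
  then show False using assms by linarith
qed

lemma
  fixes p :: real
  assumes p: "0 < p" and N: "0 < N"
  shows step_fun_Lp: "(step_fun p N j :: real \<Rightarrow> 'k::Lp_scalar) \<in> Lp p"
    and Lint_step_fun: "j < N \<Longrightarrow> Lint p (step_fun p N j :: real \<Rightarrow> 'k) = 1"
proof -
  have [measurable]: "(\<lambda>x. x) \<in> borel_measurable \<I>" by (rule measurable_ident_I)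
  define J where "J = {real j / real N ..< (real j + 1) / real N}"
  have "(\<lambda>_. of_real (real N powr (1/p))) \<in> (Lp p :: (real \<Rightarrow> 'k) set)"
    using p by (intro Lp_bounded[of _ "real N powr (1/p)"]) auto
  then show "(step_fun p N j :: real \<Rightarrow> 'k) \<in> Lp p"
    unfolding step_fun_def by (rule restr_Lp(1)[OF p]) measurable
  assume j: "j < N"
  have lo: "0 \<le> real j / real N" and hi: "(real j + 1) / real N \<le> 1" using j N by (auto simp: divide_le_eq)
  have "x \<in> {0..1}" if "x \<in> J" for x
  proof -
    have "real j / real N \<le> x" "x < (real j + 1) / real N" using that by (auto simp: J_def)
    then show ?thesis using order_trans[OF lo] hi by simp
  qed
  then have J01: "J \<subseteq> {0..1}" "J \<subseteq> space \<I>" by auto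
  have "Lint p (step_fun p N j :: real \<Rightarrow> 'k) = integral\<^sup>L \<I> (\<lambda>x. indicator J x * real N)"
    unfolding Lint_def using p N
    by (intro Bochner_Integration.integral_cong) (auto simp: step_fun_def restr_def J_def indicator_def powr_powr)
  also have "\<dots> = measure \<I> J * real N" using J01 by (simp add: Int_absorb2)
  also have "measure \<I> J = measure lebesgue J"
    using J01 by (intro measure_restrict_space) auto
  also have "\<dots> = 1 / real N" using N by (simp add: J_def field_simps)
  finally show "Lint p (step_fun p N j :: real \<Rightarrow> 'k) = 1" using N by simp
qed

context greedy_Lp
begin

text \<open>By cotype 2 the basis coefficients of a unit vector have bounded l^2 norm. For N
  disjoint unit vectors the sign average of the squared l^2 norm of the combined coefficients is
  then at most N D, so some choice of signs attains this bound. The assumed estimate bounds the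
  corresponding sum by a multiple of N^(1/2), but its norm is N^(1/p).\<close>

lemma no_upper_two_estimate:
  assumes p2: "p < 2" and C: "0 \<le> C"
    and upper: "\<And>A a. finite A \<Longrightarrow> Lnorm p (comb a A) \<le> C * sqrt (\<Sum>k\<in>A. (norm (a k))\<^sup>2)"
  shows False
proof -
  define D where "D = (12 * (2 * K) powr p) powr (2/p)"
  have D: "0 \<le> D" by (simp add: D_def)
  have growth: "real N powr (1/p) \<le> 1 + C * sqrt (real N * D)" if N: "0 < N" for N :: nat
  proof -
    define g where "g = (step_fun p N :: nat \<Rightarrow> real \<Rightarrow> 'k)"
    have g: "g j \<in> Lp p" for j unfolding g_def by (rule step_fun_Lp[OF p0 N])
    have Lint_g: "Lint p (g j) = 1" if "j < N" for j
      unfolding g_def by (rule Lint_step_fun[OF p0 N that])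
    have norm_g: "Lnorm p (g j) = 1" if "j < N" for j
      using Lint_g[OF that] by (simp add: Lnorm_eq_Lint)
    \<comment> \<open>One truncation index M serves all N functions; errors of at most 1/N each sum
      to at most 1.\<close>
    have "\<forall>\<^sub>F n in sequentially. \<forall>j\<in>{..<N}. Lnorm p (g j - comb (coef (g j)) {..<n}) < 1 / real N"
      using N by (intro eventually_ball_finite) (auto intro!: order_tendstoD(2)[OF coef_tendsto[OF g]])
    from eventually_happens'[OF sequentially_bot this]
    obtain M where M': "\<forall>j\<in>{..<N}. Lnorm p (g j - comb (coef (g j)) {..<M}) < 1 / real N" by (elim exE)
    have M: "Lnorm p (g j - comb (coef (g j)) {..<M}) \<le> 1 / real N" if "j < N" for j
      by (rule less_imp_le, rule M'[rule_format]) (simp add: that)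
    have q_le: "(\<Sum>k<M. (norm (coef (g j) k))\<^sup>2) \<le> D" if j: "j < N" for j
    proof -
      have "(\<Sum>k<M. (Lnorm p (coef (g j) k *\<^sub>F \<Psi> k))\<^sup>2) powr (p/2) \<le> 12 * (2 * K) powr p"
      proof (rule cotype_two)
        fix B
        have "(\<Sum>k<M. of_real (sgn_of B k) *\<^sub>F (coef (g j) k *\<^sub>F \<Psi> k)) = comb (\<lambda>k. of_real (sgn_of B k) * coef (g j) k) {..<M}"
          unfolding comb_def by (simp only: fscale.scale_scale)
        then show "Lnorm p (\<Sum>k<M. of_real (sgn_of B k) *\<^sub>F (coef (g j) k *\<^sub>F \<Psi> k)) \<le> 2 * K"
          using signed_coef_bound[OF g, of "{..<M}" B j] norm_g[OF j] by simp
      qed (use p1 p2 in auto)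
      then have "(\<Sum>k<M. (norm (coef (g j) k))\<^sup>2) powr (p/2) \<le> 12 * (2 * K) powr p"
        by (simp add: Lnorm_scale[OF p0])
      then have "((\<Sum>k<M. (norm (coef (g j) k))\<^sup>2) powr (p/2)) powr (2/p) \<le> D"
        unfolding D_def using p0 by (intro powr_mono2) auto
      then show ?thesis using p0 by (simp add: powr_powr sum_nonneg)
    qed
    define T where "T B = (\<Sum>k<M. (norm (\<Sum>j<N. sgn_of B j *\<^sub>R coef (g j) k))\<^sup>2)" for B
    have "(\<Sum>B\<in>Pow {..<N}. T B) = (\<Sum>k<M. 2 ^ N * (\<Sum>j<N. (norm (coef (g j) k))\<^sup>2))"
      unfolding T_def by (subst sum.swap) (simp only: signs_second_moment[OF finite_lessThan] card_lessThan)
    also have "\<dots> = 2 ^ N * (\<Sum>j<N. \<Sum>k<M. (norm (coef (g j) k))\<^sup>2)"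
      unfolding sum_distrib_left[symmetric] by (subst sum.swap) simp
    also have "\<dots> \<le> 2 ^ N * (\<Sum>j<N. D)" using q_le by (intro mult_left_mono sum_mono) auto
    also have "\<dots> = (\<Sum>B\<in>Pow {..<N}. real N * D)" by (simp add: card_Pow)
    finally have "\<not> (\<forall>B\<in>Pow {..<N}. real N * D < T B)"
      using sum_strict_mono[of "Pow {..<N}" "\<lambda>_. real N * D" T] by force
    then obtain B where B: "T B \<le> real N * D" by (auto simp: not_less)
    define s where "s j = (of_real (sgn_of B j) :: 'k)" for j
    have s1: "norm (s j) = 1" for j by (simp add: s_def sgn_of_def)
    define G where "G = (\<Sum>j<N. s j *\<^sub>F g j)"
    define H where "H = (\<Sum>j<N. s j *\<^sub>F comb (coef (g j)) {..<M})"
    have "Lint p G = integral\<^sup>L \<I> (\<lambda>x. \<Sum>j<N. norm (g j x) powr p)"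
      unfolding Lint_def
    proof (rule Bochner_Integration.integral_cong[OF refl])
      fix x
      have "norm (\<Sum>j<N. s j * g j x) powr p = (\<Sum>j<N. norm (s j * g j x) powr p)"
        using step_fun_disjoint[OF N] by (intro norm_powr_disjoint_sum) (auto simp: g_def)
      then show "norm (G x) powr p = (\<Sum>j<N. norm (g j x) powr p)"
        unfolding G_def sum_fscale_apply by (simp add: norm_mult s1)
    qed
    also have "\<dots> = (\<Sum>j<N. Lint p (g j))"
      unfolding Lint_def using LpD(2)[OF g] by (simp add: Bochner_Integration.integral_sum)
    also have "\<dots> = real N" using Lint_g by simp
    finally have "Lnorm p G = real N powr (1/p)" by (simp add: Lnorm_eq_Lint)
    moreover have "Lnorm p G \<le> Lnorm p H + Lnorm p (G - H)"
      unfolding G_def H_def by (intro Lnorm_le_add_diff[OF p1] Lp_sum[OF p1] Lp_scale g comb_Lp)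
    moreover have "Lnorm p (G - H) \<le> 1"
    proof -
      have eq: "G - H = (\<Sum>j<N. s j *\<^sub>F (g j - comb (coef (g j)) {..<M}))"
        unfolding G_def H_def sum_subtractf[symmetric] fscale.scale_right_diff_distrib ..
      have "Lnorm p (G - H) \<le> (\<Sum>j<N. Lnorm p (s j *\<^sub>F (g j - comb (coef (g j)) {..<M})))"
        unfolding eq by (intro Lnorm_triangle_sum[OF p1] Lp_scale Lp_diff[OF p1] g comb_Lp)
      also have "\<dots> \<le> (\<Sum>j<N. 1 / real N)"
        using M by (intro sum_mono) (simp add: Lnorm_scale[OF p0] s1)
      finally show ?thesis using N by simp
    qed
    moreover have "Lnorm p H \<le> C * sqrt (real N * D)"
    proof -
      have "H = comb (\<lambda>k. \<Sum>j<N. s j * coef (g j) k) {..<M}"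
        unfolding H_def comb_scale[symmetric] by (rule sum_comb)
      then have "Lnorm p H \<le> C * sqrt (\<Sum>k<M. (norm (\<Sum>j<N. s j * coef (g j) k))\<^sup>2)"
        using upper by simp
      also have "(\<Sum>k<M. (norm (\<Sum>j<N. s j * coef (g j) k))\<^sup>2) = T B"
        unfolding T_def s_def by (simp add: scaleR_conv_of_real)
      also have "C * sqrt (T B) \<le> C * sqrt (real N * D)"
        using B C by (intro mult_left_mono) auto
      finally show ?thesis .
    qed
    ultimately show ?thesis by simp
  qed
  define L where "L = 1 + C * sqrt D"
  have L: "0 < L" using C D by (simp add: L_def add_pos_nonneg)
  define e where "e = 1/p - 1/2"
  have e: "0 < e" using p0 p2 by (simp add: e_def field_simps)
  \<comment> \<open>The bound in \<open>growth\<close> is at most L N^(1/2) for N >= 1, while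
    N^(1/p) = N^e N^(1/2), so N^e > L is contradictory. The summand 1 ensures N >= 1.\<close>
  obtain N :: nat where N: "L powr (1/e) + 1 < real N" using reals_Archimedean2 by blast
  then have N1: "1 \<le> real N" by (meson less_imp_le order_trans le_add_same_cancel2 powr_ge_zero)
  have "L = (L powr (1/e)) powr e" using e L by (simp add: powr_powr)
  also have "\<dots> < real N powr e" using e N by (intro powr_less_mono2) auto
  finally have "L * real N powr (1/2) < real N powr e * real N powr (1/2)"
    using N1 by (intro mult_strict_right_mono) auto
  also have "\<dots> = real N powr (1/p)" using N1 by (simp add: e_def powr_add[symmetric])
  also have "\<dots> \<le> 1 + C * sqrt (real N * D)" using growth[of N] N1 by simp
  also have "\<dots> \<le> real N powr (1/2) + C * (real N powr (1/2) * sqrt D)"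
    using N1 by (simp add: powr_half_sqrt real_sqrt_mult)
  also have "\<dots> = L * real N powr (1/2)" by (simp add: L_def algebra_simps)
  finally show False by simp
qed

text \<open>
  For \<open>p < 2\<close> the estimate above fails, so some coefficient functionals are arbitrarily small on
  bounded functions. Choosing them successively, and cutting a sum of the corresponding basis
  elements at suitable levels, each of the chosen functionals sees essentially one of the disjoint
  layers.
\<close>

lemma lower_p_estimate_less2:
  assumes p2: "p < 2"
  shows "lower_p_estimate (1 / (2 * K))"
proof -
  define small where "small n \<eta> \<longleftrightarrow> (\<forall>g. g \<in> borel_measurable \<I> \<longrightarrow> (\<forall>x. norm (g x) \<le> 1) \<longrightarrow> norm (coef g n) < \<eta>)" for n and \<eta> :: real
  have ex_small: "\<exists>n. small n \<eta>" if "0 < \<eta>" for \<eta>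
  proof (rule ccontr)
    assume "\<nexists>n. small n \<eta>"
    then have "\<forall>n. \<exists>g. g \<in> borel_measurable \<I> \<and> (\<forall>x. norm (g x) \<le> 1) \<and> \<eta> \<le> norm (coef g n)"
      unfolding small_def by (meson not_less)
    then obtain g where g: "\<And>n. g n \<in> borel_measurable \<I>" "\<And>n x. norm (g n x) \<le> 1" "\<And>n. \<eta> \<le> norm (coef (g n) n)"
      by metis
    show False
    proof (rule no_upper_two_estimate[OF p2])
      show "0 \<le> 4 * K / \<eta>" using K_ge_1 that by simp
      show "Lnorm p (comb a A) \<le> 4 * K / \<eta> * sqrt (\<Sum>k\<in>A. (norm (a k))\<^sup>2)" if "finite A" for A a
        using p2 by (intro upper_two_estimate[OF _ \<open>0 < \<eta>\<close> g that]) auto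
    qed
  qed
  \<comment> \<open>Cutting off from \<open>\<Psi> n\<close> a part of norm below 1/K leaves a
    bounded function whose n-th coefficient is nonzero.\<close>
  have not_small: "\<exists>d>0. \<not> small n d" for n
  proof -
    have [measurable]: "\<Psi> n \<in> borel_measurable \<I>" using LpD(1)[OF Psi_Lp] .
    have "0 < 1 / K" using K_ge_1 by simp
    then obtain R :: nat where R: "Lnorm p (restr (\<lambda>x. real R < norm (\<Psi> n x)) (\<Psi> n)) < 1 / K"
      using order_tendstoD(2)[OF restr_above_tendsto_0[OF p0 Psi_Lp], of "1 / K" n]
      by (auto simp: eventually_sequentially)
    define u where "u = restr (\<lambda>x. real R < norm (\<Psi> n x)) (\<Psi> n)"
    define v where "v = restr (\<lambda>x. \<not> real R < norm (\<Psi> n x)) (\<Psi> n)"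
    have uv: "u \<in> Lp p" "v \<in> Lp p" unfolding u_def v_def by (rule restr_Lp[OF p0 Psi_Lp], measurable)+
    have "\<Psi> n = u + v" by (auto simp: u_def v_def restr_def fun_eq_iff)
    moreover have "coef (\<Psi> n) n = 1" using coef_comb[of "{n}" "\<lambda>_. 1" n] by (simp add: comb_def)
    ultimately have 1: "coef u n + coef v n = 1" using coef_add[OF uv] by metis
    have "norm (coef u n) \<le> K * Lnorm p u" by (rule coef_bound[OF uv(1)])
    also have "\<dots> < 1" using R K_ge_1 by (simp add: u_def field_simps)
    finally have nz: "coef v n \<noteq> 0" using 1 by auto
    define g where "g = of_real (1 / (real R + 1)) *\<^sub>F v"
    have "norm (g x) = norm (v x) / (real R + 1)" for x
      unfolding g_def fscale_apply norm_mult norm_of_real by simp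
    then have "norm (g x) \<le> 1" for x
      by (simp add: v_def restr_def)
    moreover have "g \<in> borel_measurable \<I>" using LpD(1)[OF Lp_scale[OF uv(2)]] unfolding g_def .
    moreover have "coef g n \<noteq> 0" unfolding g_def coef_scale[OF uv(2)] mult_eq_0_iff of_real_eq_0_iff using nz by simp
    ultimately show ?thesis
      unfolding small_def by (intro exI[of _ "norm (coef g n)"]) auto
  qed
  \<comment> \<open>An index that is small for a threshold at most d m cannot be m. Strictly
    decreasing values of d therefore keep the indices chosen below distinct.\<close>
  then obtain d where d: "\<And>n. 0 < d n" "\<And>n. \<not> small n (d n)" by metis
  have small_less: "d n < \<eta>" if "small n \<eta>" for n \<eta>
  proof (rule ccontr)
    assume "\<not> d n < \<eta>"
    then have "small n (d n)" using that unfolding small_def by (meson less_le_trans not_less)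
    then show False using d(2) by blast
  qed
  have lower: "\<exists>B a. finite B \<and> card B = N \<and> (\<forall>k\<in>B. norm (a k) = 1) \<and>
     1 / (2 * K) * real N powr (1/p) \<le> Lnorm p (comb a B)" for N
  proof -
    \<comment> \<open>The pair \<open>s i\<close> consists of the index n_i and the level M_i. The
      functional of n_i is at most 1/4 on functions bounded by M_i and on tails above the next
      level, so at least 1/2 of the coefficient 1 comes from the layer between. The sum f of the
      chosen elements is not known while the levels are picked; the tail bound is uniform over all
      functions of norm at most N, which covers it.\<close>
    have "\<exists>s. \<forall>i. (0 < snd (s i) \<and> small (fst (s i)) (1 / (4 * snd (s i)))) \<and>
       (snd (s i) \<le> snd (s (Suc i)) \<and> d (fst (s (Suc i))) < d (fst (s i)) \<and>
        (\<forall>f\<in>Lp p. Lnorm p f \<le> real N \<longrightarrow> norm (coef (restr (\<lambda>x. snd (s (Suc i)) < norm (f x)) f) (fst (s i))) \<le> 1/4))"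
    proof (rule dependent_nat_choice)
      obtain n where "small n (1 / (4 * 1))" using ex_small[of "1/4"] by auto
      then show "\<exists>x. 0 < snd x \<and> small (fst x) (1 / (4 * snd x))"
        by (intro exI[of _ "(n, 1)"]) simp
    next
      fix x :: "nat \<times> real" and i :: nat
      assume x: "0 < snd x \<and> small (fst x) (1 / (4 * snd x))"
      obtain M0 where M0: "0 < M0" "\<forall>M\<ge>M0. \<forall>f\<in>Lp p. Lnorm p f \<le> real N \<longrightarrow>
          norm (coef (restr (\<lambda>x. M < norm (f x)) f) (fst x)) \<le> 1/4"
        using functional_tail_small[OF p coef_dual, of "1/4" "real N" "fst x"] by auto
      define M where "M = max (snd x) M0"
      have "M0 \<le> M" "snd x \<le> M" by (simp_all add: M_def)
      then have "0 < M" using M0 by simp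
      have tail: "\<forall>f\<in>Lp p. Lnorm p f \<le> real N \<longrightarrow> norm (coef (restr (\<lambda>x. M < norm (f x)) f) (fst x)) \<le> 1/4"
        using \<open>M0 \<le> M\<close> by (rule M0(2)[THEN spec, THEN mp])
      have "0 < min (d (fst x)) (1 / (4 * M))" using d(1) \<open>0 < M\<close> by simp
      then obtain n where n: "small n (min (d (fst x)) (1 / (4 * M)))" using ex_small by blast
      have "small n (1 / (4 * M))" using n unfolding small_def by simp
      moreover have "d n < d (fst x)" using small_less[OF n] by simp
      ultimately show "\<exists>y. (0 < snd y \<and> small (fst y) (1 / (4 * snd y))) \<and>
          (snd x \<le> snd y \<and> d (fst y) < d (fst x) \<and> (\<forall>f\<in>Lp p. Lnorm p f \<le> real N \<longrightarrow>
          norm (coef (restr (\<lambda>x. snd y < norm (f x)) f) (fst x)) \<le> 1/4))"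
        using \<open>0 < M\<close> \<open>snd x \<le> M\<close> tail by (intro exI[of _ "(n, M)"]) (simp only: fst_conv snd_conv simp_thms)
    qed
    then obtain s where s: "\<And>i. 0 < snd (s i)" "\<And>i. small (fst (s i)) (1 / (4 * snd (s i)))"
      "\<And>i. snd (s i) \<le> snd (s (Suc i))" "\<And>i. d (fst (s (Suc i))) < d (fst (s i))"
      "\<And>i f. f \<in> Lp p \<Longrightarrow> Lnorm p f \<le> real N \<Longrightarrow>
        norm (coef (restr (\<lambda>x. snd (s (Suc i)) < norm (f x)) f) (fst (s i))) \<le> 1/4" by blast
    define n M where "n i = fst (s i)" and "M i = snd (s i)" for i
    have M_mono: "M i \<le> M j" if "i \<le> j" for i j
      using that by (rule lift_Suc_mono_le[of M, rotated]) (simp add: M_def s)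
    have "d (n j) < d (n i)" if "i < j" for i j
      using that by (rule lift_Suc_mono_less[of "\<lambda>i. - d (n i)", simplified, rotated]) (simp add: n_def s)
    then have inj: "inj n" by (metis injI less_irrefl linorder_neqE_nat)
    define B where "B = n ` {..<N}"
    have B: "finite B" "card B = N" using inj by (auto simp: B_def card_image inj_on_subset)
    define f where "f = comb (\<lambda>_. 1) B"
    have f: "f \<in> Lp p" by (simp add: f_def)
    have [measurable]: "f \<in> borel_measurable \<I>" using LpD(1)[OF f] .
    have "Lnorm p f \<le> (\<Sum>k\<in>B. Lnorm p (1 *\<^sub>F \<Psi> k))"
      unfolding f_def comb_def by (intro Lnorm_triangle_sum[OF p1] Lp_scale Psi_Lp)
    also have "\<dots> = real N" using B by (simp add: Lnorm_scale[OF p0])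
    finally have fN: "Lnorm p f \<le> real N" .
    define h where "h i = restr (\<lambda>x. M i < norm (f x) \<and> norm (f x) \<le> M (Suc i)) f" for i
    have h: "h i \<in> Lp p" for i unfolding h_def by (rule restr_Lp(1)[OF p0 f]) measurable
    have layer: "(1 / (2 * K)) powr p \<le> Lint p (h i)" if i: "i < N" for i
    proof -
      define u where "u = restr (\<lambda>x. M (Suc i) < norm (f x)) f"
      define v where "v = restr (\<lambda>x. norm (f x) \<le> M i) f"
      have uv: "u \<in> Lp p" "v \<in> Lp p" unfolding u_def v_def by (rule restr_Lp[OF p0 f], measurable)+
      have u4: "norm (coef u (n i)) \<le> 1/4" unfolding u_def M_def n_def by (rule s(5)[OF f fN])
      have M_pos: "0 < M i" by (simp add: M_def s)
      define g where "g = of_real (1 / M i) *\<^sub>F v"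
      have "norm (g x) \<le> 1" for x
        using M_pos by (auto simp: g_def v_def restr_def norm_divide divide_le_eq)
      moreover have "g \<in> borel_measurable \<I>" using LpD(1)[OF Lp_scale[OF uv(2)]] unfolding g_def .
      ultimately have "norm (coef g (n i)) < 1 / (4 * M i)"
        using s(2)[of i] unfolding small_def M_def n_def by blast
      then have v4: "norm (coef v (n i)) \<le> 1/4"
        unfolding g_def coef_scale[OF uv(2)] using M_pos by (simp add: norm_mult norm_divide field_simps)
      have "f = u + (v + h i)"
        using M_mono[of i "Suc i"] by (auto simp: u_def v_def h_def restr_def fun_eq_iff)
      then have "coef f (n i) = coef u (n i) + (coef v (n i) + coef (h i) (n i))"
        using coef_add[OF uv(1) Lp_add[OF p1 uv(2) h]] coef_add[OF uv(2) h] by metis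
      moreover have "coef f (n i) = 1"
        unfolding f_def coef_comb[OF B(1)] using i by (simp add: B_def)
      ultimately have "1 \<le> norm (coef u (n i)) + (norm (coef v (n i)) + norm (coef (h i) (n i)))"
        by (metis norm_one norm_triangle_le norm_triangle_ineq add_left_mono)
      then have "1/2 \<le> norm (coef (h i) (n i))" using u4 v4 by linarith
      also have "\<dots> \<le> K * Lnorm p (h i)" by (rule coef_bound[OF h])
      finally have "1 / (2 * K) \<le> Lnorm p (h i)" using K_ge_1 by (simp add: field_simps)
      then show ?thesis
        unfolding Lint_eq_Lnorm[OF p0] using K_ge_1 p0 by (intro powr_mono2) auto
    qed
    have "real N * (1 / (2 * K)) powr p \<le> (\<Sum>i<N. Lint p (h i))"
      using sum_mono[of "{..<N}" "\<lambda>_. (1 / (2 * K)) powr p" "\<lambda>i. Lint p (h i)"] layer by simp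
    also have "\<dots> = integral\<^sup>L \<I> (\<lambda>x. \<Sum>i<N. norm (h i x) powr p)"
      unfolding Lint_def using LpD(2)[OF h] by (simp add: Bochner_Integration.integral_sum)
    also have "\<dots> \<le> integral\<^sup>L \<I> (\<lambda>x. norm (f x) powr p)"
    proof (rule integral_mono)
      fix x
      have disj: "h i x = 0 \<or> h j x = 0" if "i \<noteq> j" for i j
        using that M_mono[of "Suc i" j] M_mono[of "Suc j" i]
        by (cases "i < j") (auto simp: h_def restr_def)
      have "(\<Sum>i<N. norm (h i x) powr p) = norm (\<Sum>i<N. h i x) powr p"
        using disj by (intro norm_powr_disjoint_sum[symmetric]) auto
      also have "\<dots> \<le> norm (f x) powr p"
      proof (cases "\<exists>i<N. h i x \<noteq> 0")
        case True
        then obtain i where i: "i < N" "h i x \<noteq> 0" by blast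
        then have "(\<Sum>i<N. h i x) = h i x + (\<Sum>j\<in>{..<N} - {i}. h j x)" by (intro sum.remove) auto
        also have "(\<Sum>j\<in>{..<N} - {i}. h j x) = 0" using disj i by (intro sum.neutral) auto
        finally show ?thesis using p0 by (auto simp: h_def restr_def)
      qed auto
      finally show "(\<Sum>i<N. norm (h i x) powr p) \<le> norm (f x) powr p" .
    qed (use LpD(2)[OF h] LpD(2)[OF f] in auto)
    finally have "(real N * (1 / (2 * K)) powr p) powr (1/p) \<le> Lnorm p f"
      unfolding Lnorm_eq_Lint Lint_def using p0 by (intro powr_mono2) auto
    moreover have "(real N * (1 / (2 * K)) powr p) powr (1/p) = 1 / (2 * K) * real N powr (1/p)"
      using p0 K_ge_1 by (simp only: powr_mult powr_powr) simp
    ultimately show ?thesis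
      using B by (intro exI[of _ B] exI[of _ "\<lambda>_. 1"]) (simp add: f_def)
  qed
  have "0 < 1 / (2 * K)" using K_ge_1 by simp
  then show ?thesis unfolding lower_p_estimate_def using lower by blast
qed

lemma ex_lower_p_estimate: "\<exists>\<delta>. lower_p_estimate \<delta>"
  using lower_p_estimate_less2 lower_p_estimate_ge2 by (cases "p < 2") auto

end

section \<open>The Chebyshev greedy algorithm\<close>

text \<open>Smoothness bounds ||h+u|| + ||h-u|| from above. If u is a multiple of g rotated so that
  F u >= 0, then ||h+u|| >= ||h|| + F u, and the gain passes to ||h-u||.\<close>

lemma descent_direction:
  fixes p :: real
  assumes p: "1 < p"
  obtains C where "1 \<le> C"
    "\<And>(h :: real \<Rightarrow> 'k::Lp_scalar) F g \<mu>.
      h \<in> Lp p \<Longrightarrow> norming_functional p h F \<Longrightarrow> g \<in> Lp p \<Longrightarrow> Lnorm p g \<le> 1 \<Longrightarrow> 0 \<le> \<mu> \<Longrightarrow> \<mu> \<le> 1 \<Longrightarrow>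
      \<exists>z. Lnorm p (h - z *\<^sub>F g) \<le> Lnorm p h * (1 - \<mu> * norm (F g) + C * \<mu> powr (min p 2))"
proof -
  obtain C where C: "1 \<le> C"
    "\<And>(f :: real \<Rightarrow> 'k) u \<mu>.
       f \<in> Lp p \<Longrightarrow> u \<in> Lp p \<Longrightarrow> 0 \<le> \<mu> \<Longrightarrow> \<mu> \<le> 1 \<Longrightarrow> Lnorm p u \<le> \<mu> * Lnorm p f \<Longrightarrow>
       Lnorm p (f + u) + Lnorm p (f - u) \<le> 2 * Lnorm p f * (1 + C * \<mu> powr (min p 2))"
    using Lnorm_smooth[OF p, where 'k='k] by blast
  have "\<exists>z. Lnorm p (h - z *\<^sub>F g) \<le> Lnorm p h * (1 - \<mu> * norm (F g) + 2 * C * \<mu> powr (min p 2))"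
    if h: "h \<in> Lp p" and F: "norming_functional p h F" and g: "g \<in> Lp p" "Lnorm p g \<le> 1"
      and \<mu>: "0 \<le> \<mu>" "\<mu> \<le> 1"
    for h :: "real \<Rightarrow> 'k" and F g \<mu>
  proof -
    have dual: "F \<in> Lp_dual p" and Fh: "F h = of_real (Lnorm p h)"
      using F by (auto simp: norming_functional_def)
    define w where "w = (if F g = 0 then 1 else of_real (norm (F g)) / F g)"
    have w: "norm w = 1" "w * F g = of_real (norm (F g))"
      by (auto simp: w_def norm_divide)
    define z where "z = of_real (\<mu> * Lnorm p h) * w"
    define u where "u = z *\<^sub>F g"
    have u: "u \<in> Lp p" using g by (auto simp: u_def)
    have "Lnorm p u = \<mu> * Lnorm p h * Lnorm p g"
      using p \<mu> w by (simp add: u_def z_def Lnorm_scale norm_mult)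
    also have "\<dots> \<le> \<mu> * Lnorm p h"
      using g \<mu> by (intro mult_left_le) auto
    finally have "Lnorm p (h + u) + Lnorm p (h - u) \<le> 2 * Lnorm p h * (1 + C * \<mu> powr (min p 2))"
      using C(2)[OF h u \<mu>] by simp
    moreover have "Lnorm p h + \<mu> * Lnorm p h * norm (F g) \<le> Lnorm p (h + u)"
    proof -
      have "F (h + u) = of_real (Lnorm p h) + z * F g"
        unfolding u_def using Lp_dual_add[OF dual h, of "z *\<^sub>F g"] Lp_dual_scale[OF dual g(1), of z] g Fh by auto
      also have "\<dots> = of_real (Lnorm p h + \<mu> * Lnorm p h * norm (F g))"
        by (simp add: z_def mult.assoc w)
      finally have "norm (F (h + u)) = \<bar>Lnorm p h + \<mu> * Lnorm p h * norm (F g)\<bar>"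
        by (simp only: norm_of_real)
      moreover have "norm (F (h + u)) \<le> Lnorm p (h + u)"
        using p by (intro norming_functional_bound[OF _ F] Lp_add[OF _ h u]) auto
      ultimately show ?thesis by simp
    qed
    ultimately have "Lnorm p (h - u) \<le> Lnorm p h * (1 - \<mu> * norm (F g) + 2 * C * \<mu> powr (min p 2))"
      by (simp add: algebra_simps)
    then show ?thesis by (auto simp: u_def)
  qed
  then show ?thesis using C(1) by (intro that[of "2 * C"]) auto
qed

context greedy_Lp
begin

definition descent_rate :: "real \<Rightarrow> bool" where
  "descent_rate c \<longleftrightarrow> 0 < c \<and> (\<forall>h F g \<theta>. h \<in> Lp p \<longrightarrow> norming_functional p h F \<longrightarrow>
      (g :: real \<Rightarrow> 'k) \<in> Lp p \<longrightarrow> Lnorm p g \<le> 1 \<longrightarrow> 0 < \<theta> \<longrightarrow> \<theta> \<le> norm (F g) \<longrightarrow>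
      (\<exists>z. Lnorm p (h - z *\<^sub>F g) \<le> (1 - c * \<theta> powr (min p 2 / (min p 2 - 1))) * Lnorm p h))"

lemma descent_rate_pos: "descent_rate c \<Longrightarrow> 0 < c"
  by (simp add: descent_rate_def)

lemma descent_rateD:
  fixes h g :: "real \<Rightarrow> 'k"
  assumes "descent_rate c"
    and "h \<in> Lp p" "norming_functional p h F" "g \<in> Lp p" "Lnorm p g \<le> 1" "0 < \<theta>" "\<theta> \<le> norm (F g)"
  shows "\<exists>z. Lnorm p (h - z *\<^sub>F g) \<le> (1 - c * \<theta> powr (min p 2 / (min p 2 - 1))) * Lnorm p h"
  using assms(2-) by (rule assms(1)[unfolded descent_rate_def, THEN conjunct2, rule_format])

text \<open>The step \<open>\<mu>\<close> balances the linear gain \<open>\<mu> \<theta>\<close> against the smoothness error \<open>C \<mu>\<^sup>q\<close>, \<open>q = min p 2\<close>.\<close>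

lemma ex_descent_rate: "\<exists>c. descent_rate c"
proof -
  obtain C where C: "1 \<le> C"
    "\<And>(h :: real \<Rightarrow> 'k) F g \<mu>.
      h \<in> Lp p \<Longrightarrow> norming_functional p h F \<Longrightarrow> g \<in> Lp p \<Longrightarrow> Lnorm p g \<le> 1 \<Longrightarrow> 0 \<le> \<mu> \<Longrightarrow> \<mu> \<le> 1 \<Longrightarrow>
      \<exists>z. Lnorm p (h - z *\<^sub>F g) \<le> Lnorm p h * (1 - \<mu> * norm (F g) + C * \<mu> powr (min p 2))"
    using descent_direction[OF p, where 'k='k] by blast
  define q where "q = min p 2"
  have q: "1 < q" using p by (simp add: q_def)
  define c where "c = (1 / (2 * C)) powr (1 / (q - 1)) / 2"
  have "0 < c" using C(1) by (simp add: c_def)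
  moreover have "\<exists>z. Lnorm p (h - z *\<^sub>F g) \<le> (1 - c * \<theta> powr (q / (q - 1))) * Lnorm p h"
    if h: "h \<in> Lp p" and F: "norming_functional p h F" and g: "g \<in> Lp p" "Lnorm p g \<le> 1"
      and \<theta>: "0 < \<theta>" "\<theta> \<le> norm (F g)"
    for h :: "real \<Rightarrow> 'k" and F g \<theta>
  proof -
    define \<mu> where "\<mu> = (\<theta> / (2 * C)) powr (1 / (q - 1))"
    have \<mu>0: "0 < \<mu>" using C(1) \<theta> by (simp add: \<mu>_def)
    have "norm (F g) \<le> 1"
      using norming_functional_bound[OF _ F g(1)] g(2) p by simp
    then have "\<theta> / (2 * C) \<le> 1" using \<theta> C(1) by simp
    then have \<mu>1: "\<mu> \<le> 1" unfolding \<mu>_def using q \<theta> C(1) by (intro powr_le1) auto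
    have "\<mu> powr q = \<mu> * \<mu> powr (q - 1)"
      using powr_mult_base[of \<mu> "q - 1"] \<mu>0 by simp
    also have "\<mu> powr (q - 1) = \<theta> / (2 * C)"
      unfolding \<mu>_def using q \<theta> C(1) by (simp add: powr_powr)
    finally have e1: "C * \<mu> powr q = \<mu> * \<theta> / 2" using C(1) by simp
    have "\<theta> powr (q / (q - 1)) = \<theta> * \<theta> powr (1 / (q - 1))"
      using powr_mult_base[of \<theta> "1 / (q - 1)"] \<theta> q by (simp add: field_simps)
    then have e2: "c * \<theta> powr (q / (q - 1)) = \<mu> * \<theta> / 2"
      by (simp add: c_def \<mu>_def powr_divide)
    obtain z where z: "Lnorm p (h - z *\<^sub>F g) \<le> Lnorm p h * (1 - \<mu> * norm (F g) + C * \<mu> powr q)"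
      using C(2)[OF h F g, of \<mu>] \<mu>0 \<mu>1 unfolding q_def by auto
    also have "\<dots> \<le> Lnorm p h * (1 - \<mu> * \<theta> + \<mu> * \<theta> / 2)"
      unfolding e1 using \<mu>0 \<theta> by (intro mult_left_mono) auto
    finally show ?thesis unfolding e2 by (intro exI[of _ z]) (simp add: algebra_simps)
  qed
  ultimately have "descent_rate c" unfolding descent_rate_def q_def by simp
  then show ?thesis by blast
qed

text \<open>If F g were nonzero, a descent step along g would strictly lower the norm. This is the
  orthogonality of a Chebyshev remainder to the span it was minimized over.\<close>

lemma norming_functional_vanishes:
  fixes h g :: "real \<Rightarrow> 'k"
  assumes h: "h \<in> Lp p" "0 < Lnorm p h" and F: "norming_functional p h F"
    and g: "g \<in> Lp p" "Lnorm p g \<le> 1"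
    and best: "\<And>z. Lnorm p h \<le> Lnorm p (h - z *\<^sub>F g)"
  shows "F g = 0"
proof (rule ccontr)
  assume nz: "F g \<noteq> 0"
  obtain c where c: "descent_rate c" using ex_descent_rate by blast
  obtain z where "Lnorm p (h - z *\<^sub>F g) \<le> (1 - c * norm (F g) powr (min p 2 / (min p 2 - 1))) * Lnorm p h"
    using descent_rateD[OF c h(1) F g, of "norm (F g)"] nz by auto
  also have "\<dots> < 1 * Lnorm p h"
    using descent_rate_pos[OF c] nz h(2) by (intro mult_strict_right_mono) auto
  finally show False using best[of z] by simp
qed

text \<open>A set of indices obtained from the chosen functions by injectivity of
  \<open>\<Psi>\<close>; an element chosen twice is counted once.\<close>

definition selected :: "(nat \<Rightarrow> real \<Rightarrow> 'k) \<Rightarrow> nat \<Rightarrow> nat set" where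
  "selected \<phi> m = {i. \<Psi> i \<in> \<phi> ` {..<m}}"

lemma finite_selected: "finite (selected \<phi> m)"
  using finite_vimageI[OF _ inj_Psi, of "\<phi> ` {..<m}"] by (simp add: selected_def vimage_def)

lemma selected_mono: "m \<le> n \<Longrightarrow> selected \<phi> m \<subseteq> selected \<phi> n"
  by (auto simp: selected_def)

lemma span_Psi: "finite I \<Longrightarrow> fscale.span (\<Psi> ` I) = range (\<lambda>a. comb a I)"
proof -
  assume I: "finite I"
  have inj: "inj_on \<Psi> I" using inj_Psi by (rule inj_on_subset) simp
  have "(\<Sum>v\<in>\<Psi> ` I. u v *\<^sub>F v) = comb (u \<circ> \<Psi>) I" for u
    using inj by (simp add: comb_def sum.reindex)
  moreover have "comb a I = (\<Sum>v\<in>\<Psi> ` I. (a \<circ> inv \<Psi>) v *\<^sub>F v)" for a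
    using inj inj_Psi by (simp add: comb_def sum.reindex)
  ultimately show ?thesis
    unfolding fscale.span_finite[OF finite_imageI[OF I]] by (intro equalityI image_subsetI) (blast intro: range_eqI)+
qed

end

section \<open>Runs of the weak Chebyshev greedy algorithm\<close>

locale WCGA = greedy_Lp p \<Psi> for p and \<Psi> :: "nat \<Rightarrow> real \<Rightarrow> 'k::Lp_scalar" +
  fixes \<tau> :: real and f :: "real \<Rightarrow> 'k" and \<phi> G :: "nat \<Rightarrow> real \<Rightarrow> 'k"
  assumes tau: "0 < \<tau>" and f: "f \<in> Lp p" and run: "WCGA_run p (range \<Psi>) \<tau> f \<phi> G"
begin

abbreviation rem :: "nat \<Rightarrow> real" where "rem m \<equiv> Lnorm p (f - G m)"

lemma run_0: "G 0 = 0"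
  and run_stopped: "rem n = 0 \<Longrightarrow> G (Suc n) \<in> Lp p \<and> rem (Suc n) = 0"
  and run_step: "rem n \<noteq> 0 \<Longrightarrow> \<phi> n \<in> range \<Psi> \<and>
    (\<exists>F. norming_functional p (f - G n) F \<and> norm (F (\<phi> n)) \<ge> \<tau> * (SUP g\<in>range \<Psi>. norm (F g))) \<and>
    G (Suc n) \<in> fscale.span (\<phi> ` {..n}) \<and> rem (Suc n) = Lp_dist p f (fscale.span (\<phi> ` {..n}))"
  using run[unfolded WCGA_run_def, THEN conjunct1]
    run[unfolded WCGA_run_def, THEN conjunct2, rule_format, of n]
  by (simp_all only: if_True if_False simp_thms)

text \<open>A run constrains \<open>\<phi> i\<close> only while the remainder is nonzero. Activity
  up to m guarantees that the first m choices are basis elements and that \<open>G m\<close> lies in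
  their span.\<close>

definition active :: "nat \<Rightarrow> bool" where
  "active m \<longleftrightarrow> (\<forall>i<m. rem i \<noteq> 0)"

lemma active_if_nonzero:
  assumes "rem n \<noteq> 0"
  shows "active (Suc n)"
  unfolding active_def
proof (intro allI impI notI)
  fix m assume "m < Suc n" and m: "rem m = 0"
  define Z where "Z k \<longleftrightarrow> rem k = 0" for k
  have "Z (m + d)" for d
  proof (induction d)
    case (Suc d)
    then show ?case using run_stopped[of "m + d"] by (simp add: Z_def)
  qed (use m in \<open>simp add: Z_def\<close>)
  from this[of "n - m"] show False using assms \<open>m < Suc n\<close> by (simp add: Z_def)
qed

lemma active_Suc: "active (Suc m) \<Longrightarrow> active m"
  by (simp add: active_def)

lemma active_step: "active (Suc m) \<Longrightarrow> rem m \<noteq> 0"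
  by (simp add: active_def)

lemma chosen:
  assumes "active m"
  shows "\<phi> ` {..<m} = \<Psi> ` selected \<phi> m"
proof -
  have phi: "\<phi> i \<in> range \<Psi>" if "i < m" for i
  proof -
    have "rem i \<noteq> 0" using assms that by (simp add: active_def)
    then show ?thesis by (rule run_step[THEN conjunct1])
  qed
  show ?thesis
  proof (intro equalityI subsetI)
    fix y assume y: "y \<in> \<phi> ` {..<m}"
    then obtain j where "y = \<Psi> j" using phi by blast
    with y show "y \<in> \<Psi> ` selected \<phi> m" by (simp add: selected_def)
  qed (auto simp: selected_def)
qed

lemma span_chosen:
  "active m \<Longrightarrow> fscale.span (\<phi> ` {..<m}) = range (\<lambda>a. comb a (selected \<phi> m))"
  by (simp only: chosen span_Psi[OF finite_selected])

lemma approximant_in_span: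
  assumes "active m"
  shows "G m \<in> fscale.span (\<phi> ` {..<m})"
proof (cases m)
  case 0
  then show ?thesis by (simp add: run_0 fscale.span_zero)
next
  case (Suc n)
  then show ?thesis using run_step[of n] active_step[of n] assms by (simp add: lessThan_Suc_atMost)
qed

lemma best_in_span:
  assumes "active m" and "v \<in> fscale.span (\<phi> ` {..<m})"
  shows "rem m \<le> Lnorm p (f - v)"
proof (cases m)
  case 0
  then show ?thesis using assms by (simp add: run_0)
next
  case (Suc n)
  then have "rem m = Lp_dist p f (fscale.span (\<phi> ` {..<m}))"
    using run_step[of n] active_step[of n] assms by (simp add: lessThan_Suc_atMost)
  then show ?thesis using Lp_dist_le[OF assms(2)] by simp
qed

lemma approximant_combE:
  assumes "active m"
  obtains a where "G m = comb a (selected \<phi> m)"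
  using approximant_in_span[OF assms] span_chosen[OF assms] by auto

lemma approximant_add_in_span:
  assumes "rem m \<noteq> 0"
  shows "G m + z *\<^sub>F \<phi> m \<in> fscale.span (\<phi> ` {..<Suc m})"
proof (rule fscale.span_add)
  have "active m" using active_if_nonzero[OF assms] by (rule active_Suc)
  then show "G m \<in> fscale.span (\<phi> ` {..<Suc m})"
    using approximant_in_span fscale.span_mono[of "\<phi> ` {..<m}" "\<phi> ` {..<Suc m}"] by force
  show "z *\<^sub>F \<phi> m \<in> fscale.span (\<phi> ` {..<Suc m})"
    by (intro fscale.span_scale fscale.span_base) auto
qed

lemma G_Lp: "G m \<in> Lp p"
proof (cases "\<exists>n. m = Suc n \<and> rem n = 0")
  case True
  then show ?thesis using run_stopped by blast
next
  case False
  then have "active m"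
    using active_if_nonzero[of "m - 1"] by (cases m) (auto simp: active_def)
  then show ?thesis using approximant_combE comb_Lp by metis
qed

lemma rem_Lp: "f - G m \<in> Lp p"
  using Lp_diff[OF p1 f G_Lp] .

lemma rem_antimono: "antimono rem"
proof (rule decseq_SucI)
  fix m
  show "rem (Suc m) \<le> rem m"
  proof (cases "rem m = 0")
    case True
    then show ?thesis using run_stopped by simp
  next
    case False
    then have "G m + 0 *\<^sub>F \<phi> m \<in> fscale.span (\<phi> ` {..<Suc m})"
      by (rule approximant_add_in_span)
    moreover have "f - (G m + 0 *\<^sub>F \<phi> m) = f - G m" by (simp add: fun_eq_iff)
    ultimately show ?thesis using best_in_span[OF active_if_nonzero[OF False]] by metis
  qed
qed

lemma functional_vanishes:
  assumes "rem m \<noteq> 0" and F: "norming_functional p (f - G m) F" and i: "i \<in> selected \<phi> m"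
  shows "F (\<Psi> i) = 0"
proof (rule norming_functional_vanishes[OF rem_Lp _ F])
  have act: "active m" using active_if_nonzero[OF assms(1)] by (rule active_Suc)
  show "0 < rem m" using assms(1) Lnorm_nonneg[of p "f - G m"] by linarith
  fix z
  have "\<Psi> i \<in> fscale.span (\<phi> ` {..<m})"
    using i by (auto simp: selected_def intro: fscale.span_base)
  then have "G m + z *\<^sub>F \<Psi> i \<in> fscale.span (\<phi> ` {..<m})"
    using approximant_in_span[OF act] by (intro fscale.span_add fscale.span_scale) auto
  then have "rem m \<le> Lnorm p (f - (G m + z *\<^sub>F \<Psi> i))" by (rule best_in_span[OF act])
  then show "rem m \<le> Lnorm p (f - G m - z *\<^sub>F \<Psi> i)" by (simp add: diff_diff_eq)
qed auto

lemma functional_comb: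
  "norming_functional p h F \<Longrightarrow> F (comb a S) = (\<Sum>k\<in>S. a k * F (\<Psi> k))"
  unfolding comb_def by (rule Lp_dual_sum[OF p1]) (auto simp: norming_functional_def)

text \<open>The approximant \<open>G m\<close> has no coefficients on unselected indices, so there
  the coefficients of x are those of \<open>comb x T - G m\<close>, and this element differs from
  the remainder by at most epsilon in norm. Estimates of x on unselected indices can thus be made in
  terms of the remainder.\<close>

lemma unselected_bound:
  assumes act: "rem m \<noteq> 0" and T: "finite T" and A: "A \<subseteq> T - selected \<phi> m"
    and near: "Lnorm p (f - comb x T) \<le> \<epsilon>"
  shows "\<exists>d S. finite S \<and> A \<subseteq> S \<and> (\<forall>k\<in>A. d k = x k) \<and> Lnorm p (comb d S) \<le> rem m + \<epsilon>"
proof -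
  obtain a where a: "G m = comb a (selected \<phi> m)"
    using approximant_combE active_Suc[OF active_if_nonzero[OF act]] by blast
  define S where "S = T \<union> selected \<phi> m"
  define d where "d k = (if k \<in> T then x k else 0) + (-1) * (if k \<in> selected \<phi> m then a k else 0)" for k
  have S: "finite S" using T finite_selected by (simp add: S_def)
  have "comb d S = comb x T + (-1) *\<^sub>F comb a (selected \<phi> m)"
    unfolding d_def comb_add comb_scale
    using comb_zero_outside[OF S, of T x] comb_zero_outside[OF S, of "selected \<phi> m" a]
    by (simp add: S_def)
  also have "\<dots> = (f - G m) - (f - comb x T)"
    by (simp add: a fun_eq_iff)
  finally have "Lnorm p (comb d S) \<le> rem m + Lnorm p (f - comb x T)"
    using Lnorm_triangle_diff[OF p1 rem_Lp[of m] Lp_diff[OF p1 f comb_Lp]] by simp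
  then have "Lnorm p (comb d S) \<le> rem m + \<epsilon>" using near by linarith
  moreover have "A \<subseteq> S" "\<forall>k\<in>A. d k = x k" using A by (auto simp: S_def d_def)
  ultimately show ?thesis using S by blast
qed

text \<open>For \<open>contract\<close>, F vanishes on the selected elements, so F sees the
  approximation error, the part of x on A and the rest Z only. Hence F on the part over A is at
  least half the remainder. It is also at most M, the supremum of |F| on the basis, times the sum of
  the coefficients on A, so M is at least a constant times s^(-1/p'). Weakness passes this to the
  chosen element up to tau, and the descent rate turns it into the power alpha of s.\<close>

lemma WCGA_bound_sparse:
  assumes lower: "lower_p_estimate \<delta>"
    and rate: "descent_rate c"
    and T: "finite T" and near: "Lnorm p (f - comb x T) \<le> \<epsilon>"
    and \<kappa>: "\<kappa> = c * (\<tau> / (4 * (K ^ 4 / \<delta> / (1 - 1/p)))) powr (min p 2 / (min p 2 - 1))"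
  shows "greedy_process rem (\<lambda>m. T - selected \<phi> m) (\<lambda>B. Lnorm p (comb x B)) K \<epsilon> \<kappa> (\<alpha> p)"
proof
  define W where "W = K ^ 4 / \<delta> / (1 - 1/p)"
  define \<sigma> where "\<sigma> = 1 - 1/p"
  define q where "q = min p 2 / (min p 2 - 1)"
  have W: "0 < W" using p K_ge_1 lower by (simp add: W_def lower_p_estimate_def)
  have sigma: "0 < \<sigma>" using p by (simp add: \<sigma>_def)
  \<comment> \<open>Here sigma is 1/p' and q is the conjugate exponent of \<open>min p 2\<close>: it
    equals p' for p <= 2 and 2 for p > 2.\<close>
  have alpha: "\<sigma> * q = \<alpha> p"
    using p by (auto simp: \<sigma>_def q_def \<alpha>_def conjugate_exponent_def min_def field_simps)
  have kappa: "\<kappa> = c * (\<tau> / (4 * W)) powr q" by (simp add: \<kappa> W_def q_def)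
  show eps: "0 \<le> \<epsilon>" using near Lnorm_nonneg[of p "f - comb x T"] by linarith
  show "0 < \<kappa>" using descent_rate_pos[OF rate] tau W by (simp add: kappa)
  show "1 \<le> \<alpha> p" using p by (auto simp: \<alpha>_def conjugate_exponent_def field_simps)
  show "1 \<le> K" by (rule K_ge_1)
  show "antimono rem" by (rule rem_antimono)
  show "antimono (\<lambda>m. T - selected \<phi> m)"
    using selected_mono by (intro antimonoI) blast
  show "finite (T - selected \<phi> 0)" using T by simp
  show "Lnorm p (comb x {}) = 0" by simp
  show "Lnorm p (comb x A) \<le> K * Lnorm p (comb x B)" if "A \<subseteq> B" "B \<subseteq> T - selected \<phi> 0" for A B
    using that T finite_subset[of B T] by (intro unconditional) auto
  have near_Lp: "f - comb x T \<in> Lp p" using Lp_diff[OF p1 f comb_Lp] .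
  \<comment> \<open>The selected part of \<open>comb x T\<close> competes in the minimization that
    defines \<open>G m\<close>.\<close>
  show "rem m \<le> \<epsilon> + Lnorm p (comb x (T - selected \<phi> m))" if "4 * \<epsilon> < rem m" for m
  proof -
    have "rem m \<noteq> 0" using that eps by auto
    then have act: "active m" using active_if_nonzero active_Suc by blast
    have sub: "T - (T - selected \<phi> m) \<subseteq> selected \<phi> m" by auto
    have "comb x (T - (T - selected \<phi> m)) = comb (\<lambda>k. if k \<in> T - (T - selected \<phi> m) then x k else 0) (selected \<phi> m)"
      using comb_zero_outside[OF finite_selected sub] by simp
    then have "comb x (T - (T - selected \<phi> m)) \<in> fscale.span (\<phi> ` {..<m})"
      using span_chosen[OF act] by auto
    then have "rem m \<le> Lnorm p (f - comb x (T - (T - selected \<phi> m)))"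
      by (rule best_in_span[OF act])
    also have "comb x (T - (T - selected \<phi> m)) = comb x T - comb x (T - selected \<phi> m)"
      using T by (intro comb_diff) auto
    also have "f - (comb x T - comb x (T - selected \<phi> m)) = (f - comb x T) + comb x (T - selected \<phi> m)"
      by simp
    also have "Lnorm p \<dots> \<le> Lnorm p (f - comb x T) + Lnorm p (comb x (T - selected \<phi> m))"
      by (rule Lnorm_triangle[OF p1 near_Lp comb_Lp])
    finally show ?thesis using near by linarith
  qed
  show "Lnorm p (comb x (T - selected \<phi> m)) \<le> K * (rem m + \<epsilon>)" if "4 * \<epsilon> < rem m" for m
  proof -
    have nz: "rem m \<noteq> 0" using that eps by auto
    obtain d S where d: "finite S" "T - selected \<phi> m \<subseteq> S"
      "\<forall>k\<in>T - selected \<phi> m. d k = x k" "Lnorm p (comb d S) \<le> rem m + \<epsilon>"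
      using unselected_bound[OF nz T order_refl near] by (elim exE conjE)
    have "Lnorm p (comb x (T - selected \<phi> m)) = Lnorm p (comb d (T - selected \<phi> m))"
      using d(3) by (intro arg_cong[of _ _ "Lnorm p"] comb_cong) simp
    also have "\<dots> \<le> K * Lnorm p (comb d S)" by (rule unconditional[OF d(1,2)])
    also have "\<dots> \<le> K * (rem m + \<epsilon>)" using d(4) K_ge_1 by (intro mult_left_mono) auto
    finally show ?thesis .
  qed
  show "rem (Suc m) \<le> (1 - \<kappa> / real s powr \<alpha> p) * rem m"
    if big: "4 * \<epsilon> < rem m" and A: "A \<subseteq> T - selected \<phi> m" "card A \<le> s" "1 \<le> s"
      and small: "4 * Lnorm p (comb x (T - selected \<phi> m - A)) \<le> rem m" for m A s
  proof -
    define Z where "Z = T - selected \<phi> m - A"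
    have nz: "rem m \<noteq> 0" and pos: "0 < rem m" using big eps by auto
    have act: "active (Suc m)" using nz by (rule active_if_nonzero)
    obtain F where F: "norming_functional p (f - G m) F"
      and weak: "\<tau> * (SUP g\<in>range \<Psi>. norm (F g)) \<le> norm (F (\<phi> m))"
      using run_step[OF nz, THEN conjunct2, THEN conjunct1] by (elim exE conjE)
    have phi: "\<phi> m \<in> range \<Psi>" by (rule run_step[OF nz, THEN conjunct1])
    have dual: "F \<in> Lp_dual p" and Fh: "F (f - G m) = of_real (rem m)"
      using F by (auto simp: norming_functional_def)
    define M where "M = (SUP g\<in>range \<Psi>. norm (F g))"
    have M: "norm (F (\<Psi> k)) \<le> M" for k
      unfolding M_def
    proof (rule cSUP_upper)
      show "bdd_above ((\<lambda>g. norm (F g)) ` range \<Psi>)"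
        using norming_functional_bound[OF p1 F Psi_Lp] by (intro bdd_aboveI2[of _ _ 1]) auto
    qed simp
    obtain a where a: "G m = comb a (selected \<phi> m)"
      using approximant_combE[OF active_Suc[OF act]] by blast
    have Fsel: "F (comb b I) = 0" if "I \<subseteq> selected \<phi> m" for b I
      unfolding functional_comb[OF F] using functional_vanishes[OF nz F] that
      by (intro sum.neutral) auto
    have "comb x T = comb x (T \<inter> selected \<phi> m) + (comb x Z + comb x A)"
    proof -
      have "comb x T = comb x (T \<inter> selected \<phi> m \<union> (Z \<union> A))"
        using A by (intro arg_cong[of _ _ "comb x"]) (auto simp: Z_def)
      also have "\<dots> = comb x (T \<inter> selected \<phi> m) + comb x (Z \<union> A)"
        using T A finite_subset[of A T] by (intro comb_Un) (auto simp: Z_def)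
      also have "comb x (Z \<union> A) = comb x Z + comb x A"
        using T A finite_subset[of A T] by (intro comb_Un) (auto simp: Z_def)
      finally show ?thesis .
    qed
    then have "f - G m = (f - comb x T) + (comb x (T \<inter> selected \<phi> m) + (comb x Z + (comb x A + (-1) *\<^sub>F G m)))"
      by (simp add: fun_eq_iff)
    then have "F (f - G m) = F ((f - comb x T) + (comb x (T \<inter> selected \<phi> m) + (comb x Z + (comb x A + (-1) *\<^sub>F G m))))"
      by (rule arg_cong)
    also have "\<dots> = F (f - comb x T) + (F (comb x (T \<inter> selected \<phi> m)) + (F (comb x Z) + (F (comb x A) + (-1) * F (G m))))"
      by (simp only: Lp_dual_add[OF dual] Lp_dual_scale[OF dual] Lp_add[OF p1] Lp_scale comb_Lp near_Lp G_Lp)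
    also have "\<dots> = F (f - comb x T) + F (comb x Z) + F (comb x A)"
      using Fsel[of "T \<inter> selected \<phi> m" x] Fsel[of "selected \<phi> m" a] by (simp add: a)
    finally have "norm (F (f - G m)) \<le> norm (F (f - comb x T)) + norm (F (comb x Z)) + norm (F (comb x A))"
      using norm_triangle_ineq[of "F (f - comb x T) + F (comb x Z)" "F (comb x A)"]
        norm_triangle_ineq[of "F (f - comb x T)" "F (comb x Z)"] by simp
    moreover have "norm (F (f - G m)) = rem m" by (simp add: Fh)
    moreover have "norm (F (f - comb x T)) \<le> \<epsilon>"
      using norming_functional_bound[OF p1 F near_Lp] near by simp
    moreover have "norm (F (comb x Z)) \<le> Lnorm p (comb x Z)"
      by (rule norming_functional_bound[OF p1 F comb_Lp])
    \<comment> \<open>The error epsilon and the norm of the part on Z are each at most a quarter of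
      the remainder.\<close>
    ultimately have half: "rem m / 2 \<le> norm (F (comb x A))"
      using big small by (simp add: Z_def)
    obtain d S where d: "finite S" "A \<subseteq> S" "\<forall>k\<in>A. d k = x k" "Lnorm p (comb d S) \<le> rem m + \<epsilon>"
      using unselected_bound[OF nz T A(1) near] by (elim exE conjE)
    have M0: "0 \<le> M" using M[of 0] norm_ge_zero order_trans by blast
    have "norm (F (comb x A)) \<le> (\<Sum>k\<in>A. norm (x k) * norm (F (\<Psi> k)))"
      unfolding functional_comb[OF F] by (rule order_trans[OF norm_sum]) (simp add: norm_mult)
    also have "\<dots> \<le> (\<Sum>k\<in>A. norm (x k) * M)"
      using M by (intro sum_mono mult_left_mono) auto
    also have "\<dots> = M * (\<Sum>k\<in>A. norm (d k))"
      using d(3) by (simp add: sum_distrib_left mult.commute)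
    also have "\<dots> \<le> M * (W * real (card A) powr \<sigma> * Lnorm p (comb d S))"
      using sum_coeff_bound[OF lower d(1,2), of d] M0 unfolding W_def \<sigma>_def by (intro mult_left_mono) auto
    \<comment> \<open>The factor 2 absorbs epsilon, which is smaller than the remainder.\<close>
    also have "\<dots> \<le> M * (W * real s powr \<sigma> * (2 * rem m))"
      using M0 W d(4) A(2) sigma big eps by (intro mult_left_mono mult_mono powr_mono2) auto
    finally have "rem m * 1 \<le> rem m * (M * (4 * W * real s powr \<sigma>))"
      using half by (simp add: mult_ac)
    then have "1 \<le> M * (4 * W * real s powr \<sigma>)" using pos by (rule mult_left_le_imp_le)
    then have "1 / (4 * W * real s powr \<sigma>) \<le> M"
      using W A(3) by (simp add: divide_le_eq)
    then have "\<tau> * (1 / (4 * W * real s powr \<sigma>)) \<le> \<tau> * M" using tau by (intro mult_left_mono) auto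
    also have "\<dots> \<le> norm (F (\<phi> m))" using weak by (simp add: M_def)
    finally have theta: "\<tau> / (4 * W) / real s powr \<sigma> \<le> norm (F (\<phi> m))" by simp
    have phi_Lp: "\<phi> m \<in> Lp p" "Lnorm p (\<phi> m) \<le> 1" using phi by auto
    have theta0: "0 < \<tau> / (4 * W) / real s powr \<sigma>" using tau W A(3) by simp
    obtain z where z: "Lnorm p (f - G m - z *\<^sub>F \<phi> m)
        \<le> (1 - c * (\<tau> / (4 * W) / real s powr \<sigma>) powr q) * rem m"
      using descent_rateD[OF rate rem_Lp F phi_Lp theta0 theta] unfolding q_def by blast
    have "(\<tau> / (4 * W) / real s powr \<sigma>) powr q = (\<tau> / (4 * W)) powr q / real s powr \<alpha> p"
      by (simp only: powr_divide[of "\<tau> / (4 * W)"] powr_powr alpha)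
    then have gain: "c * (\<tau> / (4 * W) / real s powr \<sigma>) powr q = \<kappa> / real s powr \<alpha> p"
      by (simp add: kappa)
    have "G m + z *\<^sub>F \<phi> m \<in> fscale.span (\<phi> ` {..<Suc m})"
      by (rule approximant_add_in_span[OF nz])
    then have "rem (Suc m) \<le> Lnorm p (f - (G m + z *\<^sub>F \<phi> m))" by (rule best_in_span[OF act])
    also have "f - (G m + z *\<^sub>F \<phi> m) = f - G m - z *\<^sub>F \<phi> m" by (simp add: diff_diff_eq)
    finally show ?thesis using z unfolding gain by linarith
  qed
qed auto

end

context greedy_Lp
begin

text \<open>The infimum defining \<open>sigma_N\<close> need not be attained. The number of steps is
  the same for every approximant with at most N terms and for every error epsilon, so approximants
  with error at most e/4 above the infimum are inserted and e is arbitrary.\<close>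

theorem WCGA_lebesgue:
  assumes tau: "0 < \<tau>"
  shows "\<exists>c>0. \<forall>N\<ge>1. \<forall>f\<in>Lp p. \<forall>\<phi> G. WCGA_run p (range \<Psi>) \<tau> f \<phi> G \<longrightarrow>
          Lnorm p (f - G (nat \<lfloor>c * real N powr \<alpha> p\<rfloor>)) \<le> 4 * sigma_N p (range \<Psi>) N f"
proof -
  obtain \<delta> where lower: "lower_p_estimate \<delta>" using ex_lower_p_estimate by blast
  obtain c where rate: "descent_rate c" using ex_descent_rate by blast
  note c = descent_rate_pos[OF rate]
  define \<kappa> where "\<kappa> = c * (\<tau> / (4 * (K ^ 4 / \<delta> / (1 - 1/p)))) powr (min p 2 / (min p 2 - 1))"
  \<comment> \<open>This is \<open>total_const\<close> with U = K, written out because it must be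
    fixed before the approximant and its error.\<close>
  define C where "C = 2 * 2 powr \<alpha> p * (ln (16 * K\<^sup>2) / \<kappa> + 1)"
  have bound: "Lnorm p (f - G (nat \<lfloor>C * real N powr \<alpha> p\<rfloor>)) \<le> 4 * \<epsilon>"
    if f: "f \<in> Lp p" and run: "WCGA_run p (range \<Psi>) \<tau> f \<phi> G"
      and T: "finite T" "card T \<le> N" "Lnorm p (f - comb x T) \<le> \<epsilon>"
    for N f \<phi> G T x \<epsilon>
  proof -
    interpret WCGA p \<Psi> \<tau> f \<phi> G by unfold_locales fact+
    interpret greedy_process rem "\<lambda>m. T - selected \<phi> m" "\<lambda>B. Lnorm p (comb x B)" K \<epsilon> \<kappa> "\<alpha> p"
      using WCGA_bound_sparse[OF lower rate T(1,3) \<kappa>_def] .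
    have "total_const = C" by (simp add: total_const_def stage_const_def C_def)
    moreover have "card (T - selected \<phi> 0) \<le> N"
      using T by (simp add: selected_def)
    ultimately show ?thesis using remainder_bound[of N] by simp
  qed
  show ?thesis
  proof (intro exI[of _ C] conjI allI impI ballI)
    have delta: "0 < \<delta>" using lower by (simp add: lower_p_estimate_def)
    have "0 < \<kappa>" using c tau K_ge_1 p delta by (simp add: \<kappa>_def)
    moreover have "1 \<le> K\<^sup>2" using K_ge_1 by simp
    then have "1 \<le> 16 * K\<^sup>2" by linarith
    ultimately show "0 < C" by (simp add: C_def add_nonneg_pos)
    fix N :: nat and f \<phi> G
    assume f: "f \<in> Lp p" and run: "WCGA_run p (range \<Psi>) \<tau> f \<phi> G"
    show "Lnorm p (f - G (nat \<lfloor>C * real N powr \<alpha> p\<rfloor>)) \<le> 4 * sigma_N p (range \<Psi>) N f"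
    proof (rule field_le_epsilon)
      fix e :: real assume e: "0 < e"
      have ne: "Sigma_N (range \<Psi>) N \<noteq> {}" using comb_in_Sigma[of "{}" N] by auto
      have bdd: "bdd_below ((\<lambda>g. Lnorm p (f - g)) ` Sigma_N (range \<Psi>) N)"
        by (rule bdd_belowI2[of _ 0]) simp
      have "sigma_N p (range \<Psi>) N f < sigma_N p (range \<Psi>) N f + e / 4" using e by simp
      then obtain g where g: "g \<in> Sigma_N (range \<Psi>) N"
        "Lnorm p (f - g) < sigma_N p (range \<Psi>) N f + e / 4"
        unfolding sigma_N_def Lp_dist_def
        using cINF_less_iff[OF ne bdd] by blast
      obtain T x where T: "finite T" "card T \<le> N" "g = comb x T" by (rule Sigma_combE[OF g(1)])
      show "Lnorm p (f - G (nat \<lfloor>C * real N powr \<alpha> p\<rfloor>)) \<le> 4 * sigma_N p (range \<Psi>) N f + e"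
        using bound[OF f run T(1,2), of x "sigma_N p (range \<Psi>) N f + e / 4"] g(2) T(3) by simp
    qed
  qed
qed

end

theorem theorem1p22:
  "\<exists>C::real. C \<ge> 1 \<and>
    (\<forall>(p::real) (\<tau>::real) (\<Psi> :: nat \<Rightarrow> real \<Rightarrow> real).
       1 < p \<longrightarrow> 0 < \<tau> \<longrightarrow> \<tau> \<le> 1 \<longrightarrow> greedy_basis p \<Psi> \<longrightarrow>
       (\<exists>c>0. \<forall>N\<ge>1. \<forall>f\<in>Lp p. \<forall>\<phi> G. WCGA_run p (range \<Psi>) \<tau> f \<phi> G \<longrightarrow>
          Lnorm p (f - G (nat \<lfloor>c * real N powr \<alpha> p\<rfloor>)) \<le> C * sigma_N p (range \<Psi>) N f)) \<and>
    (\<forall>(p::real) (\<tau>::real) (\<Psi> :: nat \<Rightarrow> real \<Rightarrow> complex).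
       1 < p \<longrightarrow> 0 < \<tau> \<longrightarrow> \<tau> \<le> 1 \<longrightarrow> greedy_basis p \<Psi> \<longrightarrow>
       (\<exists>c>0. \<forall>N\<ge>1. \<forall>f\<in>Lp p. \<forall>\<phi> G. WCGA_run p (range \<Psi>) \<tau> f \<phi> G \<longrightarrow>
          Lnorm p (f - G (nat \<lfloor>c * real N powr \<alpha> p\<rfloor>)) \<le> C * sigma_N p (range \<Psi>) N f))"
  by (rule exI[of _ 4], intro conjI allI impI)
    (simp, (rule greedy_Lp.WCGA_lebesgue[OF greedy_Lp.intro], assumption+)+)

end
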